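(* Assume the standing hypotheses (H) below. Then there exists a unique $(u,P)\in C^2([0,T];H_0^1(\Omega)\times H_0(\mathrm{Curl};\Omega))$ such that $$\mathcal{W}_1\big((u_{,tt}(t),P_{,tt}(t)),(\varphi,\Phi)\big)+\mathcal{W}_2\big((u(t),P(t)),(\varphi,\Phi)\big)=l^{(f(t),M(t))}(\varphi,\Phi)$$ for all $(\varphi,\Phi)\in H_0^1(\Omega)\times H_0(\mathrm{Curl};\Omega)$ and all $t\in[0,T]$, and $u(\cdot,0)=u_0$, $u_{,t}(\cdot,0)=\underline{u}_0$, $P(\cdot,0)=P_0$, $P_{,t}(\cdot,0)=\underline{P}_0$ in $\Omega$.
   Context: $\Omega\subset\mathbb{R}^3$ is a bounded domain with piecewise smooth boundary, $T>0$. For $X\in\mathbb{R}^{3\times3}$, $\mathrm{sym}\,X=\frac12(X+X^T)$, $\mathrm{skew}\,X=\frac12(X-X^T)$; $\langle X,Y\rangle=\mathrm{tr}(XY^T)$, $\|X\|^2=\langle X,X\rangle$; $\mathrm{Sym}(3)$ = symmetric and $\mathfrak{so}(3)$ = skew-symmetric $3\times3$ matrices. $H_0^1(\Omega)$ denotes $\mathbb{R}^3$-valued fields with components in $H^1_0(\Omega)$; for $P:\Omega\to\mathbb{R}^{3\times3}$ with rows $P_1,P_2,P_3$, $\mathrm{Curl}\,P$ is the matrix with rows $(\mathrm{curl}\,P_i)^T$, and $H_0(\mathrm{Curl};\Omega)$ is the closure of $C_0^\infty(\Omega;\mathbb{R}^{3\times3})$ in the norm $\|P\|^2_{H(\mathrm{Curl})}=\|P\|^2_{L^2}+\|\mathrm{Curl}\,P\|^2_{L^2}$.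 The product space is normed by $\|(u,P)\|^2=\|u\|^2_{H^1}+\|P\|^2_{H(\mathrm{Curl})}$; $H^{-1}(\Omega)$ and $(H_0(\mathrm{Curl};\Omega))^*$ are the dual spaces. For a constant fourth-order tensor $\mathbb{C}$, $(\mathbb{C}.X)_{ij}=\mathbb{C}_{ijkl}X_{kl}$. Standing hypotheses (H): (i) constant fourth-order tensors $\mathbb{C}_e,\mathbb{C}_{micro},\widetilde{\mathbb{C}}_e,\widetilde{\mathbb{C}}_{micro}$ (acting $\mathrm{Sym}(3)\to\mathrm{Sym}(3)$) satisfy $\mathbb{C}_{ijrs}=\mathbb{C}_{rsij}=\mathbb{C}_{jirs}$; $\mathbb{C}_c,\widetilde{\mathbb{C}}_c$ (acting $\mathfrak{so}(3)\to\mathfrak{so}(3)$) satisfy $\mathbb{C}_{ijrs}=-\mathbb{C}_{jirs}=\mathbb{C}_{rsij}$; $\mathbb{L}_{aniso},\widetilde{\mathbb{L}}_{aniso}$ (acting on $\mathbb{R}^{3\times3}$) satisfy $\mathbb{L}_{ijrs}=\mathbb{L}_{rsij}$. (ii) $\mathbb{C}_e,\mathbb{C}_{micro},\mathbb{C}_c,\mathbb{L}_{aniso}$ are bounded: $\langle\mathbb{C}.X,X\rangle\le C\|X\|^2$ on their respective domains for some constant $C\ge0$ (no sign condition). (iii) $\widetilde{\mathbb{C}}_e$ and $\widetilde{\mathbb{L}}_{aniso}$ are positive definite: there are $0<m\le M$ with $m\|X\|^2\le\langle\widetilde{\mathbb{C}}_e.X,X\rangle\le M\|X\|^2$ for $X\in\mathrm{Sym}(3)$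 and the same for $\widetilde{\mathbb{L}}_{aniso}$ on $\mathbb{R}^{3\times3}$. (iv) $\widetilde{\mathbb{C}}_{micro}$ (on $\mathrm{Sym}(3)$) and $\widetilde{\mathbb{C}}_c$ (on $\mathfrak{so}(3)$) are positive semi-definite and bounded. (v) $(f,M)\in C([0,T];H^{-1}(\Omega)\times(H_0(\mathrm{Curl};\Omega))^* )$. (vi) $(u_0,P_0),(\underline{u}_0,\underline{P}_0)\in H_0^1(\Omega)\times H_0(\mathrm{Curl};\Omega)$. (vii) $\rho,J,L_c,\mu>0$ are constants. Bilinear forms on $H_0^1(\Omega)\times H_0(\mathrm{Curl};\Omega)$: $\mathcal{W}_1((u,P),(\varphi,\Phi))=\int_\Omega\big(\rho\langle u,\varphi\rangle+J\langle P,\Phi\rangle+\langle\widetilde{\mathbb{C}}_e.\mathrm{sym}(\nabla u-P),\mathrm{sym}(\nabla\varphi-\Phi)\rangle+\langle\widetilde{\mathbb{C}}_c.\mathrm{skew}(\nabla u-P),\mathrm{skew}(\nabla\varphi-\Phi)\rangle+\langle\widetilde{\mathbb{C}}_{micro}.\mathrm{sym}P,\mathrm{sym}\Phi\rangle+\mu L_c^2\langle\widetilde{\mathbb{L}}_{aniso}.\mathrm{Curl}P,\mathrm{Curl}\Phi\rangle\big)dx$, $\mathcal{W}_2((u,P),(\varphi,\Phi))=\int_\Omega\big(\langle\mathbb{C}_e.\mathrm{sym}(\nabla u-P),\mathrm{sym}(\nabla\varphi-\Phi)\rangle+\langle\mathbb{C}_c.\mathrm{skew}(\nabla u-P),\mathrm{skew}(\nabla\varphi-\Phi)\rangle+\langle\mathbb{C}_{micro}.\mathrm{sym}P,\mathrm{sym}\Phi\rangle+\mu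 L_c^2\langle\mathbb{L}_{aniso}.\mathrm{Curl}P,\mathrm{Curl}\Phi\rangle\big)dx$, and $l^{(f,M)}(\varphi,\Phi)=\langle f,\varphi\rangle_{H^{-1},H^1_0}+\langle M,\Phi\rangle_{(H_0(\mathrm{Curl}))^*,H_0(\mathrm{Curl})}$. *)

theory Defs
  imports "HOL-Analysis.Analysis"
begin

(* Points of R^3, vector fields and matrix fields on R^3.
   A 3x3 matrix is an element of real^3^3 (rows X $ i); the inner product
   X \<bullet> Y on real^3^3 is sum_ij X_ij Y_ij = tr(X Y^T), and norm is Frobenius. *)
type_synonym pt = "real^3"
type_synonym mat = "real^3^3"
type_synonym vfield = "pt \<Rightarrow> real^3"
type_synonym mfield = "pt \<Rightarrow> mat"
type_synonym tensor4 = "real^3^3^3^3"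

(* A state (u, G, P, C) represents (u,P) in H_0^1 x H_0(Curl), with G = grad u and
   C = Curl P (the completion representation of the closure of C_0^infty). *)
type_synonym state = "vfield \<times> mfield \<times> mfield \<times> mfield"

definition msym :: "mat \<Rightarrow> mat" where
  "msym X = (1/2) *\<^sub>R (X + transpose X)"

definition mskew :: "mat \<Rightarrow> mat" where
  "mskew X = (1/2) *\<^sub>R (X - transpose X)"

definition is_sym :: "mat \<Rightarrow> bool" where
  "is_sym X \<longleftrightarrow> transpose X = X"

definition is_skew :: "mat \<Rightarrow> bool" where
  "is_skew X \<longleftrightarrow> transpose X = - X"

definition tapp :: "tensor4 \<Rightarrow> mat \<Rightarrow> mat" where
  "tapp C X = (\<chi> i j. \<Sum>k\<in>UNIV. \<Sum>l\<in>UNIV. C $ i $ j $ k $ l * X $ k $ l)"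

definition major_sym :: "tensor4 \<Rightarrow> bool" where
  "major_sym C \<longleftrightarrow> (\<forall>i j r s. C $ i $ j $ r $ s = C $ r $ s $ i $ j)"

definition sym_tensor :: "tensor4 \<Rightarrow> bool" where
  "sym_tensor C \<longleftrightarrow> major_sym C \<and> (\<forall>i j r s. C $ i $ j $ r $ s = C $ j $ i $ r $ s)"

definition skew_tensor :: "tensor4 \<Rightarrow> bool" where
  "skew_tensor C \<longleftrightarrow> major_sym C \<and> (\<forall>i j r s. C $ i $ j $ r $ s = - C $ j $ i $ r $ s)"

definition pderiv :: "(pt \<Rightarrow> 'b::real_normed_vector) \<Rightarrow> pt \<Rightarrow> 3 \<Rightarrow> 'b" where
  "pderiv F x j = frechet_derivative F (at x) (axis j 1)"

definition grad :: "vfield \<Rightarrow> mfield" where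
  "grad u x = (\<chi> i j. pderiv u x j $ i)"

(* curl v = (d2 v3 - d3 v2, d3 v1 - d1 v3, d1 v2 - d2 v1), indices 1,2,3 as in Cross3 *)
definition curlv :: "vfield \<Rightarrow> pt \<Rightarrow> real^3" where
  "curlv v x = vector [pderiv v x 2 $ 3 - pderiv v x 3 $ 2,
                       pderiv v x 3 $ 1 - pderiv v x 1 $ 3,
                       pderiv v x 1 $ 2 - pderiv v x 2 $ 1]"

definition Curl :: "mfield \<Rightarrow> mfield" where
  "Curl P x = (\<chi> i. curlv (\<lambda>y. P y $ i) x)"

fun Cn :: "nat \<Rightarrow> (pt \<Rightarrow> 'b::real_normed_vector) \<Rightarrow> bool" where
  "Cn 0 F \<longleftrightarrow> continuous_on UNIV F"
| "Cn (Suc n) F \<longleftrightarrow> (\<forall>x. F differentiable (at x)) \<and> continuous_on UNIV F \<and>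
      (\<forall>v. Cn n (\<lambda>x. frechet_derivative F (at x) v))"

definition smooth :: "(pt \<Rightarrow> 'b::real_normed_vector) \<Rightarrow> bool" where
  "smooth F \<longleftrightarrow> (\<forall>n. Cn n F)"

definition test_fun :: "pt set \<Rightarrow> (pt \<Rightarrow> 'b::real_normed_vector) \<Rightarrow> bool" where
  "test_fun \<Omega> F \<longleftrightarrow> smooth F \<and> compact (closure {x. F x \<noteq> 0}) \<and> closure {x. F x \<noteq> 0} \<subseteq> \<Omega>"

definition sqL2 :: "pt set \<Rightarrow> (pt \<Rightarrow> 'b::real_normed_vector) \<Rightarrow> ennreal" where
  "sqL2 \<Omega> F = (\<integral>\<^sup>+ x. ennreal (indicator \<Omega> x * (norm (F x))\<^sup>2) \<partial>lborel)"

definition L2 :: "pt set \<Rightarrow> (pt \<Rightarrow> 'b::{real_normed_vector, second_countable_topology}) \<Rightarrow> bool" where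
  "L2 \<Omega> F \<longleftrightarrow> (\<lambda>x. indicator \<Omega> x *\<^sub>R F x) \<in> borel_measurable lborel \<and> sqL2 \<Omega> F < \<infinity>"

definition H01 :: "pt set \<Rightarrow> vfield \<times> mfield \<Rightarrow> bool" where
  "H01 \<Omega> uG \<longleftrightarrow> L2 \<Omega> (fst uG) \<and> L2 \<Omega> (snd uG) \<and>
     (\<exists>\<phi>::nat \<Rightarrow> vfield. (\<forall>n. test_fun \<Omega> (\<phi> n)) \<and>
        ((\<lambda>n. sqL2 \<Omega> (\<lambda>x. \<phi> n x - fst uG x)) \<longlongrightarrow> 0) sequentially \<and>
        ((\<lambda>n. sqL2 \<Omega> (\<lambda>x. grad (\<phi> n) x - snd uG x)) \<longlongrightarrow> 0) sequentially)"

definition H0Curl :: "pt set \<Rightarrow> mfield \<times> mfield \<Rightarrow> bool" where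
  "H0Curl \<Omega> PC \<longleftrightarrow> L2 \<Omega> (fst PC) \<and> L2 \<Omega> (snd PC) \<and>
     (\<exists>\<Phi>::nat \<Rightarrow> mfield. (\<forall>n. test_fun \<Omega> (\<Phi> n)) \<and>
        ((\<lambda>n. sqL2 \<Omega> (\<lambda>x. \<Phi> n x - fst PC x)) \<longlongrightarrow> 0) sequentially \<and>
        ((\<lambda>n. sqL2 \<Omega> (\<lambda>x. Curl (\<Phi> n) x - snd PC x)) \<longlongrightarrow> 0) sequentially)"

definition normH1 :: "pt set \<Rightarrow> vfield \<times> mfield \<Rightarrow> real" where
  "normH1 \<Omega> uG = sqrt (enn2real (sqL2 \<Omega> (fst uG) + sqL2 \<Omega> (snd uG)))"

definition normHCurl :: "pt set \<Rightarrow> mfield \<times> mfield \<Rightarrow> real" where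
  "normHCurl \<Omega> PC = sqrt (enn2real (sqL2 \<Omega> (fst PC) + sqL2 \<Omega> (snd PC)))"

definition inX :: "pt set \<Rightarrow> state \<Rightarrow> bool" where
  "inX \<Omega> s \<longleftrightarrow> (case s of (u, G, P, C) \<Rightarrow> H01 \<Omega> (u, G) \<and> H0Curl \<Omega> (P, C))"

definition normX :: "pt set \<Rightarrow> state \<Rightarrow> real" where
  "normX \<Omega> s = (case s of (u, G, P, C) \<Rightarrow>
      sqrt ((normH1 \<Omega> (u, G))\<^sup>2 + (normHCurl \<Omega> (P, C))\<^sup>2))"

definition sdiff :: "state \<Rightarrow> state \<Rightarrow> state" where
  "sdiff s r = (case s of (u, G, P, C) \<Rightarrow> case r of (u', G', P', C') \<Rightarrow>
      (\<lambda>x. u x - u' x, \<lambda>x. G x - G' x, \<lambda>x. P x - P' x, \<lambda>x. C x - C' x))"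

definition sscale :: "real \<Rightarrow> state \<Rightarrow> state" where
  "sscale a s = (case s of (u, G, P, C) \<Rightarrow>
      (\<lambda>x. a *\<^sub>R u x, \<lambda>x. a *\<^sub>R G x, \<lambda>x. a *\<^sub>R P x, \<lambda>x. a *\<^sub>R C x))"

definition dual_H01 :: "pt set \<Rightarrow> (vfield \<times> mfield \<Rightarrow> real) \<Rightarrow> bool" where
  "dual_H01 \<Omega> f \<longleftrightarrow>
     (\<forall>a b u G v K. H01 \<Omega> (u, G) \<longrightarrow> H01 \<Omega> (v, K) \<longrightarrow>
        f (\<lambda>x. a *\<^sub>R u x + b *\<^sub>R v x, \<lambda>x. a *\<^sub>R G x + b *\<^sub>R K x) = a * f (u, G) + b * f (v, K)) \<and>
     (\<exists>K. \<forall>uG. H01 \<Omega> uG \<longrightarrow> \<bar>f uG\<bar> \<le> K * normH1 \<Omega> uG)"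

definition dual_H0Curl :: "pt set \<Rightarrow> (mfield \<times> mfield \<Rightarrow> real) \<Rightarrow> bool" where
  "dual_H0Curl \<Omega> f \<longleftrightarrow>
     (\<forall>a b P C Q D. H0Curl \<Omega> (P, C) \<longrightarrow> H0Curl \<Omega> (Q, D) \<longrightarrow>
        f (\<lambda>x. a *\<^sub>R P x + b *\<^sub>R Q x, \<lambda>x. a *\<^sub>R C x + b *\<^sub>R D x) = a * f (P, C) + b * f (Q, D)) \<and>
     (\<exists>K. \<forall>PC. H0Curl \<Omega> PC \<longrightarrow> \<bar>f PC\<bar> \<le> K * normHCurl \<Omega> PC)"

definition cont_dual :: "pt set \<Rightarrow> real \<Rightarrow> (real \<Rightarrow> vfield \<times> mfield \<Rightarrow> real)
     \<Rightarrow> (real \<Rightarrow> mfield \<times> mfield \<Rightarrow> real) \<Rightarrow> bool" where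
  "cont_dual \<Omega> T f M \<longleftrightarrow>
     (\<forall>t\<in>{0..T}. dual_H01 \<Omega> (f t) \<and> dual_H0Curl \<Omega> (M t)) \<and>
     (\<forall>t\<in>{0..T}. \<forall>\<epsilon>>0. \<exists>\<delta>>0. \<forall>s\<in>{0..T}. \<bar>s - t\<bar> < \<delta> \<longrightarrow>
        (\<forall>uG. H01 \<Omega> uG \<longrightarrow> \<bar>f s uG - f t uG\<bar> \<le> \<epsilon> * normH1 \<Omega> uG) \<and>
        (\<forall>PC. H0Curl \<Omega> PC \<longrightarrow> \<bar>M s PC - M t PC\<bar> \<le> \<epsilon> * normHCurl \<Omega> PC))"

definition has_X_deriv :: "pt set \<Rightarrow> real \<Rightarrow> (real \<Rightarrow> state) \<Rightarrow> (real \<Rightarrow> state) \<Rightarrow> bool" where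
  "has_X_deriv \<Omega> T w w' \<longleftrightarrow>
     (\<forall>t\<in>{0..T}. ((\<lambda>s. normX \<Omega> (sdiff (sscale (1 / (s - t)) (sdiff (w s) (w t))) (w' t)))
                   \<longlongrightarrow> 0) (at t within {0..T}))"

definition X_continuous :: "pt set \<Rightarrow> real \<Rightarrow> (real \<Rightarrow> state) \<Rightarrow> bool" where
  "X_continuous \<Omega> T w \<longleftrightarrow>
     (\<forall>t\<in>{0..T}. ((\<lambda>s. normX \<Omega> (sdiff (w s) (w t))) \<longlongrightarrow> 0) (at t within {0..T}))"

definition C2X :: "pt set \<Rightarrow> real \<Rightarrow> (real \<Rightarrow> state) \<Rightarrow> (real \<Rightarrow> state) \<Rightarrow> (real \<Rightarrow> state) \<Rightarrow> bool" where
  "C2X \<Omega> T w w1 w2 \<longleftrightarrow>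
     (\<forall>t\<in>{0..T}. inX \<Omega> (w t) \<and> inX \<Omega> (w1 t) \<and> inX \<Omega> (w2 t)) \<and>
     has_X_deriv \<Omega> T w w1 \<and> has_X_deriv \<Omega> T w1 w2 \<and> X_continuous \<Omega> T w2"

definition W1 :: "pt set \<Rightarrow> real \<Rightarrow> real \<Rightarrow> real \<Rightarrow> real \<Rightarrow> tensor4 \<Rightarrow> tensor4 \<Rightarrow> tensor4
     \<Rightarrow> tensor4 \<Rightarrow> state \<Rightarrow> state \<Rightarrow> real" where
  "W1 \<Omega> \<rho> J \<mu> Lc Ce Cc Cmicro Laniso s r = (case s of (u, G, P, C) \<Rightarrow> case r of (\<phi>, G\<phi>, \<Phi>, C\<Phi>) \<Rightarrow>
     (LINT x:\<Omega>|lborel.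
        \<rho> * (u x \<bullet> \<phi> x) + J * (P x \<bullet> \<Phi> x)
      + tapp Ce (msym (G x - P x)) \<bullet> msym (G\<phi> x - \<Phi> x)
      + tapp Cc (mskew (G x - P x)) \<bullet> mskew (G\<phi> x - \<Phi> x)
      + tapp Cmicro (msym (P x)) \<bullet> msym (\<Phi> x)
      + \<mu> * Lc\<^sup>2 * (tapp Laniso (C x) \<bullet> C\<Phi> x)))"

definition W2 :: "pt set \<Rightarrow> real \<Rightarrow> real \<Rightarrow> tensor4 \<Rightarrow> tensor4 \<Rightarrow> tensor4
     \<Rightarrow> tensor4 \<Rightarrow> state \<Rightarrow> state \<Rightarrow> real" where
  "W2 \<Omega> \<mu> Lc Ce Cc Cmicro Laniso s r = (case s of (u, G, P, C) \<Rightarrow> case r of (\<phi>, G\<phi>, \<Phi>, C\<Phi>) \<Rightarrow>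
     (LINT x:\<Omega>|lborel.
        tapp Ce (msym (G x - P x)) \<bullet> msym (G\<phi> x - \<Phi> x)
      + tapp Cc (mskew (G x - P x)) \<bullet> mskew (G\<phi> x - \<Phi> x)
      + tapp Cmicro (msym (P x)) \<bullet> msym (\<Phi> x)
      + \<mu> * Lc\<^sup>2 * (tapp Laniso (C x) \<bullet> C\<Phi> x)))"

definition lfm :: "(vfield \<times> mfield \<Rightarrow> real) \<Rightarrow> (mfield \<times> mfield \<Rightarrow> real) \<Rightarrow> state \<Rightarrow> real" where
  "lfm f M r = (case r of (\<phi>, G\<phi>, \<Phi>, C\<Phi>) \<Rightarrow> f (\<phi>, G\<phi>) + M (\<Phi>, C\<Phi>))"

definition is_solution where
  "is_solution \<Omega> T \<rho> J \<mu> Lc Ce Cc Cmicro Laniso Cet Cct Cmicrot Lanisot f M u0 P0 u0' P0' w \<longleftrightarrow>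
     (\<exists>w1 w2. C2X \<Omega> T w w1 w2 \<and>
       (\<forall>t\<in>{0..T}. \<forall>r. inX \<Omega> r \<longrightarrow>
          W1 \<Omega> \<rho> J \<mu> Lc Cet Cct Cmicrot Lanisot (w2 t) r + W2 \<Omega> \<mu> Lc Ce Cc Cmicro Laniso (w t) r
            = lfm (f t) (M t) r) \<and>
       (case w 0 of (u, G, P, C) \<Rightarrow>
          normH1 \<Omega> (\<lambda>x. u x - fst u0 x, \<lambda>x. G x - snd u0 x) = 0 \<and>
          normHCurl \<Omega> (\<lambda>x. P x - fst P0 x, \<lambda>x. C x - snd P0 x) = 0) \<and>
       (case w1 0 of (u, G, P, C) \<Rightarrow>
          normH1 \<Omega> (\<lambda>x. u x - fst u0' x, \<lambda>x. G x - snd u0' x) = 0 \<and>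
          normHCurl \<Omega> (\<lambda>x. P x - fst P0' x, \<lambda>x. C x - snd P0' x) = 0))"

end

theory Submission
  imports Defs
begin

text \<open>
  A state \<open>(u, \<nabla>u, P, Curl P)\<close>, extended by zero outside \<open>\<Omega>\<close>, is an element of the Hilbert space
  of square integrable functions on \<open>\<real>\<^sup>3\<close> with values in \<open>\<real>\<^sup>3 \<times> (\<real>\<^sup>3\<^sup>\<times>\<^sup>3)\<^sup>3\<close>, and \<open>H\<^sub>0\<^sup>1 \<times> H\<^sub>0(Curl)\<close> is
  the closed subspace spanned by test functions. There \<open>W1\<close> is a symmetric coercive form: \<open>J |P|\<^sup>2\<close>
  together with the term in \<open>sym (\<nabla>u - P)\<close> controls \<open>sym \<nabla>u\<close>, and Korn's inequality
  \<open>\<parallel>\<nabla>u\<parallel>\<^sup>2 \<le> 2 \<parallel>sym \<nabla>u\<parallel>\<^sup>2\<close> for test functions follows from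
  \<open>\<integral> \<Sum>ij. \<partial>\<^sub>j u\<^sub>i \<partial>\<^sub>i u\<^sub>j = \<integral> (div u)\<^sup>2\<close>. As \<open>W2\<close> is merely bounded, representing it and the load
  through \<open>W1\<close> turns the weak equation into \<open>w'' = F(t) - A w\<close> with a bounded operator \<open>A\<close>, a linear
  ordinary differential equation in a Hilbert space: existence by a weighted Picard contraction,
  uniqueness by Gronwall's argument for \<open>\<parallel>w\<parallel>\<^sup>2 + \<parallel>w'\<parallel>\<^sup>2\<close>.
\<close>

section \<open>Second order evolution equations for coercive forms\<close>

text \<open>The obstacle is that the energy density is not coercive pointwise: \<open>Cct\<close>
  may vanish, so the density sees only the symmetric part of \<open>G - P\<close>. The deficit is a
  multiple of \<open>G \<bullet> transpose G\<close>, which has no sign at a point but a nonnegative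
  integral when \<open>G\<close> is the gradient of a test function. Coercivity is therefore proved
  on test states, and as both sides are continuous it survives in the closure. Keeping
  \<open>G\<close> and \<open>C\<close> as separate components turns the graph norms into plain
  square integrals, so that the closure is taken in one L2 space and weak derivatives never appear.
  Two mismatches with the abstract setting remain. The energy space is a set and not a type, so the
  differential equation is solved in the ambient space and its solution is afterwards shown to stay
  in the subspace. And states and loads live on functions, not on classes modulo null sets: loads
  descend to classes because of their norm bound, and a solution comes back through a choice of
  representative at each time.\<close>

lemma linear_coeff_zero_if_quadratic_nonneg:
  fixes b q :: real
  assumes "\<And>t. 0 \<le> t * b + t\<^sup>2 * q"
  shows "b = 0"
proof (rule ccontr)
  assume "b \<noteq> 0"
  \<comment> \<open>Since \<open>q < k\<close>, the value at \<open>t = - b / k\<close> is negative: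
    close to zero the linear term beats the quadratic one.\<close>
  define k where "k = 1 + \<bar>q\<bar>"
  have k: "k > 0" "q < k" unfolding k_def by auto
  have "0 \<le> (- b / k) * b + (- b / k)\<^sup>2 * q" by (rule assms)
  also have "\<dots> = b\<^sup>2 / k * (q / k - 1)"
    using k by (simp add: field_simps power2_eq_square)
  finally have "0 \<le> b\<^sup>2 / k * (q / k - 1)" .
  moreover have "b\<^sup>2 / k > 0" "q / k - 1 < 0" using k \<open>b \<noteq> 0\<close> by (auto simp: field_simps)
  ultimately show False using mult_pos_neg[of "b\<^sup>2 / k" "q / k - 1"] by linarith
qed

text \<open>The representing element is the minimiser of \<open>a x x - 2 * l x\<close> over \<open>S\<close>.\<close>

lemma coercive_form_representation:
  fixes a :: "'a::{real_inner,banach} \<Rightarrow> 'a \<Rightarrow> real"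
  assumes S: "subspace S" "closed S"
    and a: "bounded_bilinear a" and sym: "\<And>x y. a x y = a y x"
    and c: "0 < c" and coercive: "\<And>x. x \<in> S \<Longrightarrow> c * (norm x)\<^sup>2 \<le> a x x"
    and l_add: "\<And>x y. x \<in> S \<Longrightarrow> y \<in> S \<Longrightarrow> l (x + y) = l x + l y"
    and l_scale: "\<And>x r. x \<in> S \<Longrightarrow> l (r *\<^sub>R x) = r * l x"
    and l_bound: "\<And>x. x \<in> S \<Longrightarrow> \<bar>l x\<bar> \<le> K * norm x"
  shows "\<exists>!x. x \<in> S \<and> (\<forall>y\<in>S. a x y = l y)"
proof -
  interpret a: bounded_bilinear a by (rule a)
  define E where "E x = a x x - 2 * l x" for x
  have low: "- (K\<^sup>2 / c) \<le> E x" if "x \<in> S" for x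
  proof -
    \<comment> \<open>Completing the square in \<open>norm x\<close> gives the lower bound of
      \<open>c * (norm x)\<^sup>2 - 2 * K * norm x\<close>.\<close>
    have "0 \<le> (c * norm x - K)\<^sup>2 / c" using c by simp
    also have "\<dots> = c * (norm x)\<^sup>2 - 2 * (K * norm x) + K\<^sup>2 / c"
      using c by (simp add: field_simps power2_eq_square)
    finally show ?thesis using coercive[OF that] l_bound[OF that] unfolding E_def by linarith
  qed
  have ne: "E ` S \<noteq> {}" using subspace_0[OF S(1)] by blast
  have bdd: "bdd_below (E ` S)" using low by (auto intro!: bdd_belowI)
  define d where "d = Inf (E ` S)"
  have d: "d \<le> E x" if "x \<in> S" for x
    unfolding d_def using bdd that by (auto intro: cInf_lower)
  have "\<exists>x\<in>S. E x < d + inverse (real (Suc n))" for n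
    using cInf_lessD[OF ne, of "d + inverse (real (Suc n))"] unfolding d_def by auto
  then obtain x where xS: "\<And>n. x n \<in> S" and xE: "\<And>n. E (x n) < d + inverse (real (Suc n))"
    by metis
  \<comment> \<open>The midpoint lies in \<open>S\<close> and has energy at least \<open>d\<close>;
    by the parallelogram identity for \<open>a\<close>, the distance of two points is then
    controlled by their excess energies. This makes a minimising sequence Cauchy.\<close>
  have parallelogram: "c * (norm (y - z))\<^sup>2 \<le> 2 * (E y - d) + 2 * (E z - d)"
    if "y \<in> S" "z \<in> S" for y z
  proof -
    have m: "(1/2) *\<^sub>R (y + z) \<in> S" using that S by (simp add: subspace_add subspace_scale)
    have "E ((1/2) *\<^sub>R (y + z)) = a (y + z) (y + z) / 4 - (l y + l z)"
      using that S l_scale[of "y + z" "1/2"]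
      by (simp add: E_def a.scaleR_left a.scaleR_right l_add subspace_add del: scaleR_add_right)
    then have "4 * d \<le> a (y + z) (y + z) - 4 * (l y + l z)" using d[OF m] by simp
    moreover have "a (y - z) (y - z) + a (y + z) (y + z) = 2 * a y y + 2 * a z z"
      by (simp add: a.diff_left a.diff_right a.add_left a.add_right)
    moreover have "c * (norm (y - z))\<^sup>2 \<le> a (y - z) (y - z)"
      using coercive that S by (simp add: subspace_diff)
    ultimately show ?thesis unfolding E_def by simp
  qed
  have "Cauchy x"
  proof (rule CauchyI)
    fix e :: real assume e: "0 < e"
    define \<epsilon> where "\<epsilon> = c * e\<^sup>2 / 4"
    have "\<epsilon> > 0" unfolding \<epsilon>_def using c e by simp
    then obtain N where N: "inverse (real (Suc N)) < \<epsilon>" using reals_Archimedean by blast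
    have "norm (x m - x n) < e" if "m \<ge> N" "n \<ge> N" for m n
    proof -
      have le: "E (x k) - d < \<epsilon>" if "k \<ge> N" for k
      proof -
        have "E (x k) - d < inverse (real (Suc k))" using xE[of k] by simp
        also have "\<dots> \<le> inverse (real (Suc N))" using that by (simp add: field_simps)
        finally show ?thesis using N by simp
      qed
      have "c * (norm (x m - x n))\<^sup>2 \<le> 2 * (E (x m) - d) + 2 * (E (x n) - d)"
        by (rule parallelogram) (rule xS)+
      also have "\<dots> < 4 * \<epsilon>"
        using add_strict_mono[OF le[OF that(1)] le[OF that(2)]] by simp
      also have "\<dots> = c * e\<^sup>2" unfolding \<epsilon>_def by simp
      finally have "(norm (x m - x n))\<^sup>2 < e\<^sup>2" using c by simp
      then show ?thesis using e by (simp add: power2_less_imp_less)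
    qed
    then show "\<exists>M. \<forall>m\<ge>M. \<forall>n\<ge>M. norm (x m - x n) < e" by blast
  qed
  then obtain z where z: "x \<longlonglongrightarrow> z" using Cauchy_convergent convergent_def by blast
  have zS: "z \<in> S" using closed_sequentially[OF S(2)] xS z by blast
  have z_eq: "a z y = l y" if y: "y \<in> S" for y
  proof -
    \<comment> \<open>First variation in direction \<open>y\<close>: moving from \<open>x n\<close>
      by \<open>t *\<^sub>R y\<close> cannot lead below \<open>d\<close>, and \<open>E (x n)\<close>
      exceeds \<open>d\<close> by less than \<open>inverse (real (Suc n))\<close>, which disappears
      in the limit.\<close>
    have "0 \<le> t * (2 * (a z y - l y)) + t\<^sup>2 * a y y" for t
    proof -
      have ge: "- inverse (real (Suc n)) \<le> t * (2 * (a (x n) y - l y)) + t\<^sup>2 * a y y" for n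
      proof -
        have ty: "t *\<^sub>R y \<in> S" using y S by (simp add: subspace_scale)
        have "d \<le> E (x n + t *\<^sub>R y)" using d xS ty S by (simp add: subspace_add)
        also have "\<dots> = E (x n) + (t * (2 * (a (x n) y - l y)) + t\<^sup>2 * a y y)"
          unfolding E_def using y xS[of n] ty sym[of y "x n"]
          by (simp add: a.add_left a.add_right a.scaleR_left a.scaleR_right l_add l_scale
              power2_eq_square algebra_simps)
        finally show ?thesis using xE[of n] by simp
      qed
      have lim: "(\<lambda>n. t * (2 * (a (x n) y - l y)) + t\<^sup>2 * a y y)
          \<longlonglongrightarrow> t * (2 * (a z y - l y)) + t\<^sup>2 * a y y"
        by (intro tendsto_intros a.tendsto z)
      have "(\<lambda>n. - inverse (real (Suc n))) \<longlonglongrightarrow> - 0"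
        by (intro tendsto_minus LIMSEQ_inverse_real_of_nat)
      from LIMSEQ_le[OF this lim] show ?thesis using ge by simp
    qed
    from linear_coeff_zero_if_quadratic_nonneg[OF this] show ?thesis by simp
  qed
  have "z' = z" if "z' \<in> S" "\<forall>y\<in>S. a z' y = l y" for z'
  proof -
    have dS: "z' - z \<in> S" using S zS that by (simp add: subspace_diff)
    have "c * (norm (z' - z))\<^sup>2 \<le> a (z' - z) (z' - z)" by (rule coercive[OF dS])
    also have "\<dots> = 0" using dS that z_eq by (simp add: a.diff_left)
    finally show ?thesis using c by (simp add: mult_le_0_iff)
  qed
  then show ?thesis using zS z_eq by blast
qed

text \<open>The component \<open>q\<close> of \<open>w t\<close> orthogonal to \<open>S\<close> is
  orthogonal to every velocity, so \<open>q \<bullet> w s\<close> is constant in \<open>s\<close>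
  and equals its value 0 at the start; hence \<open>q \<bullet> q = 0\<close>. The orthogonal
  projection comes from the representation lemma applied to the inner product itself.\<close>

lemma vector_derivative_in_closed_subspace:
  fixes w :: "real \<Rightarrow> 'a::{real_inner,banach}"
  assumes S: "subspace S" "closed S"
    and w': "\<And>t. t \<in> {0..T} \<Longrightarrow> (w has_vector_derivative v t) (at t within {0..T})"
    and v: "\<And>t. t \<in> {0..T} \<Longrightarrow> v t \<in> S" and w0: "w 0 \<in> S" and t: "t \<in> {0..T}"
  shows "w t \<in> S"
proof -
  have "\<exists>!p. p \<in> S \<and> (\<forall>y\<in>S. p \<bullet> y = w t \<bullet> y)"
    by (rule coercive_form_representation[OF S bounded_bilinear_inner, where c = 1 and K = "norm (w t)"])
      (auto simp: inner_commute power2_norm_eq_inner inner_add_left inner_add_right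
        intro: order_trans[OF Cauchy_Schwarz_ineq2])
  then obtain p where p: "p \<in> S" "\<And>y. y \<in> S \<Longrightarrow> p \<bullet> y = w t \<bullet> y" by blast
  define q where "q = w t - p"
  have q: "q \<bullet> y = 0" if "y \<in> S" for y using p that unfolding q_def by (simp add: inner_diff_left)
  have "((\<lambda>s. q \<bullet> w s) has_derivative (\<lambda>h. 0)) (at s within {0..T})" if s: "s \<in> {0..T}" for s
    using bounded_linear.has_vector_derivative[OF bounded_linear_inner_right w'[OF s], of q] q[OF v[OF s]]
    by (simp add: has_vector_derivative_def)
  then obtain k where "\<And>s. s \<in> {0..T} \<Longrightarrow> q \<bullet> w s = k"
    using has_derivative_zero_constant[of "{0..T}" "\<lambda>s. q \<bullet> w s"] by auto
  then have "q \<bullet> w t = q \<bullet> w 0" using t by auto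
  then have "q \<bullet> q = 0" using q[OF w0] q[OF p(1)] unfolding q_def by (simp add: inner_diff_right)
  then show ?thesis using p unfolding q_def by simp
qed

text \<open>Picard iteration is a contraction on all of \<open>{0..T}\<close> for the norm weighted by
  \<open>exp (- \<kappa> t)\<close> with \<open>\<kappa>\<close> large; the weight is absorbed into the unknown.\<close>

lemma linear_ode_exists:
  fixes L :: "'z::banach \<Rightarrow> 'z"
  assumes L: "bounded_linear L" and F: "continuous_on {0..T} F" and T: "0 \<le> T"
  shows "\<exists>z. z 0 = z0 \<and>
    (\<forall>t\<in>{0..T}. (z has_vector_derivative (L (z t) + F t)) (at t within {0..T}))"
proof -
  interpret L: bounded_linear L by (rule L)
  obtain K where K: "K > 0" "\<And>x. norm (L x) \<le> norm x * K" using L.pos_bounded by blast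
  \<comment> \<open>Integrating the weight contributes a factor \<open>1 / \<kappa>\<close> against
    the Lipschitz constant \<open>K\<close>, so \<open>2 * K\<close> yields the contraction constant
    1/2.\<close>
  define \<kappa> where "\<kappa> = 2 * K"
  have \<kappa>: "\<kappa> > 0" unfolding \<kappa>_def using K by simp
  \<comment> \<open>Elements of \<open>bcontfun\<close> are functions on the whole type, so times
    are clamped to \<open>{0..T}\<close> and the Picard iterate is continued constantly
    outside.\<close>
  define cl where "cl t = max 0 (min T t)" for t
  have cl: "cl t \<in> {0..T}" for t unfolding cl_def using T by auto
  have cl_id: "cl t = t" if "t \<in> {0..T}" for t using that unfolding cl_def by auto
  have cl_cont: "continuous_on UNIV cl" unfolding cl_def by (intro continuous_intros)
  define G where "G z s = exp (\<kappa> * s) *\<^sub>R L (apply_bcontfun z s) + F s" for z s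
  have G_cont: "continuous_on {0..T} (G z)" for z
    unfolding G_def by (intro continuous_intros F L.continuous_on continuous_on_apply_bcontfun)
  have G_int: "G z integrable_on {0..cl t}" for z t
    by (rule integrable_continuous_real, rule continuous_on_subset[OF G_cont]) (use cl in auto)
  define I where "I z t = exp (- \<kappa> * t) *\<^sub>R (z0 + integral {0..t} (G z))" for z t
  have I_cont: "continuous_on {0..T} (I z)" for z
    unfolding I_def
    by (intro continuous_intros indefinite_integral_continuous_1 integrable_continuous_real G_cont)
  have I_bc: "(\<lambda>t. I z (cl t)) \<in> bcontfun" for z
  proof -
    have "compact (I z ` {0..T})" by (intro compact_continuous_image I_cont compact_Icc)
    then obtain B where "\<forall>y\<in>I z ` {0..T}. norm y \<le> B" using compact_imp_bounded bounded_iff by metis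
    then have "norm (I z (cl t)) \<le> B" for t using cl by blast
    moreover have "continuous_on UNIV (\<lambda>t. I z (cl t))"
      by (rule continuous_on_compose2[OF I_cont cl_cont]) (use cl in auto)
    ultimately show ?thesis by (rule bcontfun_normI[rotated])
  qed
  define \<Phi> where "\<Phi> z = Bcontfun (\<lambda>t. I z (cl t))" for z
  have \<Phi>: "apply_bcontfun (\<Phi> z) t = I z (cl t)" for z t
    unfolding \<Phi>_def using Bcontfun_inverse[OF I_bc] by simp
  have contr: "dist (\<Phi> z) (\<Phi> y) \<le> 1/2 * dist z y" for z y
  proof (rule dist_bound)
    fix t
    define \<tau> where "\<tau> = cl t"
    have \<tau>: "\<tau> \<ge> 0" "\<tau> \<le> T" using cl[of t] unfolding \<tau>_def by auto
    define D where "D = dist z y"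
    have exp_int: "((\<lambda>s. exp (\<kappa> * s) * (K * D)) has_integral
        (exp (\<kappa> * \<tau>) * (K * D) / \<kappa> - exp (\<kappa> * 0) * (K * D) / \<kappa>)) {0..\<tau>}"
      by (rule fundamental_theorem_of_calculus[OF \<tau>(1)])
        (use \<kappa> in \<open>auto intro!: derivative_eq_intros
          simp: has_real_derivative_iff_has_vector_derivative[symmetric]\<close>)
    have "dist (I z \<tau>) (I y \<tau>) = exp (- \<kappa> * \<tau>) * norm (integral {0..\<tau>} (\<lambda>s. G z s - G y s))"
      unfolding I_def dist_norm using G_int[of _ t, folded \<tau>_def]
      by (subst integral_diff) (auto simp: scaleR_diff_right[symmetric])
    also have "norm (integral {0..\<tau>} (\<lambda>s. G z s - G y s)) \<le> integral {0..\<tau>} (\<lambda>s. exp (\<kappa> * s) * (K * D))"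
    proof (rule integral_norm_bound_integral)
      show "(\<lambda>s. G z s - G y s) integrable_on {0..\<tau>}"
        using G_int[of _ t, folded \<tau>_def] by (intro integrable_diff)
      show "(\<lambda>s. exp (\<kappa> * s) * (K * D)) integrable_on {0..\<tau>}" using exp_int by blast
      fix s assume "s \<in> {0..\<tau>}"
      have "norm (G z s - G y s) = exp (\<kappa> * s) * norm (L (apply_bcontfun z s - apply_bcontfun y s))"
        unfolding G_def by (simp add: L.diff scaleR_diff_right[symmetric])
      also have "norm (L (apply_bcontfun z s - apply_bcontfun y s)) \<le> K * D"
        using K(2)[of "apply_bcontfun z s - apply_bcontfun y s"] dist_bounded[of z s y] K(1)
        unfolding D_def dist_norm[symmetric]
        by (smt (verit) mult.commute mult_left_mono)
      finally show "norm (G z s - G y s) \<le> exp (\<kappa> * s) * (K * D)" by simp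
    qed
    also have "integral {0..\<tau>} (\<lambda>s. exp (\<kappa> * s) * (K * D)) = (exp (\<kappa> * \<tau>) - 1) * (D / 2)"
      using integral_unique[OF exp_int] K(1) unfolding \<kappa>_def by (simp add: field_simps)
    also have "exp (- \<kappa> * \<tau>) * ((exp (\<kappa> * \<tau>) - 1) * (D / 2)) = (1 - exp (- \<kappa> * \<tau>)) * (D / 2)"
      by (simp add: algebra_simps exp_minus)
    also have "\<dots> \<le> 1 * (D / 2)" unfolding D_def by (intro mult_right_mono) auto
    finally show "dist (apply_bcontfun (\<Phi> z) t) (apply_bcontfun (\<Phi> y) t) \<le> 1/2 * dist z y"
      unfolding \<Phi> \<tau>_def D_def by simp
  qed
  have "\<exists>!z. \<Phi> z = z"
    using banach_fix_type[of "1/2" \<Phi>] contr by simp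
  then obtain y where y: "\<Phi> y = y" by blast
  define z where "z t = z0 + integral {0..t} (G y)" for t
  have z: "exp (\<kappa> * t) *\<^sub>R apply_bcontfun y t = z t" if "t \<in> {0..T}" for t
  proof -
    have "apply_bcontfun y t = I y t" using \<Phi>[of y t] y cl_id[OF that] by simp
    then show ?thesis unfolding I_def z_def by (simp add: exp_minus)
  qed
  have "(z has_vector_derivative (L (z t) + F t)) (at t within {0..T})" if t: "t \<in> {0..T}" for t
  proof -
    have "((\<lambda>u. integral {0..u} (G y)) has_vector_derivative G y t) (at t within {0..T})"
      by (rule integral_has_vector_derivative[OF G_cont t])
    moreover have "G y t = L (z t) + F t"
      unfolding G_def z[OF t, symmetric] by (simp add: L.scaleR)
    ultimately show ?thesis unfolding z_def by (auto intro!: derivative_eq_intros)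
  qed
  moreover have "z 0 = z0" unfolding z_def by simp
  ultimately show ?thesis by blast
qed

section \<open>The abstract equation a(w'', r) + b(w, r) = l(t, r) on a closed subspace\<close>

locale coercive_evolution =
  fixes S :: "'a::{real_inner,banach} set" and a b :: "'a \<Rightarrow> 'a \<Rightarrow> real" and c :: real
  assumes S: "subspace S" "closed S"
    and a: "bounded_bilinear a" and b: "bounded_bilinear b"
    and a_sym: "\<And>x y. a x y = a y x"
    and c: "0 < c" and coercive: "\<And>x. x \<in> S \<Longrightarrow> c * (norm x)\<^sup>2 \<le> a x x"
begin

interpretation a: bounded_bilinear a by (rule a)
interpretation b: bounded_bilinear b by (rule b)

text \<open>Coercivity with one factor \<open>norm x\<close> cancelled. It bounds the element that
  represents a functional of norm at most \<open>B\<close>.\<close>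

lemma norm_le_if_form_bounded:
  assumes "x \<in> S" and "a x x \<le> B * norm x" and "0 \<le> B"
  shows "c * norm x \<le> B"
proof (cases "x = 0")
  case False
  have "(c * norm x) * norm x \<le> B * norm x"
    using coercive[OF assms(1)] assms(2) by (simp add: power2_eq_square mult.assoc)
  then show ?thesis using False by simp
qed (use assms in simp)

text \<open>Stated for zero load and zero initial data because it is applied to the difference of
  two solutions.\<close>

lemma evolution_unique:
  assumes w: "\<And>t. t \<in> {0..T} \<Longrightarrow> (w has_vector_derivative w1 t) (at t within {0..T})"
    and w1: "\<And>t. t \<in> {0..T} \<Longrightarrow> (w1 has_vector_derivative w2 t) (at t within {0..T})"
    and w2S: "\<And>t. t \<in> {0..T} \<Longrightarrow> w2 t \<in> S"
    and eq: "\<And>t r. t \<in> {0..T} \<Longrightarrow> r \<in> S \<Longrightarrow> a (w2 t) r + b (w t) r = 0"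
    and "w 0 = 0" "w1 0 = 0" and t: "t \<in> {0..T}"
  shows "w t = 0"
proof -
  obtain K where K: "K > 0" "\<And>x y. norm (b x y) \<le> norm x * norm y * K"
    using b.pos_bounded by blast
  \<comment> \<open>Testing the equation with \<open>w2 s\<close> itself bounds the acceleration by
    the displacement, whatever the sign of \<open>b\<close>.\<close>
  have w2: "norm (w2 s) \<le> K / c * norm (w s)" if s: "s \<in> {0..T}" for s
  proof -
    have "a (w2 s) (w2 s) \<le> (K * norm (w s)) * norm (w2 s)"
      using eq[OF s w2S[OF s]] K(2)[of "w s" "w2 s"] by (simp add: mult_ac)
    then have "c * norm (w2 s) \<le> K * norm (w s)"
      using norm_le_if_form_bounded[OF w2S[OF s]] K(1) by simp
    then show ?thesis using c by (simp add: field_simps)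
  qed
  \<comment> \<open>Both terms of \<open>\<phi>'\<close> are bounded by multiples of
    \<open>2 * norm (w s) * norm (w1 s)\<close>: the factor 1 belongs to
    \<open>w \<bullet> w1\<close>, the factor \<open>K / c\<close> to
    \<open>w1 \<bullet> w2\<close>.\<close>
  define k where "k = 1 + K / c"
  define \<phi> where "\<phi> s = w s \<bullet> w s + w1 s \<bullet> w1 s" for s
  define \<phi>' where "\<phi>' s = 2 * (w s \<bullet> w1 s) + 2 * (w1 s \<bullet> w2 s)" for s
  have \<phi>': "(\<phi> has_real_derivative \<phi>' s) (at s within {0..T})" if s: "s \<in> {0..T}" for s
    unfolding \<phi>_def \<phi>'_def has_real_derivative_iff_has_vector_derivative
    by (rule derivative_eq_intros bounded_bilinear.has_vector_derivative[OF bounded_bilinear_inner] 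
        w[OF s] w1[OF s])+ (simp add: inner_commute)
  have \<phi>'_le: "\<phi>' s \<le> k * \<phi> s" if s: "s \<in> {0..T}" for s
  proof -
    have "w s \<bullet> w1 s \<le> norm (w s) * norm (w1 s)" by (rule norm_cauchy_schwarz)
    moreover have "w1 s \<bullet> w2 s \<le> norm (w1 s) * (K / c * norm (w s))"
      using norm_cauchy_schwarz[of "w1 s" "w2 s"] mult_left_mono[OF w2[OF s], of "norm (w1 s)"] by simp
    ultimately have "\<phi>' s \<le> 2 * (norm (w s) * norm (w1 s)) + 2 * (norm (w1 s) * (K / c * norm (w s)))"
      unfolding \<phi>'_def by linarith
    also have "\<dots> = k * (2 * (norm (w s) * norm (w1 s)))"
      unfolding k_def by (simp add: algebra_simps)
    also have "\<dots> \<le> k * ((norm (w s))\<^sup>2 + (norm (w1 s))\<^sup>2)"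
      using K(1) c sum_squares_bound[of "norm (w s)" "norm (w1 s)"]
      by (intro mult_left_mono) (auto simp: k_def)
    finally show ?thesis unfolding \<phi>_def by (simp add: power2_norm_eq_inner)
  qed
  \<comment> \<open>Gronwall by integrating factor: \<open>\<phi>' \<le> k * \<phi>\<close> makes
    \<open>exp (- k * s) * \<phi> s\<close> nonincreasing.\<close>
  have "exp (- k * t) * \<phi> t \<le> exp (- k * 0) * \<phi> 0"
  proof (rule DERIV_nonpos_imp_decreasing_open[where f = "\<lambda>s. exp (- k * s) * \<phi> s"])
    fix s assume s: "0 < s" "s < t"
    then have s': "s \<in> {0..T}" "at s within {0..T} = at s"
      using t by (auto intro: at_within_interior)
    have "((\<lambda>s. exp (- k * s) * \<phi> s) has_real_derivative exp (- k * s) * (\<phi>' s - k * \<phi> s)) (at s)"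
      using \<phi>'[OF s'(1)] unfolding s'(2)
      by (auto intro!: derivative_eq_intros simp: algebra_simps)
    then show "\<exists>y. ((\<lambda>s. exp (- k * s) * \<phi> s) has_real_derivative y) (at s) \<and> y \<le> 0"
      using \<phi>'_le[OF s'(1)] by (auto simp: mult_le_0_iff)
  next
    have "continuous_on {0..T} \<phi>"
      using \<phi>' by (meson DERIV_continuous continuous_on_eq_continuous_within)
    then show "continuous_on {0..t} (\<lambda>s. exp (- k * s) * \<phi> s)"
      using t by (intro continuous_intros) (auto intro: continuous_on_subset)
  qed (use t in auto)
  then have "\<phi> t \<le> 0" using assms by (simp add: \<phi>_def mult_le_0_iff)
  then show ?thesis unfolding \<phi>_def
    by (smt (verit) inner_ge_zero inner_eq_zero_iff)
qed

lemma evolution_exists: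
  fixes l :: "real \<Rightarrow> 'a \<Rightarrow> real"
  assumes T: "0 \<le> T" and x0: "x0 \<in> S" "v0 \<in> S"
    and l_add: "\<And>t x y. t \<in> {0..T} \<Longrightarrow> x \<in> S \<Longrightarrow> y \<in> S \<Longrightarrow> l t (x + y) = l t x + l t y"
    and l_scale: "\<And>t x r. t \<in> {0..T} \<Longrightarrow> x \<in> S \<Longrightarrow> l t (r *\<^sub>R x) = r * l t x"
    and l_bound: "\<And>t. t \<in> {0..T} \<Longrightarrow> \<exists>K. \<forall>x\<in>S. \<bar>l t x\<bar> \<le> K * norm x"
    and l_cont: "\<And>t \<epsilon>. t \<in> {0..T} \<Longrightarrow> 0 < \<epsilon> \<Longrightarrow>
      \<exists>\<delta>>0. \<forall>s\<in>{0..T}. \<bar>s - t\<bar> < \<delta> \<longrightarrow> (\<forall>x\<in>S. \<bar>l s x - l t x\<bar> \<le> \<epsilon> * norm x)"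
  shows "\<exists>w w1 w2. (\<forall>t\<in>{0..T}. w t \<in> S \<and> w1 t \<in> S \<and> w2 t \<in> S
      \<and> (w has_vector_derivative w1 t) (at t within {0..T})
      \<and> (w1 has_vector_derivative w2 t) (at t within {0..T})
      \<and> (\<forall>r\<in>S. a (w2 t) r + b (w t) r = l t r))
    \<and> continuous_on {0..T} w2 \<and> w 0 = x0 \<and> w1 0 = v0"
proof -
  have ex_A: "\<exists>!z. z \<in> S \<and> (\<forall>y\<in>S. a z y = b x y)" for x
  proof -
    obtain K where "\<And>x y. norm (b x y) \<le> norm x * norm y * K" using b.pos_bounded by blast
    then have "\<bar>b x y\<bar> \<le> K * norm x * norm y" for y by (metis mult.commute mult.left_commute real_norm_def)
    then show ?thesis
      by (intro coercive_form_representation[OF S a a_sym c coercive, where K = "K * norm x"])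
        (auto simp: b.add_right b.scaleR_right)
  qed
  \<comment> \<open>\<open>A\<close> is defined on the whole ambient space and takes its values in
    \<open>S\<close>; uniqueness of the representing element makes it linear.\<close>
  define A where "A x = (THE z. z \<in> S \<and> (\<forall>y\<in>S. a z y = b x y))" for x
  have AS: "A x \<in> S" and A: "y \<in> S \<Longrightarrow> a (A x) y = b x y" for x y
    using theI'[OF ex_A, of x] unfolding A_def by blast+
  have A_eq: "A x = z" if "z \<in> S" "\<forall>y\<in>S. a z y = b x y" for x z
    unfolding A_def using ex_A that by (intro the1_equality) auto
  have "bounded_linear A"
  proof -
    obtain K where K: "K > 0" "\<And>x y. norm (b x y) \<le> norm x * norm y * K" using b.pos_bounded by blast
    show ?thesis
    proof (rule bounded_linear_intro)
      show "A (x + y) = A x + A y" for x y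
        using A_eq[of "A x + A y" "x + y"] AS A S
        by (simp add: subspace_add a.add_left b.add_left)
      show "A (r *\<^sub>R x) = r *\<^sub>R A x" for r x
        using A_eq[of "r *\<^sub>R A x" "r *\<^sub>R x"] AS A S
        by (simp add: subspace_scale a.scaleR_left b.scaleR_left)
      show "norm (A x) \<le> norm x * (K / c)" for x
      proof -
        have "a (A x) (A x) \<le> (K * norm x) * norm (A x)"
          using K(2)[of x "A x"] A[OF AS, of x x] by (simp add: mult_ac)
        then have "c * norm (A x) \<le> K * norm x" using norm_le_if_form_bounded[OF AS] K(1) by simp
        then show ?thesis using c by (simp add: field_simps)
      qed
    qed
  qed
  then interpret A: bounded_linear A .
  have "\<exists>z. z \<in> S \<and> (\<forall>y\<in>S. a z y = l t y)" if t: "t \<in> {0..T}" for t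
  proof -
    obtain K where "\<forall>x\<in>S. \<bar>l t x\<bar> \<le> K * norm x" using l_bound[OF t] by blast
    then show ?thesis
      by (intro ex1_implies_ex coercive_form_representation[OF S a a_sym c coercive, where K = K])
        (auto simp: l_add[OF t] l_scale[OF t])
  qed
  then obtain F where FS: "\<And>t. t \<in> {0..T} \<Longrightarrow> F t \<in> S"
    and F: "\<And>t y. t \<in> {0..T} \<Longrightarrow> y \<in> S \<Longrightarrow> a (F t) y = l t y"
    using bchoice[of "{0..T}" "\<lambda>t z. z \<in> S \<and> (\<forall>y\<in>S. a z y = l t y)"] by blast
  have F_cont: "continuous_on {0..T} F"
    unfolding continuous_on_iff dist_norm
  proof (intro ballI allI impI)
    fix t e :: real assume t: "t \<in> {0..T}" and e: "0 < e"
    \<comment> \<open>\<open>F s - F t\<close> represents \<open>l s - l t\<close>, so a bound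
      \<open>c * e / 2\<close> for the functionals becomes \<open>e / 2\<close> after division by
      the coercivity constant.\<close>
    have "0 < c * e / 2" using c e by simp
    from l_cont[OF t this] obtain \<delta> where \<delta>: "\<delta> > 0" "\<And>s x. s \<in> {0..T} \<Longrightarrow> \<bar>s - t\<bar> < \<delta> \<Longrightarrow> x \<in> S
        \<Longrightarrow> \<bar>l s x - l t x\<bar> \<le> c * e / 2 * norm x" by blast
    have "norm (F s - F t) < e" if s: "s \<in> {0..T}" "norm (s - t) < \<delta>" for s
    proof -
      have D: "F s - F t \<in> S" using FS s t S by (simp add: subspace_diff)
      have "a (F s - F t) (F s - F t) = l s (F s - F t) - l t (F s - F t)"
        using F[OF s(1) D] F[OF t D] by (simp add: a.diff_left)
      also have "\<dots> \<le> c * e / 2 * norm (F s - F t)"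
        using order_trans[OF abs_ge_self \<delta>(2)[OF s(1) _ D]] s(2) by simp
      finally have "c * norm (F s - F t) \<le> c * e / 2"
        by (rule norm_le_if_form_bounded[OF D]) (use c e in simp)
      then show ?thesis using c e by simp
    qed
    then show "\<exists>d>0. \<forall>x'\<in>{0..T}. norm (x' - t) < d \<longrightarrow> norm (F x' - F t) < e"
      using \<delta>(1) by blast
  qed
  \<comment> \<open>The first order system for the pair of position and velocity.\<close>
  define L where "L p = (snd p, - A (fst p))" for p :: "'a \<times> 'a"
  have "bounded_linear L"
    unfolding L_def by (intro bounded_linear_Pair bounded_linear_snd bounded_linear_minus
      bounded_linear_compose[OF A.bounded_linear bounded_linear_fst, unfolded o_def])
  moreover have "continuous_on {0..T} (\<lambda>t. (0::'a, F t))" by (intro continuous_intros F_cont)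
  ultimately obtain z where z0: "z 0 = (x0, v0)"
    and z: "\<And>t. t \<in> {0..T} \<Longrightarrow>
      (z has_vector_derivative (L (z t) + (0, F t))) (at t within {0..T})"
    using linear_ode_exists[of L T "\<lambda>t. (0, F t)" "(x0, v0)"] T by blast
  define w w1 w2 where "w t = fst (z t)" and "w1 t = snd (z t)" and "w2 t = F t - A (fst (z t))" for t
  have w: "(w has_vector_derivative w1 t) (at t within {0..T})"
    and w1: "(w1 has_vector_derivative w2 t) (at t within {0..T})" if "t \<in> {0..T}" for t
    using bounded_linear.has_vector_derivative[OF bounded_linear_fst z[OF that]]
      bounded_linear.has_vector_derivative[OF bounded_linear_snd z[OF that]]
    unfolding w_def w1_def w2_def L_def by auto
  have w2S: "w2 t \<in> S" if "t \<in> {0..T}" for t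
    unfolding w2_def using S FS[OF that] AS by (simp add: subspace_diff)
  \<comment> \<open>The acceleration lies in \<open>S\<close> by its formula, wherever
    \<open>w\<close> may be, since \<open>A\<close> maps everything into \<open>S\<close>. This
    confines the velocity, and the velocity in turn confines the position.\<close>
  have w1S: "w1 t \<in> S" if "t \<in> {0..T}" for t
    by (rule vector_derivative_in_closed_subspace[OF S w1 w2S _ that]) (use x0 z0 in \<open>auto simp: w1_def\<close>)
  have wS: "w t \<in> S" if "t \<in> {0..T}" for t
    by (rule vector_derivative_in_closed_subspace[OF S w w1S _ that]) (use x0 z0 in \<open>auto simp: w_def\<close>)
  have "continuous_on {0..T} w"
    using w by (meson continuous_on_eq_continuous_within has_vector_derivative_continuous)
  then have "continuous_on {0..T} w2"
    unfolding w2_def w_def[symmetric] by (intro continuous_intros F_cont A.continuous_on)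
  moreover have "a (w2 t) r + b (w t) r = l t r" if "t \<in> {0..T}" "r \<in> S" for t r
    using F[OF that] A[OF that(2)] unfolding w2_def w_def by (simp add: a.diff_left)
  moreover have "w 0 = x0" "w1 0 = v0" using z0 by (auto simp: w_def w1_def)
  ultimately show ?thesis
    using w w1 wS w1S w2S by (intro exI[of _ w] exI[of _ w1] exI[of _ w2] conjI ballI)
qed

end

section \<open>The Hilbert space of square integrable functions\<close>

definition square_integrable :: "('a::euclidean_space \<Rightarrow> 'b::euclidean_space) \<Rightarrow> bool" where
  "square_integrable f \<longleftrightarrow> f \<in> borel_measurable borel \<and> integrable lborel (\<lambda>x. (norm (f x))\<^sup>2)"

lemma square_integrableD [measurable_dest]: "square_integrable f \<Longrightarrow> f \<in> borel_measurable borel"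
  by (simp add: square_integrable_def)

lemma square_integrable_iff_nn_integral:
  "square_integrable f \<longleftrightarrow>
    f \<in> borel_measurable borel \<and> (\<integral>\<^sup>+x. ennreal ((norm (f x))\<^sup>2) \<partial>lborel) < \<infinity>"
  unfolding square_integrable_def by (auto simp: integrable_iff_bounded)

lemma square_integrable_bounded_by:
  assumes "f \<in> borel_measurable borel" "integrable lborel g" "\<And>x. (norm (f x))\<^sup>2 \<le> g x"
  shows "square_integrable f"
  unfolding square_integrable_def using assms(1)
  by (auto intro!: Bochner_Integration.integrable_bound[OF assms(2)] order_trans[OF assms(3) abs_ge_self])

text \<open>The integrand is dominated by
  \<open>K * ((norm (f x))\<^sup>2 + (norm (g x))\<^sup>2)\<close>, and it is measurable because
  \<open>q\<close> is jointly continuous.\<close>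

lemma integrable_bilinear:
  fixes q :: "'b::euclidean_space \<Rightarrow> 'c::euclidean_space \<Rightarrow> real"
  assumes q: "bounded_bilinear q" and f: "square_integrable f" and g: "square_integrable g"
  shows "integrable lborel (\<lambda>x. q (f x) (g x))"
proof -
  obtain K where K: "K > 0" "\<And>a b. norm (q a b) \<le> norm a * norm b * K"
    using bounded_bilinear.pos_bounded[OF q] by blast
  have "integrable lborel (\<lambda>x. K * ((norm (f x))\<^sup>2 + (norm (g x))\<^sup>2))"
    using f g unfolding square_integrable_def by (intro integrable_mult_right integrable_add) auto
  then show ?thesis
  proof (rule Bochner_Integration.integrable_bound)
    have "(\<lambda>x. q (f x) (g x)) \<in> borel_measurable borel"
    proof -
      have "continuous_on UNIV (\<lambda>p. q (fst p) (snd p))"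
        by (intro bounded_bilinear.continuous_on[OF q] continuous_intros)
      from borel_measurable_continuous_onI[OF this]
      have "(\<lambda>x. (\<lambda>p. q (fst p) (snd p)) (f x, g x)) \<in> borel_measurable borel"
        by (rule measurable_compose[rotated])
          (use f g in \<open>auto simp: square_integrable_def borel_prod[symmetric]\<close>)
      then show ?thesis by simp
    qed
    then show "(\<lambda>x. q (f x) (g x)) \<in> borel_measurable lborel" by simp
    have "norm (q a b) \<le> norm (K * ((norm a)\<^sup>2 + (norm b)\<^sup>2))" for a b
    proof -
      have "norm (q a b) \<le> K * (norm a * norm b)" using K(2)[of a b] by (simp add: mult_ac)
      also have "\<dots> \<le> K * ((norm a)\<^sup>2 + (norm b)\<^sup>2)"
      proof (rule mult_left_mono)
        have "0 \<le> norm a * norm b" by simp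
        then show "norm a * norm b \<le> (norm a)\<^sup>2 + (norm b)\<^sup>2"
          using sum_squares_bound[of "norm a" "norm b"] by linarith
      qed (use K in simp)
      finally show ?thesis using K(1) by simp
    qed
    then show "AE x in lborel. norm (q (f x) (g x)) \<le> norm (K * ((norm (f x))\<^sup>2 + (norm (g x))\<^sup>2))"
      by simp
  qed
qed

lemma square_integrable_zero: "square_integrable (\<lambda>x. 0)"
  by (simp add: square_integrable_def)

lemma square_integrable_scaleR:
  assumes "square_integrable f" shows "square_integrable (\<lambda>x. r *\<^sub>R f x)"
  using assms by (auto simp: square_integrable_def power_mult_distrib)

lemma square_integrable_add:
  assumes f: "square_integrable f" and g: "square_integrable g"
  shows "square_integrable (\<lambda>x. f x + g x)"
proof (rule square_integrable_bounded_by)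
  show "integrable lborel (\<lambda>x. 2 * (norm (f x))\<^sup>2 + 2 * (norm (g x))\<^sup>2)"
    using f g unfolding square_integrable_def by auto
  show "(norm (f x + g x))\<^sup>2 \<le> 2 * (norm (f x))\<^sup>2 + 2 * (norm (g x))\<^sup>2" for x
  proof -
    have "(norm (f x + g x))\<^sup>2 \<le> (norm (f x) + norm (g x))\<^sup>2" by (intro power_mono norm_triangle_ineq) auto
    also have "\<dots> \<le> 2 * (norm (f x))\<^sup>2 + 2 * (norm (g x))\<^sup>2"
      using sum_squares_bound[of "norm (f x)" "norm (g x)"] by (simp add: power2_sum)
    finally show ?thesis .
  qed
qed (use f g in measurable)

lemma square_integrable_minus: "square_integrable f \<Longrightarrow> square_integrable (\<lambda>x. - f x)"
  using square_integrable_scaleR[of f "-1"] by simp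

lemma square_integrable_diff:
  "square_integrable f \<Longrightarrow> square_integrable g \<Longrightarrow> square_integrable (\<lambda>x. f x - g x)"
  using square_integrable_add[OF _ square_integrable_minus] by fastforce

\<comment> \<open>The space L2 as a type of its own, so that the class hierarchy for inner product
  and Banach spaces applies to it. The relation is partial: a function that is not square integrable
  belongs to no class.\<close>
quotient_type (overloaded) ('a, 'b) lsq = "'a::euclidean_space \<Rightarrow> 'b::euclidean_space" /
  partial: "\<lambda>f g. square_integrable f \<and> square_integrable g \<and> (AE x in lborel. f x = g x)"
proof (rule part_equivpI)
  show "\<exists>f::'a \<Rightarrow> 'b. square_integrable f \<and> square_integrable f \<and> (AE x in lborel. f x = f x)"
    using square_integrable_zero by blast
qed (auto intro!: sympI transpI)

lemma square_integrable_rep [simp]: "square_integrable (rep_lsq X)"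
  using Quotient3_rep_reflp[OF Quotient3_lsq] by blast

lemma abs_rep_lsq [simp]: "abs_lsq (rep_lsq X) = X"
  by (rule Quotient3_abs_rep[OF Quotient3_lsq])

lemma abs_lsq_eq_iff:
  "square_integrable f \<Longrightarrow> square_integrable g \<Longrightarrow> abs_lsq f = abs_lsq g \<longleftrightarrow> (AE x in lborel. f x = g x)"
  using Quotient3_rel[OF Quotient3_lsq, of f g] by auto

lemma rep_abs_lsq: "square_integrable f \<Longrightarrow> AE x in lborel. rep_lsq (abs_lsq f) x = f x"
  using abs_lsq_eq_iff[of "rep_lsq (abs_lsq f)" f] by simp

lemma lsq_cases [case_names abs]:
  obtains f where "square_integrable f" "X = abs_lsq f"
  by (metis square_integrable_rep abs_rep_lsq)

text \<open>Lifts a pointwise form to classes; for bounded bilinear \<open>q\<close> the choice of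
  representatives is immaterial by \<open>lsq_form_abs\<close>. The inner product of the space and
  the two energy forms are all instances.\<close>

definition lsq_form :: "('b \<Rightarrow> 'c \<Rightarrow> real) \<Rightarrow> ('a::euclidean_space, 'b::euclidean_space) lsq
    \<Rightarrow> ('a, 'c::euclidean_space) lsq \<Rightarrow> real" where
  "lsq_form q X Y = (\<integral>x. q (rep_lsq X x) (rep_lsq Y x) \<partial>lborel)"

lemma lsq_form_abs:
  assumes q: "bounded_bilinear q" and f: "square_integrable f" and g: "square_integrable g"
  shows "lsq_form q (abs_lsq f) (abs_lsq g) = (\<integral>x. q (f x) (g x) \<partial>lborel)"
  unfolding lsq_form_def
proof (rule integral_cong_AE)
  show "AE x in lborel. q (rep_lsq (abs_lsq f) x) (rep_lsq (abs_lsq g) x) = q (f x) (g x)"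
    using rep_abs_lsq[OF f] rep_abs_lsq[OF g] by eventually_elim simp
qed (use borel_measurable_integrable[OF integrable_bilinear[OF q f g]]
      borel_measurable_integrable[OF integrable_bilinear[OF q square_integrable_rep square_integrable_rep]] in auto)

instantiation lsq :: (euclidean_space, euclidean_space) real_vector
begin

definition "0 = abs_lsq (\<lambda>x. 0)"
definition "X + Y = abs_lsq (\<lambda>x. rep_lsq X x + rep_lsq Y x)"
definition "- X = abs_lsq (\<lambda>x. - rep_lsq X x)"
definition "X - Y = abs_lsq (\<lambda>x. rep_lsq X x - rep_lsq Y x)"
definition "r *\<^sub>R X = abs_lsq (\<lambda>x. r *\<^sub>R rep_lsq X x)"

lemma plus_abs_lsq:
  assumes "square_integrable f" "square_integrable g"
  shows "abs_lsq f + abs_lsq g = abs_lsq (\<lambda>x. f x + g x)"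
  unfolding plus_lsq_def using assms rep_abs_lsq[OF assms(1)] rep_abs_lsq[OF assms(2)]
  by (subst abs_lsq_eq_iff) (auto intro: square_integrable_add)

lemma minus_abs_lsq:
  assumes "square_integrable f" "square_integrable g"
  shows "abs_lsq f - abs_lsq g = abs_lsq (\<lambda>x. f x - g x)"
  unfolding minus_lsq_def using assms rep_abs_lsq[OF assms(1)] rep_abs_lsq[OF assms(2)]
  by (subst abs_lsq_eq_iff) (auto intro: square_integrable_diff)

lemma uminus_abs_lsq: "square_integrable f \<Longrightarrow> - abs_lsq f = abs_lsq (\<lambda>x. - f x)"
  unfolding uminus_lsq_def using rep_abs_lsq[of f]
  by (subst abs_lsq_eq_iff) (auto intro: square_integrable_minus)

lemma scaleR_abs_lsq: "square_integrable f \<Longrightarrow> r *\<^sub>R abs_lsq f = abs_lsq (\<lambda>x. r *\<^sub>R f x)"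
  unfolding scaleR_lsq_def using rep_abs_lsq[of f]
  by (subst abs_lsq_eq_iff) (auto intro: square_integrable_scaleR)

instance
proof
  fix X Y Z :: "('a, 'b) lsq" and r s :: real
  obtain f where [simp]: "square_integrable f" "X = abs_lsq f" by (rule lsq_cases)
  obtain g where [simp]: "square_integrable g" "Y = abs_lsq g" by (rule lsq_cases)
  obtain h where [simp]: "square_integrable h" "Z = abs_lsq h" by (rule lsq_cases)
  note [simp] = plus_abs_lsq minus_abs_lsq uminus_abs_lsq scaleR_abs_lsq square_integrable_add
    square_integrable_diff square_integrable_minus square_integrable_scaleR square_integrable_zero
    zero_lsq_def
  show "X + Y + Z = X + (Y + Z)" by (simp add: add.assoc)
  show "X + Y = Y + X" by (simp add: add.commute)
  show "0 + X = X" by simp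
  show "- X + X = 0" by simp
  show "X - Y = X + - Y" by simp
  show "r *\<^sub>R (X + Y) = r *\<^sub>R X + r *\<^sub>R Y" by (simp add: scaleR_add_right)
  show "(r + s) *\<^sub>R X = r *\<^sub>R X + s *\<^sub>R X" by (simp add: scaleR_add_left)
  show "r *\<^sub>R s *\<^sub>R X = (r * s) *\<^sub>R X" by simp
  show "1 *\<^sub>R X = X" by simp
qed

end

lemma lsq_form_add_left:
  assumes q: "bounded_bilinear q"
  shows "lsq_form q (X + Y) Z = lsq_form q X Z + lsq_form q Y Z"
proof -
  interpret bounded_bilinear q by (rule q)
  obtain f where f: "square_integrable f" "X = abs_lsq f" by (rule lsq_cases)
  obtain g where g: "square_integrable g" "Y = abs_lsq g" by (rule lsq_cases)
  obtain h where h: "square_integrable h" "Z = abs_lsq h" by (rule lsq_cases)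
  show ?thesis
    using f g h integrable_bilinear[OF q, of f h] integrable_bilinear[OF q, of g h]
    by (simp add: plus_abs_lsq lsq_form_abs[OF q] square_integrable_add add_left)
qed

lemma lsq_form_scaleR_left:
  assumes q: "bounded_bilinear q"
  shows "lsq_form q (r *\<^sub>R X) Z = r * lsq_form q X Z"
proof -
  interpret bounded_bilinear q by (rule q)
  obtain f where f: "square_integrable f" "X = abs_lsq f" by (rule lsq_cases)
  obtain h where h: "square_integrable h" "Z = abs_lsq h" by (rule lsq_cases)
  show ?thesis
    using f h by (simp add: scaleR_abs_lsq lsq_form_abs[OF q] square_integrable_scaleR scaleR_left)
qed

lemma lsq_form_swap: "lsq_form q X Y = lsq_form (\<lambda>a b. q b a) Y X"
  by (simp add: lsq_form_def)

instantiation lsq :: (euclidean_space, euclidean_space) real_inner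
begin

definition "inner_lsq = lsq_form (\<bullet>)"
definition norm_lsq :: "('a, 'b) lsq \<Rightarrow> real" where "norm_lsq X = sqrt (inner X X)"
definition dist_lsq :: "('a, 'b) lsq \<Rightarrow> ('a, 'b) lsq \<Rightarrow> real" where "dist_lsq X Y = norm (X - Y)"
definition sgn_lsq :: "('a, 'b) lsq \<Rightarrow> ('a, 'b) lsq" where "sgn_lsq X = X /\<^sub>R norm X"
definition uniformity_lsq :: "(('a, 'b) lsq \<times> ('a, 'b) lsq) filter" where
  "uniformity_lsq = (INF e\<in>{0 <..}. principal {(x, y). dist x y < e})"
definition open_lsq :: "('a, 'b) lsq set \<Rightarrow> bool" where
  "open_lsq U = (\<forall>x\<in>U. eventually (\<lambda>(x', y). x' = x \<longrightarrow> y \<in> U) uniformity)"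

instance
proof
  fix X Y Z :: "('a, 'b) lsq" and r :: real
  show "X \<bullet> Y = Y \<bullet> X" by (simp add: inner_lsq_def lsq_form_def inner_commute)
  show "(X + Y) \<bullet> Z = X \<bullet> Z + Y \<bullet> Z"
    by (simp add: inner_lsq_def lsq_form_add_left bounded_bilinear_inner)
  show "r *\<^sub>R X \<bullet> Y = r * (X \<bullet> Y)"
    by (simp add: inner_lsq_def lsq_form_scaleR_left bounded_bilinear_inner)
  show "0 \<le> X \<bullet> X" by (simp add: inner_lsq_def lsq_form_def)
  show "X \<bullet> X = 0 \<longleftrightarrow> X = 0"
  proof -
    obtain f where f: "square_integrable f" "X = abs_lsq f" by (rule lsq_cases)
    have "X \<bullet> X = (\<integral>x. f x \<bullet> f x \<partial>lborel)"
      using f by (simp add: inner_lsq_def lsq_form_abs bounded_bilinear_inner)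
    also have "\<dots> = 0 \<longleftrightarrow> (AE x in lborel. f x \<bullet> f x = 0)"
      using integrable_bilinear[OF bounded_bilinear_inner f(1) f(1)]
      by (subst integral_nonneg_eq_0_iff_AE) auto
    also have "\<dots> \<longleftrightarrow> X = 0"
      using f by (simp add: zero_lsq_def abs_lsq_eq_iff square_integrable_zero)
    finally show ?thesis .
  qed
qed (rule norm_lsq_def dist_lsq_def sgn_lsq_def uniformity_lsq_def open_lsq_def)+

end

lemma power2_norm_abs_lsq:
  "square_integrable f \<Longrightarrow> (norm (abs_lsq f))\<^sup>2 = (\<integral>x. (norm (f x))\<^sup>2 \<partial>lborel)"
  by (simp add: power2_norm_eq_inner inner_lsq_def lsq_form_abs bounded_bilinear_inner)

lemma norm_abs_lsq:
  "square_integrable f \<Longrightarrow> norm (abs_lsq f) = sqrt (\<integral>x. (norm (f x))\<^sup>2 \<partial>lborel)"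
  by (metis norm_ge_zero power2_norm_abs_lsq real_sqrt_unique)

lemma nn_integral_norm_abs_lsq:
  assumes f: "square_integrable f"
  shows "(\<integral>\<^sup>+x. ennreal ((norm (f x))\<^sup>2) \<partial>lborel) = ennreal ((norm (abs_lsq f))\<^sup>2)"
  using f by (simp add: power2_norm_abs_lsq square_integrable_def nn_integral_eq_integral)

lemma bounded_bilinear_lsq_form:
  fixes q :: "'b::euclidean_space \<Rightarrow> 'c::euclidean_space \<Rightarrow> real"
  assumes q: "bounded_bilinear q"
  shows "bounded_bilinear (lsq_form q :: ('a::euclidean_space, 'b) lsq \<Rightarrow> _)"
proof
  fix X X' :: "('a, 'b) lsq" and Y Y' :: "('a, 'c) lsq" and r
  note q' = bounded_bilinear.flip[OF q]
  show "lsq_form q (X + X') Y = lsq_form q X Y + lsq_form q X' Y" by (rule lsq_form_add_left[OF q])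
  show "lsq_form q X (Y + Y') = lsq_form q X Y + lsq_form q X Y'"
    unfolding lsq_form_swap[of q] by (rule lsq_form_add_left[OF q'])
  show "lsq_form q (r *\<^sub>R X) Y = r *\<^sub>R lsq_form q X Y" by (simp add: lsq_form_scaleR_left[OF q])
  show "lsq_form q X (r *\<^sub>R Y) = r *\<^sub>R lsq_form q X Y"
    unfolding lsq_form_swap[of q] by (simp add: lsq_form_scaleR_left[OF q'])
next
  obtain K where K: "K > 0" "\<And>a b. norm (q a b) \<le> norm a * norm b * K"
    using bounded_bilinear.pos_bounded[OF q] by blast
  have "norm (lsq_form q X Y) \<le> norm X * norm Y * K" for X :: "('a, 'b) lsq" and Y :: "('a, 'c) lsq"
  proof -
    obtain f where f: "square_integrable f" "X = abs_lsq f" by (rule lsq_cases)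
    obtain g where g: "square_integrable g" "Y = abs_lsq g" by (rule lsq_cases)
    \<comment> \<open>The Cauchy-Schwarz inequality is borrowed from the scalar valued space: the
      pointwise norms of \<open>f\<close> and \<open>g\<close> define classes with the same norms as
      \<open>X\<close> and \<open>Y\<close>.\<close>
    have nf: "square_integrable (\<lambda>x. norm (f x))" and ng: "square_integrable (\<lambda>x. norm (g x))"
      using f g by (auto simp: square_integrable_def)
    have norms: "norm (abs_lsq (\<lambda>x. norm (f x))) = norm X" "norm (abs_lsq (\<lambda>x. norm (g x))) = norm Y"
      using f g nf ng by (simp_all add: norm_abs_lsq)
    have "norm (lsq_form q X Y) \<le> (\<integral>x. norm (q (f x) (g x)) \<partial>lborel)"
      using f g by (simp add: lsq_form_abs[OF q] del: real_norm_def)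
    also have "\<dots> \<le> (\<integral>x. norm (f x) * norm (g x) * K \<partial>lborel)"
      using integrable_bilinear[OF q f(1) g(1)] integrable_bilinear[OF bounded_bilinear_mult nf ng] K
      by (intro integral_mono) auto
    also have "\<dots> = lsq_form (*) (abs_lsq (\<lambda>x. norm (f x))) (abs_lsq (\<lambda>x. norm (g x))) * K"
      using nf ng by (simp add: lsq_form_abs bounded_bilinear_mult)
    also have "lsq_form (*) (abs_lsq (\<lambda>x. norm (f x))) (abs_lsq (\<lambda>x. norm (g x))) \<le> norm X * norm Y"
      using norm_cauchy_schwarz[of "abs_lsq (\<lambda>x. norm (f x))" "abs_lsq (\<lambda>x. norm (g x))"]
      unfolding norms by (simp add: inner_lsq_def lsq_form_def)
    finally show ?thesis using K by simp
  qed
  then show "\<exists>K. \<forall>(X :: ('a, 'b) lsq) (Y :: ('a, 'c) lsq). norm (lsq_form q X Y) \<le> norm X * norm Y * K" by blast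
qed

text \<open>Riesz--Fischer. Along a subsequence whose increments \<open>d\<^sub>k\<close> satisfy
  \<open>\<parallel>d\<^sub>k\<parallel>\<^sup>2 \<le> (1/8) ^ k\<close>, the series \<open>\<Sum>k. 4 ^ k * \<bar>d\<^sub>k x\<bar>\<^sup>2\<close> is integrable, hence a.e. finite, which
  gives a.e. convergence; Fatou's lemma identifies the pointwise limit with the norm limit.\<close>

instance lsq :: (euclidean_space, euclidean_space) complete_space
proof
  fix X :: "nat \<Rightarrow> ('a, 'b) lsq"
  assume X: "Cauchy X"
  have "\<exists>N. \<forall>m\<ge>N. \<forall>n\<ge>N. norm (X m - X n) < sqrt ((1/8) ^ k)" for k
    using X by (rule CauchyD) simp
  then obtain N where N: "\<And>k m n. m \<ge> N k \<Longrightarrow> n \<ge> N k \<Longrightarrow> norm (X m - X n) < sqrt ((1/8) ^ k)"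
    by metis
  \<comment> \<open>Summing all earlier thresholds puts both \<open>r k\<close> and
    \<open>r (Suc k)\<close> beyond \<open>N k\<close>; the added \<open>k\<close> makes
    \<open>r\<close> strictly increasing.\<close>
  define r where "r k = (\<Sum>j\<le>k. N j) + k" for k
  have r: "strict_mono r" unfolding r_def strict_mono_Suc_iff by simp
  have rN: "r k \<ge> N k" "r (Suc k) \<ge> N k" for k
    unfolding r_def using member_le_sum[of k "{..k}" N] by auto
  define f where "f k = rep_lsq (X (r k))" for k
  have f [simp]: "square_integrable (f k)" "abs_lsq (f k) = X (r k)" for k unfolding f_def by auto
  have [measurable]: "f k \<in> borel_measurable borel" for k using f(1) by (rule square_integrableD)
  define d where "d k x = f (Suc k) x - f k x" for k x
  have [measurable]: "d k \<in> borel_measurable borel" for k unfolding d_def by measurable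
  have nn_diff: "(\<integral>\<^sup>+x. ennreal ((norm (f j x - f k x))\<^sup>2) \<partial>lborel) = ennreal ((norm (X (r j) - X (r k)))\<^sup>2)" for j k
    using nn_integral_norm_abs_lsq[OF square_integrable_diff[OF f(1)[of j] f(1)[of k]]]
    by (simp add: minus_abs_lsq[symmetric])
  have d_le: "(\<integral>\<^sup>+x. ennreal ((norm (d k x))\<^sup>2) \<partial>lborel) \<le> ennreal ((1/8) ^ k)" for k
  proof -
    have "norm (X (r (Suc k)) - X (r k)) \<le> sqrt ((1/8) ^ k)" using N rN by (simp add: less_imp_le)
    then have "(norm (X (r (Suc k)) - X (r k)))\<^sup>2 \<le> (sqrt ((1/8) ^ k))\<^sup>2" by (intro power_mono) auto
    then show ?thesis unfolding d_def nn_diff by (intro ennreal_leI) simp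
  qed
  have "(\<integral>\<^sup>+x. (\<Sum>k. ennreal (4 ^ k * (norm (d k x))\<^sup>2)) \<partial>lborel)
      = (\<Sum>k. \<integral>\<^sup>+x. ennreal (4 ^ k * (norm (d k x))\<^sup>2) \<partial>lborel)"
    by (intro nn_integral_suminf) measurable
  also have "\<dots> \<le> (\<Sum>k. ennreal ((1/2) ^ k))"
  proof (intro suminf_le allI)
    fix k
    have "(\<integral>\<^sup>+x. ennreal (4 ^ k * (norm (d k x))\<^sup>2) \<partial>lborel)
        = ennreal (4 ^ k) * (\<integral>\<^sup>+x. ennreal ((norm (d k x))\<^sup>2) \<partial>lborel)"
      by (simp add: ennreal_mult nn_integral_cmult)
    also have "\<dots> \<le> ennreal (4 ^ k) * ennreal ((1/8) ^ k)" by (intro mult_left_mono d_le) simp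
    also have "\<dots> = ennreal ((1/2) ^ k)"
      by (simp flip: ennreal_mult power_mult_distrib)
    finally show "(\<integral>\<^sup>+x. ennreal (4 ^ k * (norm (d k x))\<^sup>2) \<partial>lborel) \<le> ennreal ((1/2) ^ k)" .
  qed auto
  also have "\<dots> < \<infinity>"
    by (subst suminf_ennreal_eq[OF _ geometric_sums[of "1/2"]]) auto
  finally have "AE x in lborel. (\<Sum>k. ennreal (4 ^ k * (norm (d k x))\<^sup>2)) \<noteq> \<infinity>"
    by (intro nn_integral_PInf_AE) auto
  then have conv: "AE x in lborel. convergent (\<lambda>k. f k x)"
  proof eventually_elim
    case (elim x)
    then have "summable (\<lambda>k. 4 ^ k * (norm (d k x))\<^sup>2)"
      by (intro summable_suminf_not_top) (auto simp: top_ennreal_def)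
    then obtain C where C: "\<And>k. norm (4 ^ k * (norm (d k x))\<^sup>2) \<le> C"
      using summable_imp_Bseq[of "\<lambda>k. 4 ^ k * (norm (d k x))\<^sup>2"] by (auto simp: Bseq_def)
    \<comment> \<open>The terms of a convergent series are bounded, here by \<open>C\<close>; the
      weight \<open>4 ^ k\<close> then forces geometric decay of the increments, and the telescoping
      sum of the \<open>d k x\<close> converges.\<close>
    have "norm (d k x) \<le> sqrt C * (1/2) ^ k" for k
    proof -
      have "((2::real) ^ k)\<^sup>2 = 4 ^ k" by (simp add: power2_eq_square flip: power_mult_distrib)
      then have "(2 ^ k * norm (d k x))\<^sup>2 \<le> C"
        using C[of k] by (simp add: power_mult_distrib)
      then have "2 ^ k * norm (d k x) \<le> sqrt C" by (rule real_le_rsqrt)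
      then have "norm (d k x) \<le> sqrt C / 2 ^ k" by (simp add: pos_le_divide_eq mult.commute)
      then show ?thesis by (simp only: power_one_over times_divide_eq_right mult_1_right)
    qed
    moreover have "summable (\<lambda>k. sqrt C * (1/2) ^ k)"
      by (intro summable_mult summable_geometric) simp
    ultimately have "summable (\<lambda>k. d k x)"
      by (rule summable_comparison_test'[rotated])
    then have "convergent (\<lambda>n. f 0 x + (\<Sum>k<n. d k x))"
      by (intro convergent_add convergent_const) (simp add: summable_iff_convergent)
    moreover have "f 0 x + (\<Sum>k<n. d k x) = f n x" for n
      unfolding d_def using sum_lessThan_telescope[of "\<lambda>k. f k x" n] by simp
    ultimately show ?case by simp
  qed
  \<comment> \<open>Where the sequence diverges, \<open>lim\<close> returns an unspecified value;
    that set is null, so every statement below ignores it.\<close>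
  define F where "F x = lim (\<lambda>k. f k x)" for x
  have F [measurable]: "F \<in> borel_measurable borel"
    unfolding F_def by (rule borel_measurable_lim_metric) measurable
  have Fdiff: "(\<integral>\<^sup>+x. ennreal ((norm (F x - f k x))\<^sup>2) \<partial>lborel) \<le> ennreal (e\<^sup>2)"
    if e: "e > 0" "\<And>j. j \<ge> M \<Longrightarrow> norm (X (r j) - X (r k)) \<le> e" for k M e
  proof -
    have "(\<integral>\<^sup>+x. ennreal ((norm (F x - f k x))\<^sup>2) \<partial>lborel)
        = (\<integral>\<^sup>+x. liminf (\<lambda>j. ennreal ((norm (f j x - f k x))\<^sup>2)) \<partial>lborel)"
    proof (rule nn_integral_cong_AE)
      show "AE x in lborel. ennreal ((norm (F x - f k x))\<^sup>2) = liminf (\<lambda>j. ennreal ((norm (f j x - f k x))\<^sup>2))"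
        using conv
      proof eventually_elim
        case (elim x)
        then have "(\<lambda>j. f j x) \<longlonglongrightarrow> F x" unfolding F_def by (simp add: convergent_LIMSEQ_iff)
        then have "(\<lambda>j. ennreal ((norm (f j x - f k x))\<^sup>2)) \<longlonglongrightarrow> ennreal ((norm (F x - f k x))\<^sup>2)"
          by (intro tendsto_intros)
        then show ?case by (intro lim_imp_Liminf[symmetric]) auto
      qed
    qed
    also have "\<dots> \<le> liminf (\<lambda>j. \<integral>\<^sup>+x. ennreal ((norm (f j x - f k x))\<^sup>2) \<partial>lborel)"
      by (intro nn_integral_liminf) measurable
    also have "\<dots> \<le> liminf (\<lambda>j. ennreal (e\<^sup>2))"
      unfolding nn_diff
    proof (intro Liminf_mono eventually_sequentiallyI[of M] ennreal_leI power_mono)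
    qed (use e in auto)
    also have "\<dots> = ennreal (e\<^sup>2)" by (intro Liminf_const) auto
    finally show ?thesis .
  qed
  have Cauchy_r: "\<exists>M. \<forall>j\<ge>M. \<forall>k\<ge>M. norm (X (r j) - X (r k)) \<le> e" if "e > 0" for e
    using CauchyD[OF Cauchy_subseq_Cauchy[OF X r] that] by (auto intro: less_imp_le)
  obtain M1 where M1: "\<And>j k. j \<ge> M1 \<Longrightarrow> k \<ge> M1 \<Longrightarrow> norm (X (r j) - X (r k)) \<le> 1"
    using Cauchy_r[of 1] by auto
  \<comment> \<open>The Fatou estimate with \<open>e = 1\<close> also proves \<open>F\<close> square
    integrable, as the sum of \<open>F - f M1\<close> and \<open>f M1\<close>.\<close>
  have "(\<integral>\<^sup>+x. ennreal ((norm (F x - f M1 x))\<^sup>2) \<partial>lborel) \<le> ennreal (1\<^sup>2)"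
    using M1 by (intro Fdiff[of 1 M1]) auto
  then have "square_integrable (\<lambda>x. F x - f M1 x)"
    by (auto simp: square_integrable_iff_nn_integral intro: le_less_trans)
  from square_integrable_add[OF this f(1)[of M1]] have FS: "square_integrable F" by simp
  have "(X \<circ> r) \<longlonglongrightarrow> abs_lsq F"
  proof (rule LIMSEQ_I)
    fix e :: real assume e: "e > 0"
    obtain M where M: "\<And>j k. j \<ge> M \<Longrightarrow> k \<ge> M \<Longrightarrow> norm (X (r j) - X (r k)) \<le> e / 2"
      using Cauchy_r[of "e / 2"] e by auto
    have "norm ((X \<circ> r) k - abs_lsq F) < e" if k: "k \<ge> M" for k
    proof -
      have "abs_lsq F - X (r k) = abs_lsq (\<lambda>x. F x - f k x)"
        using minus_abs_lsq[OF FS f(1)[of k]] by simp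
      then have "ennreal ((norm (abs_lsq F - X (r k)))\<^sup>2) = (\<integral>\<^sup>+x. ennreal ((norm (F x - f k x))\<^sup>2) \<partial>lborel)"
        using nn_integral_norm_abs_lsq[OF square_integrable_diff[OF FS f(1)[of k]]] by simp
      also have "\<dots> \<le> ennreal ((e / 2)\<^sup>2)" using M k e by (intro Fdiff[of "e / 2" M]) auto
      finally have "(norm (abs_lsq F - X (r k)))\<^sup>2 \<le> (e / 2)\<^sup>2" by (subst (asm) ennreal_le_iff) auto
      then have "norm (abs_lsq F - X (r k)) \<le> e / 2" by (rule power2_le_imp_le) (use e in simp)
      then show ?thesis using e norm_minus_commute[of "X (r k)" "abs_lsq F"] by simp
    qed
    then show "\<exists>no. \<forall>n\<ge>no. norm ((X \<circ> r) n - abs_lsq F) < e" by blast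
  qed
  then show "convergent X" using Cauchy_converges_subseq[OF X r] convergent_def by blast
qed

instance lsq :: (euclidean_space, euclidean_space) banach ..

section \<open>Integration by parts with difference quotients\<close>

lemma frechet_derivative_zero_outside:
  assumes "closed K" "\<And>y. y \<notin> K \<Longrightarrow> f y = 0" "x \<notin> K"
  shows "frechet_derivative f (at x) v = 0"
proof -
  have "(f has_derivative (\<lambda>h. 0)) (at x)"
  proof (rule has_derivative_transform_within_open[OF has_derivative_const[of 0]])
    show "open (- K)" using assms(1) by (rule open_Compl)
  qed (use assms in auto)
  then show ?thesis using frechet_derivative_at by metis
qed

lemma has_real_derivative_along_line:
  fixes f :: "'a::euclidean_space \<Rightarrow> real"
  assumes "f differentiable (at (x + h *\<^sub>R v))"
  shows "((\<lambda>h. f (x + h *\<^sub>R v)) has_real_derivative frechet_derivative f (at (x + h *\<^sub>R v)) v) (at h within A)"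
proof -
  have "((\<lambda>h. f (x + h *\<^sub>R v)) has_derivative (\<lambda>k. frechet_derivative f (at (x + h *\<^sub>R v)) (k *\<^sub>R v))) (at h within A)"
    by (rule has_derivative_compose[of "\<lambda>h. x + h *\<^sub>R v", rotated])
      (use assms in \<open>auto intro!: derivative_eq_intros simp: frechet_derivative_works[symmetric]\<close>)
  then show ?thesis
    using linear_frechet_derivative[OF assms]
    by (auto simp: has_field_derivative_def linear_cmul mult.commute[of _ "frechet_derivative f _ v"]
        intro: has_derivative_eq_rhs)
qed

text \<open>Mean value theorem along lines: the directional derivative is bounded on
  \<open>K\<close> by compactness and vanishes off \<open>K\<close>. The uniform \<open>B\<close>
  supplies the dominating function for difference quotients.\<close>

lemma directional_difference_bounded:
  fixes f :: "'a::euclidean_space \<Rightarrow> real"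
  assumes diff: "\<And>x. f differentiable (at x)"
    and cont: "continuous_on UNIV (\<lambda>x. frechet_derivative f (at x) v)"
    and K: "compact K" "\<And>x. x \<notin> K \<Longrightarrow> f x = 0"
  shows "\<exists>B\<ge>0. \<forall>x h. \<bar>f (x + h *\<^sub>R v) - f x\<bar> \<le> B * \<bar>h\<bar>"
proof -
  have "bounded ((\<lambda>x. frechet_derivative f (at x) v) ` K)"
    by (intro compact_imp_bounded compact_continuous_image continuous_on_subset[OF cont] K) auto
  then obtain B0 where B0: "\<And>x. x \<in> K \<Longrightarrow> \<bar>frechet_derivative f (at x) v\<bar> \<le> B0"
    by (auto simp: bounded_iff)
  define B where "B = max 0 B0"
  have B: "\<bar>frechet_derivative f (at x) v\<bar> \<le> B" for x
    using B0[of x] frechet_derivative_zero_outside[OF compact_imp_closed[OF K(1)] K(2), where x = x and v = v]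
    unfolding B_def by (cases "x \<in> K") auto
  have "\<bar>f (x + h *\<^sub>R v) - f x\<bar> \<le> B * \<bar>h\<bar>" for x h
    using field_differentiable_bound[of UNIV "\<lambda>h. f (x + h *\<^sub>R v)" "\<lambda>h. frechet_derivative f (at (x + h *\<^sub>R v)) v" B h 0]
      has_real_derivative_along_line[OF diff] B by auto
  moreover have "B \<ge> 0" unfolding B_def by simp
  ultimately show ?thesis by blast
qed

lemma difference_quotient_tendsto:
  fixes f :: "'a::euclidean_space \<Rightarrow> real"
  assumes "f differentiable (at x)" and h: "h \<longlonglongrightarrow> 0" "\<And>n. h n \<noteq> 0"
  shows "(\<lambda>n. (f (x + h n *\<^sub>R v) - f x) / h n) \<longlonglongrightarrow> frechet_derivative f (at x) v"
proof -
  have "((\<lambda>s. (f (x + s *\<^sub>R v) - f x) / s) \<longlongrightarrow> frechet_derivative f (at x) v) (at 0)"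
    using has_real_derivative_along_line[of f x 0 v UNIV] assms(1) by (simp add: DERIV_def)
  moreover have "filterlim h (at 0) sequentially"
    using h by (auto simp: filterlim_at)
  ultimately show ?thesis by (rule filterlim_compose)
qed

lemma integrable_continuous_compact_support:
  fixes f :: "'a::euclidean_space \<Rightarrow> real"
  assumes "continuous_on UNIV f" "compact K" "\<And>x. x \<notin> K \<Longrightarrow> f x = 0"
  shows "integrable lborel f"
proof -
  have "integrable lborel (\<lambda>x. indicator K x *\<^sub>R f x)"
    using assms by (intro borel_integrable_compact) (auto intro: continuous_on_subset)
  also have "(\<lambda>x. indicator K x *\<^sub>R f x) = f" using assms(3) by (auto simp: fun_eq_iff indicator_def)
  finally show ?thesis .
qed

lemma lborel_integral_translate:
  fixes f :: "'a::euclidean_space \<Rightarrow> real"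
  assumes "f \<in> borel_measurable borel"
  shows "(\<integral>x. f (x + t) \<partial>lborel) = (\<integral>x. f x \<partial>lborel)"
proof -
  have "(\<integral>x. f x \<partial>lborel) = (\<integral>x. f x \<partial>distr lborel borel ((+) t))"
    by (subst lborel_distr_plus) simp
  also have "\<dots> = (\<integral>x. f (t + x) \<partial>lborel)" using assms by (subst integral_distr) auto
  finally show ?thesis by (simp add: add.commute)
qed

text \<open>Passing to difference quotients avoids second derivatives: for step size \<open>h\<close> along \<open>v, w\<close>
  and \<open>- h\<close> along \<open>w, v\<close> the two integrals agree exactly, because translations commute and preserve
  Lebesgue measure.\<close>

lemma integral_swap_directional_derivatives:
  fixes f g :: "'a::euclidean_space \<Rightarrow> real"
  assumes f: "\<And>x. f differentiable (at x)" "\<And>v. continuous_on UNIV (\<lambda>x. frechet_derivative f (at x) v)"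
    and g: "\<And>x. g differentiable (at x)" "\<And>v. continuous_on UNIV (\<lambda>x. frechet_derivative g (at x) v)"
    and K: "compact K" "\<And>x. x \<notin> K \<Longrightarrow> f x = 0" "\<And>x. x \<notin> K \<Longrightarrow> g x = 0"
  shows "(\<integral>x. frechet_derivative f (at x) v * frechet_derivative g (at x) w \<partial>lborel)
       = (\<integral>x. frechet_derivative f (at x) w * frechet_derivative g (at x) v \<partial>lborel)"
proof -
  have fc: "continuous_on UNIV f" and gc: "continuous_on UNIV g"
    using f(1) g(1) by (auto simp: continuous_on_eq_continuous_within intro: differentiable_imp_continuous_within)
  have meas [measurable]: "f \<in> borel_measurable borel" "g \<in> borel_measurable borel"
    using fc gc by (auto intro: borel_measurable_continuous_onI)
  have dmeas [measurable]: "(\<lambda>x. frechet_derivative f (at x) v) \<in> borel_measurable borel"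
    "(\<lambda>x. frechet_derivative g (at x) v) \<in> borel_measurable borel" for v
    using f(2) g(2) by (auto intro: borel_measurable_continuous_onI)
  have conv: "(\<lambda>n. \<integral>x. (f (x + h n *\<^sub>R v) - f x) / h n * ((g (x + h n *\<^sub>R w) - g x) / h n) \<partial>lborel)
      \<longlonglongrightarrow> (\<integral>x. frechet_derivative f (at x) v * frechet_derivative g (at x) w \<partial>lborel)"
    if h: "h \<longlonglongrightarrow> 0" "\<And>n. h n \<noteq> 0" "\<And>n. \<bar>h n\<bar> \<le> 1" for h v w
  proof -
    obtain Bf where Bf: "Bf \<ge> 0" "\<And>x h. \<bar>f (x + h *\<^sub>R v) - f x\<bar> \<le> Bf * \<bar>h\<bar>"
      using directional_difference_bounded[OF f K(1,2)] by blast
    obtain Bg where Bg: "Bg \<ge> 0" "\<And>x h. \<bar>g (x + h *\<^sub>R w) - g x\<bar> \<le> Bg * \<bar>h\<bar>"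
      using directional_difference_bounded[OF g K(1,3)] by blast
    obtain R where R: "\<And>x. x \<in> K \<Longrightarrow> norm x \<le> R"
      using compact_imp_bounded[OF K(1)] by (auto simp: bounded_iff)
    \<comment> \<open>Steps have length at most 1, so outside the ball of radius \<open>R'\<close>
      both \<open>x\<close> and \<open>x + h n *\<^sub>R v\<close> miss \<open>K\<close> and the
      quotient of \<open>f\<close> is zero; this already kills the product.\<close>
    define R' where "R' = R + norm v"
    define q where "q = (\<lambda>x::'a. Bf * Bg * indicator (cball 0 R') x :: real)"
    have bound: "norm ((f (x + h n *\<^sub>R v) - f x) / h n * ((g (x + h n *\<^sub>R w) - g x) / h n)) \<le> q x" for x n
    proof (cases "x \<in> cball 0 R'")
      case True
      have "\<bar>(f (x + h n *\<^sub>R v) - f x) / h n\<bar> \<le> Bf" "\<bar>(g (x + h n *\<^sub>R w) - g x) / h n\<bar> \<le> Bg"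
        using Bf(2)[of x "h n"] Bg(2)[of x "h n"] h(2)[of n] by (auto simp: field_simps)
      then have "\<bar>(f (x + h n *\<^sub>R v) - f x) / h n\<bar> * \<bar>(g (x + h n *\<^sub>R w) - g x) / h n\<bar> \<le> Bf * Bg"
        using Bf(1) by (intro mult_mono) auto
      then show ?thesis unfolding q_def using True by (simp only: real_norm_def abs_mult) simp
    next
      case False
      have "norm (h n *\<^sub>R v) \<le> norm v" using h(3)[of n] by (simp add: mult_left_le_one_le)
      then have "norm (x + h n *\<^sub>R v) > R"
        using False norm_triangle_ineq4[of "x + h n *\<^sub>R v" "h n *\<^sub>R v"] unfolding R'_def by simp
      then have "x + h n *\<^sub>R v \<notin> K" using R by force
      moreover have "x \<notin> K" using R[of x] False norm_ge_zero[of v] unfolding R'_def by (auto simp del: norm_ge_zero)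
      ultimately show ?thesis using K False unfolding q_def by simp
    qed
    show ?thesis
    proof (rule integral_dominated_convergence)
      show "integrable lborel q" unfolding q_def
        using emeasure_lborel_cball_finite[of "0::'a" R']
        by (intro integrable_mult_right integrable_real_indicator) auto
      show "AE x in lborel. (\<lambda>n. (f (x + h n *\<^sub>R v) - f x) / h n * ((g (x + h n *\<^sub>R w) - g x) / h n))
          \<longlonglongrightarrow> frechet_derivative f (at x) v * frechet_derivative g (at x) w"
        using difference_quotient_tendsto[OF _ h(1,2)] f g by (intro AE_I2 tendsto_mult) auto
    qed (use bound in auto)
  qed
  define h where "h n = inverse (real (Suc n))" for n
  have h: "h \<longlonglongrightarrow> 0" "\<And>n. h n \<noteq> 0" "\<And>n. \<bar>h n\<bar> \<le> 1"
    unfolding h_def using LIMSEQ_inverse_real_of_nat by (auto simp: field_simps)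
  have mh: "(\<lambda>n. - h n) \<longlonglongrightarrow> 0" "\<And>n. - h n \<noteq> 0" "\<And>n. \<bar>- h n\<bar> \<le> 1"
    using h tendsto_minus[OF h(1)] by auto
  have prod_int: "integrable lborel (\<lambda>x. f (x + s) * g (x + t))" for s t
  proof -
    have "f (x + s) * g (x + t) = 0" if "x \<notin> (\<lambda>y. y - s) ` K" for x
      using K(2) that by (force simp: image_iff)
    moreover have "compact ((\<lambda>y. y - s) ` K)"
      using K(1) by (intro compact_continuous_image continuous_intros)
    ultimately show ?thesis
      by (intro integrable_continuous_compact_support[of _ "(\<lambda>y. y - s) ` K"] continuous_intros
          continuous_on_compose2[OF fc] continuous_on_compose2[OF gc]) auto
  qed
  have swap: "(\<integral>x. (f (x + k *\<^sub>R v) - f x) * (g (x + k *\<^sub>R w) - g x) \<partial>lborel)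
      = (\<integral>x. (f (x + (- k) *\<^sub>R w) - f x) * (g (x + (- k) *\<^sub>R v) - g x) \<partial>lborel)" for k
  proof -
    \<comment> \<open>Expanding the product leaves four correlations \<open>P s t\<close>, and these
      depend on \<open>s - t\<close> only. The pairs \<open>(k *\<^sub>R v, k *\<^sub>R w)\<close>
      and \<open>(- k *\<^sub>R w, - k *\<^sub>R v)\<close> have the same difference, while the two
      mixed terms trade places.\<close>
    define P where "P s t = (\<integral>x. f (x + s) * g (x + t) \<partial>lborel)" for s t
    have shift: "P (s + r) (t + r) = P s t" for s t r
      unfolding P_def using lborel_integral_translate[of "\<lambda>x. f (x + s) * g (x + t)" r]
      by (simp add: add.assoc add.commute[of r])
    have expand: "(\<integral>x. (f (x + s) - f x) * (g (x + t) - g x) \<partial>lborel) = P s t - P s 0 - (P 0 t - P 0 0)" for s t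
      unfolding P_def using prod_int[of s t] prod_int[of s 0] prod_int[of 0 t] prod_int[of 0 0]
      by (simp add: algebra_simps)
    have "P (- k *\<^sub>R w) (- k *\<^sub>R v) = P (k *\<^sub>R v) (k *\<^sub>R w)"
      using shift[of "- k *\<^sub>R w" "k *\<^sub>R v + k *\<^sub>R w" "- k *\<^sub>R v"] by simp
    moreover have "P (- k *\<^sub>R w) 0 = P 0 (k *\<^sub>R w)" "P 0 (- k *\<^sub>R v) = P (k *\<^sub>R v) 0"
      using shift[of "- k *\<^sub>R w" "k *\<^sub>R w" 0] shift[of 0 "k *\<^sub>R v" "- k *\<^sub>R v"] by auto
    ultimately show ?thesis unfolding expand by simp
  qed
  have "(\<integral>x. (f (x + h n *\<^sub>R v) - f x) / h n * ((g (x + h n *\<^sub>R w) - g x) / h n) \<partial>lborel)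
      = (\<integral>x. (f (x + (- h n) *\<^sub>R w) - f x) / (- h n) * ((g (x + (- h n) *\<^sub>R v) - g x) / (- h n)) \<partial>lborel)" for n
    using swap[of "h n"] by (simp only: times_divide_times_eq Bochner_Integration.integral_divide) simp
  then show ?thesis
    using LIMSEQ_unique[OF conv[OF h, of v w]] conv[OF mh, of w v] by (simp only:)
qed

section \<open>The energy density\<close>

lemma inner_transpose: "transpose X \<bullet> transpose Y = X \<bullet> (Y :: mat)"
  unfolding inner_vec_def transpose_def by (simp, subst sum.swap) simp

lemma norm_transpose: "norm (transpose X) = norm (X :: mat)"
  by (simp add: norm_eq_sqrt_inner inner_transpose)

lemma linear_transpose: "linear (transpose :: mat \<Rightarrow> mat)"
  by (rule linearI) (simp_all add: transpose_def vec_eq_iff)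

lemma linear_msym: "linear msym"
  unfolding msym_def
  by (intro linear_compose_scale_right linear_compose_add linear_transpose linear_ident)

lemma linear_mskew: "linear mskew"
  unfolding mskew_def
  by (intro linear_compose_scale_right linear_compose_sub linear_transpose linear_ident)

lemma linear_tapp: "linear (tapp C)"
  by (rule linearI)
    (simp_all add: tapp_def vec_eq_iff algebra_simps sum.distrib sum_distrib_left)

lemma is_sym_msym: "is_sym (msym X)"
  by (simp add: is_sym_def msym_def transpose_def vec_eq_iff)

lemma is_skew_mskew: "is_skew (mskew X)"
  by (simp add: is_skew_def mskew_def transpose_def vec_eq_iff diff_divide_distrib)

text \<open>Transposition is an isometry, so only the cross term
  \<open>X \<bullet> transpose X\<close> of the square remains. This is the term that Korn's
  inequality has to handle.\<close>

lemma power2_norm_msym: "(norm (msym X))\<^sup>2 = ((norm X)\<^sup>2 + X \<bullet> transpose X) / 2"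
  unfolding msym_def power2_norm_eq_inner
  by (simp add: inner_add_left inner_add_right inner_transpose inner_commute[of "transpose X" X]
      add_divide_distrib)

lemma norm_msym_le: "(norm (msym X))\<^sup>2 \<le> (norm X)\<^sup>2"
  unfolding power2_norm_msym using norm_cauchy_schwarz[of X "transpose X"]
  by (simp add: norm_transpose power2_eq_square)

lemma sum_UNIV_prod:
  fixes h :: "'a::finite \<times> 'b::finite \<Rightarrow> 'c::comm_monoid_add"
  shows "sum h UNIV = (\<Sum>i\<in>UNIV. \<Sum>j\<in>UNIV. h (i, j))"
  by (simp add: sum.cartesian_product flip: UNIV_Times_UNIV)

text \<open>With index pairs packed into single indices \<open>p\<close> and \<open>q\<close>, the
  fourfold sum is a double sum; one exchange of summations and the major symmetry finish.\<close>

lemma tapp_inner_commute: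
  assumes "major_sym C"
  shows "tapp C X \<bullet> Y = tapp C Y \<bullet> X"
proof -
  have expand: "tapp C X \<bullet> Y = (\<Sum>p\<in>UNIV. \<Sum>q\<in>UNIV.
      C $ fst p $ snd p $ fst q $ snd q * (X $ fst q $ snd q * Y $ fst p $ snd p))" for X Y
    unfolding inner_vec_def tapp_def sum_UNIV_prod
    by (simp add: sum_distrib_right mult.assoc)
  have "tapp C X \<bullet> Y = (\<Sum>q\<in>UNIV. \<Sum>p\<in>UNIV.
      C $ fst p $ snd p $ fst q $ snd q * (X $ fst q $ snd q * Y $ fst p $ snd p))"
    unfolding expand by (rule sum.swap)
  also have "\<dots> = (\<Sum>q\<in>UNIV. \<Sum>p\<in>UNIV.
      C $ fst q $ snd q $ fst p $ snd p * (Y $ fst p $ snd p * X $ fst q $ snd q))"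
    using assms unfolding major_sym_def by (intro sum.cong refl) (simp add: mult.commute[of "Y $ _ $ _"])
  also have "\<dots> = tapp C Y \<bullet> X" unfolding expand by simp
  finally show ?thesis .
qed

text \<open>The norm of this product type is Euclidean, so the square integral of a tuple is the sum
  of those of its parts, which is exactly the square of \<open>normX\<close>.\<close>

type_synonym point_state = "(real^3) \<times> mat \<times> mat \<times> mat"

text \<open>The integrand of \<open>W1\<close>; the integrand of \<open>W2\<close> is the case \<open>\<rho> = J = 0\<close>.\<close>

definition energy_density :: "real \<Rightarrow> real \<Rightarrow> real \<Rightarrow> real \<Rightarrow> tensor4 \<Rightarrow> tensor4 \<Rightarrow> tensor4 \<Rightarrow> tensor4
    \<Rightarrow> point_state \<Rightarrow> point_state \<Rightarrow> real" where
  "energy_density \<rho> J \<mu> Lc Ce Cc Cmicro Laniso s r = (case s of (u, G, P, C) \<Rightarrow> case r of (\<phi>, G\<phi>, \<Phi>, C\<Phi>) \<Rightarrow>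
     \<rho> * (u \<bullet> \<phi>) + J * (P \<bullet> \<Phi>)
   + tapp Ce (msym (G - P)) \<bullet> msym (G\<phi> - \<Phi>)
   + tapp Cc (mskew (G - P)) \<bullet> mskew (G\<phi> - \<Phi>)
   + tapp Cmicro (msym P) \<bullet> msym \<Phi>
   + \<mu> * Lc\<^sup>2 * (tapp Laniso C \<bullet> C\<Phi>))"

text \<open>In finite dimension bilinearity already implies boundedness.\<close>

lemma bounded_bilinear_energy_density: "bounded_bilinear (energy_density \<rho> J \<mu> Lc Ce Cc Cmicro Laniso)"
proof -
  note lin = linear_add[OF linear_msym] linear_add[OF linear_mskew] linear_add[OF linear_tapp]
    linear_diff[OF linear_msym] linear_diff[OF linear_mskew] linear_diff[OF linear_tapp]
    linear_cmul[OF linear_msym] linear_cmul[OF linear_mskew] linear_cmul[OF linear_tapp]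
  have "bilinear (energy_density \<rho> J \<mu> Lc Ce Cc Cmicro Laniso)"
    unfolding bilinear_def
    by (intro conjI allI linearI)
      (auto simp: energy_density_def lin inner_add_left inner_add_right inner_diff_left inner_diff_right
        algebra_simps split: prod.splits)
  then show ?thesis by (simp add: bilinear_conv_bounded_bilinear)
qed

lemma energy_density_commute:
  assumes "major_sym Ce" "major_sym Cc" "major_sym Cmicro" "major_sym Laniso"
  shows "energy_density \<rho> J \<mu> Lc Ce Cc Cmicro Laniso s r = energy_density \<rho> J \<mu> Lc Ce Cc Cmicro Laniso r s"
proof -
  obtain u G P C where s: "s = (u, G, P, C)" by (cases s) auto
  obtain u' G' P' C' where r: "r = (u', G', P', C')" by (cases r) auto
  show ?thesis
    using tapp_inner_commute[OF assms(1), of "msym (G - P)" "msym (G' - P')"]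
      tapp_inner_commute[OF assms(2), of "mskew (G - P)" "mskew (G' - P')"]
      tapp_inner_commute[OF assms(3), of "msym P" "msym P'"]
      tapp_inner_commute[OF assms(4), of C C'] inner_commute[of u u'] inner_commute[of P P']
    by (simp add: s r energy_density_def)
qed

text \<open>Half of \<open>J * (norm P)\<^sup>2\<close> is spent on passing from
  \<open>msym (G - P)\<close> to \<open>msym G\<close>, the other half controls \<open>P\<close>.
  The choice of \<open>k\<close> makes \<open>k / 2 * (norm (msym G))\<^sup>2\<close> affordable,
  and \<open>power2_norm_msym\<close> splits this into \<open>k / 4\<close> times
  \<open>(norm G)\<^sup>2\<close> and \<open>k / 4\<close> times the term without a sign, which
  stays on the left. Then \<open>c\<close> is the least of the coefficients left for
  \<open>u\<close>, \<open>P\<close>, \<open>G\<close> and \<open>C\<close>.\<close>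

lemma energy_density_lower_bound:
  assumes m: "0 < m" "\<And>X. is_sym X \<Longrightarrow> m * (norm X)\<^sup>2 \<le> tapp Ce X \<bullet> X"
      "\<And>X. m * (norm X)\<^sup>2 \<le> tapp Laniso X \<bullet> X"
    and nonneg: "\<And>X. is_sym X \<Longrightarrow> 0 \<le> tapp Cmicro X \<bullet> X" "\<And>X. is_skew X \<Longrightarrow> 0 \<le> tapp Cc X \<bullet> X"
    and k: "k = min m (J / 2)" and c: "c = min (min \<rho> (J / 2)) (min (k / 4) (\<mu> * Lc\<^sup>2 * m))"
    and pos: "0 < \<rho>" "0 < J" "0 < \<mu>" "0 < Lc"
  shows "c * (norm (u, G, P, C))\<^sup>2 + k / 4 * (G \<bullet> transpose G)
    \<le> energy_density \<rho> J \<mu> Lc Ce Cc Cmicro Laniso (u, G, P, C) (u, G, P, C)"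
proof -
  have k0: "0 < k" "k \<le> m" "k \<le> J / 2" using m pos unfolding k by auto
  have c_le: "c \<le> \<rho>" "c \<le> J / 2" "c \<le> k / 4" "c \<le> \<mu> * Lc\<^sup>2 * m" unfolding c by auto
  have tri: "(norm (msym G))\<^sup>2 \<le> 2 * (norm (msym (G - P)))\<^sup>2 + 2 * (norm P)\<^sup>2"
  proof -
    have "norm (msym G) \<le> norm (msym (G - P)) + norm (msym P)"
      using norm_triangle_ineq[of "msym (G - P)" "msym P"] by (simp add: linear_diff[OF linear_msym])
    then have "(norm (msym G))\<^sup>2 \<le> (norm (msym (G - P)) + norm (msym P))\<^sup>2" by (intro power_mono) auto
    also have "\<dots> \<le> 2 * (norm (msym (G - P)))\<^sup>2 + 2 * (norm (msym P))\<^sup>2"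
      using sum_squares_bound[of "norm (msym (G - P))" "norm (msym P)"] by (simp add: power2_sum)
    finally show ?thesis using norm_msym_le[of P] by linarith
  qed
  have "k / 4 * (norm G)\<^sup>2 + k / 4 * (G \<bullet> transpose G) = k / 2 * (norm (msym G))\<^sup>2"
    unfolding power2_norm_msym by (simp add: field_simps)
  also have "\<dots> \<le> k / 2 * (2 * (norm (msym (G - P)))\<^sup>2 + 2 * (norm P)\<^sup>2)"
    using tri k0 by (intro mult_left_mono) auto
  also have "\<dots> = k * (norm (msym (G - P)))\<^sup>2 + k * (norm P)\<^sup>2" by (simp add: field_simps)
  also have "\<dots> \<le> m * (norm (msym (G - P)))\<^sup>2 + J / 2 * (norm P)\<^sup>2"
    using k0 by (intro add_mono mult_right_mono) auto
  also have "\<dots> \<le> tapp Ce (msym (G - P)) \<bullet> msym (G - P) + J / 2 * (norm P)\<^sup>2"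
    using m(2)[OF is_sym_msym] by simp
  finally have G: "k / 4 * (norm G)\<^sup>2 + k / 4 * (G \<bullet> transpose G)
      \<le> tapp Ce (msym (G - P)) \<bullet> msym (G - P) + J / 2 * (norm P)\<^sup>2" .
  have C: "\<mu> * Lc\<^sup>2 * m * (norm C)\<^sup>2 \<le> \<mu> * Lc\<^sup>2 * (tapp Laniso C \<bullet> C)"
    using mult_left_mono[OF m(3), of "\<mu> * Lc\<^sup>2" C] pos by (simp add: mult.assoc)
  have "c * (norm (u, G, P, C))\<^sup>2
      = c * (norm u)\<^sup>2 + c * (norm G)\<^sup>2 + c * (norm P)\<^sup>2 + c * (norm C)\<^sup>2"
    by (simp add: norm_Pair algebra_simps)
  also have "\<dots> \<le> \<rho> * (norm u)\<^sup>2 + k / 4 * (norm G)\<^sup>2 + J / 2 * (norm P)\<^sup>2 + \<mu> * Lc\<^sup>2 * m * (norm C)\<^sup>2"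
    using c_le by (intro add_mono mult_right_mono) auto
  finally have "c * (norm (u, G, P, C))\<^sup>2 + k / 4 * (G \<bullet> transpose G)
      \<le> \<rho> * (norm u)\<^sup>2 + J * (norm P)\<^sup>2 + tapp Ce (msym (G - P)) \<bullet> msym (G - P)
        + \<mu> * Lc\<^sup>2 * (tapp Laniso C \<bullet> C)"
    using G C by linarith
  then show ?thesis
    using nonneg(1)[OF is_sym_msym, of P] nonneg(2)[OF is_skew_mskew, of "G - P"]
    unfolding energy_density_def by (simp add: power2_norm_eq_inner)
qed

section \<open>Test functions\<close>

lemma frechet_derivative_lincomb:
  assumes "F differentiable (at x)" "G differentiable (at x)"
  shows "frechet_derivative (\<lambda>x. a *\<^sub>R F x + b *\<^sub>R G x) (at x) v
      = a *\<^sub>R frechet_derivative F (at x) v + b *\<^sub>R frechet_derivative G (at x) v"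
  by (rule frechet_derivative_at[symmetric, THEN fun_cong])
    (intro derivative_intros assms[unfolded frechet_derivative_works])

lemma Cn_lincomb:
  "Cn n F \<Longrightarrow> Cn n G \<Longrightarrow> Cn n (\<lambda>x. a *\<^sub>R F x + b *\<^sub>R G x)"
  by (induction n arbitrary: F G)
    (auto simp: frechet_derivative_lincomb intro!: continuous_intros derivative_intros)

lemma test_fun_lincomb:
  assumes F: "test_fun \<Omega> F" and G: "test_fun \<Omega> G"
  shows "test_fun \<Omega> (\<lambda>x. a *\<^sub>R F x + b *\<^sub>R G x)"
proof -
  have sub: "closure {x. a *\<^sub>R F x + b *\<^sub>R G x \<noteq> 0} \<subseteq> closure {x. F x \<noteq> 0} \<union> closure {x. G x \<noteq> 0}"
    unfolding closure_Un[symmetric] by (intro closure_mono) auto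
  then have "compact (closure {x. a *\<^sub>R F x + b *\<^sub>R G x \<noteq> 0})"
    using F G closed_Int_compact[of "closure {x. a *\<^sub>R F x + b *\<^sub>R G x \<noteq> 0}"
        "closure {x. F x \<noteq> 0} \<union> closure {x. G x \<noteq> 0}"]
    unfolding test_fun_def by (simp add: compact_Un inf.absorb1)
  then show ?thesis using F G sub unfolding test_fun_def smooth_def by (blast intro: Cn_lincomb)
qed

lemma test_fun_differentiable: "test_fun \<Omega> F \<Longrightarrow> F differentiable (at x)"
  and test_fun_continuous_derivative:
    "test_fun \<Omega> F \<Longrightarrow> continuous_on UNIV (\<lambda>x. frechet_derivative F (at x) v)"
  and test_fun_continuous: "test_fun \<Omega> F \<Longrightarrow> continuous_on UNIV F"
  unfolding test_fun_def smooth_def by (metis Cn.simps)+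

text \<open>\<open>Curl\<close> differentiates the rows of a field and Korn's identity its
  components, whereas test functions are differentiable as whole maps.\<close>

lemma frechet_derivative_component:
  fixes F :: "pt \<Rightarrow> 'b::real_normed_vector ^ 3"
  assumes "F differentiable (at x)"
  shows "frechet_derivative (\<lambda>y. F y $ i) (at x) v = frechet_derivative F (at x) v $ i"
  by (rule frechet_derivative_at[symmetric, THEN fun_cong])
    (rule bounded_linear.has_derivative[OF bounded_linear_vec_nth assms[unfolded frechet_derivative_works]])

lemma grad_lincomb:
  assumes "test_fun \<Omega> u" "test_fun \<Omega> v"
  shows "grad (\<lambda>x. a *\<^sub>R u x + b *\<^sub>R v x) = (\<lambda>x. a *\<^sub>R grad u x + b *\<^sub>R grad v x)"
  using assms
  by (auto simp: fun_eq_iff vec_eq_iff grad_def pderiv_def frechet_derivative_lincomb test_fun_differentiable)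

lemma Curl_lincomb:
  assumes "test_fun \<Omega> P" "test_fun \<Omega> Q"
  shows "Curl (\<lambda>x. a *\<^sub>R P x + b *\<^sub>R Q x) = (\<lambda>x. a *\<^sub>R Curl P x + b *\<^sub>R Curl Q x)"
proof -
  have d: "P differentiable (at x)" "Q differentiable (at x)" for x
    using assms by (auto intro: test_fun_differentiable)
  then have "(\<lambda>x. a *\<^sub>R P x + b *\<^sub>R Q x) differentiable (at x)" for x
    by (auto intro!: derivative_intros)
  from frechet_derivative_component[OF this] show ?thesis
    by (auto simp: fun_eq_iff vec_eq_iff Curl_def curlv_def pderiv_def forall_3 vector_3
        frechet_derivative_component[OF d(1)] frechet_derivative_component[OF d(2)] frechet_derivative_lincomb[OF d] algebra_simps)
qed

lemma continuous_on_vec_components: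
  fixes F :: "'a::topological_space \<Rightarrow> 'b::topological_space ^ 'n"
  assumes "\<And>i. continuous_on S (\<lambda>x. F x $ i)"
  shows "continuous_on S F"
  using continuous_on_vec_lambda[of S "\<lambda>i x. F x $ i"] assms by simp

lemma continuous_grad: "test_fun \<Omega> u \<Longrightarrow> continuous_on UNIV (grad u)"
  by (intro continuous_on_vec_components)
    (auto simp: grad_def pderiv_def intro!: continuous_on_component test_fun_continuous_derivative)

lemma continuous_Curl:
  assumes "test_fun \<Omega> P" shows "continuous_on UNIV (Curl P)"
proof -
  have "continuous_on UNIV (\<lambda>x. Curl P x $ i $ j)" for i j
    using exhaust_3[of j] frechet_derivative_component[OF test_fun_differentiable[OF assms]]
    by (auto simp: Curl_def curlv_def pderiv_def vector_3)
      (intro continuous_intros test_fun_continuous_derivative[OF assms])+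
  then show ?thesis by (intro continuous_on_vec_components)
qed

lemma frechet_derivative_zero_outside_support:
  "x \<notin> closure {x. F x \<noteq> 0} \<Longrightarrow> frechet_derivative F (at x) v = 0"
  using closure_subset[of "{x. F x \<noteq> 0}"]
  by (intro frechet_derivative_zero_outside[of "closure {x. F x \<noteq> 0}"]) auto

lemma grad_zero_outside_support: "x \<notin> closure {x. u x \<noteq> 0} \<Longrightarrow> grad u x = 0"
  by (simp add: grad_def pderiv_def vec_eq_iff frechet_derivative_zero_outside_support)

lemma Curl_zero_outside_support:
  assumes "test_fun \<Omega> P" "x \<notin> closure {x. P x \<noteq> 0}" shows "Curl P x = 0"
  using frechet_derivative_component[OF test_fun_differentiable[OF assms(1)]] assms(2)
  by (simp add: Curl_def curlv_def pderiv_def vec_eq_iff forall_3 vector_3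
      frechet_derivative_zero_outside_support)

lemma square_integrable_continuous_compact_support:
  assumes "continuous_on UNIV f" "compact K" "\<And>x. x \<notin> K \<Longrightarrow> f x = 0"
  shows "square_integrable f"
  unfolding square_integrable_def using assms
  by (auto intro!: integrable_continuous_compact_support[of _ K] continuous_intros borel_measurable_continuous_onI)

text \<open>Korn's first inequality in disguise: the integral equals that of \<open>(div u)\<^sup>2\<close>.\<close>

lemma integral_grad_transpose_nonneg:
  assumes u: "test_fun \<Omega> u"
  shows "0 \<le> (\<integral>x. grad u x \<bullet> transpose (grad u x) \<partial>lborel)"
proof -
  define K where "K = closure {x. u x \<noteq> 0}"
  have K: "compact K" "\<And>x. x \<notin> K \<Longrightarrow> u x = 0"
    using u closure_subset[of "{x. u x \<noteq> 0}"] unfolding K_def test_fun_def by auto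
  note d = test_fun_differentiable[OF u]
  define D where "D i j x = frechet_derivative u (at x) (axis j 1) $ i" for i j :: 3 and x
  have D_cont: "continuous_on UNIV (D i j)" for i j
    unfolding D_def by (intro continuous_on_component test_fun_continuous_derivative[OF u])
  have D_int: "integrable lborel (\<lambda>x. D i j x * D k l x)" for i j k l
  proof (rule integrable_continuous_compact_support[OF _ K(1)])
    show "continuous_on UNIV (\<lambda>x. D i j x * D k l x)" by (intro continuous_intros D_cont)
  qed (simp add: D_def K_def frechet_derivative_zero_outside_support)
  have comp_diff: "(\<lambda>y. u y $ i) differentiable (at x)" for i x
    using bounded_linear.has_derivative[OF bounded_linear_vec_nth d[unfolded frechet_derivative_works]]
    by (auto simp: differentiable_def)
  \<comment> \<open>\<open>D i j\<close> is the derivative of component \<open>i\<close> in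
    direction \<open>j\<close>. Exchanging the two directions between components \<open>i\<close>
    and \<open>j\<close> turns the mixed product into a product of diagonal entries, which sum to
    the squared divergence.\<close>
  have swap: "(\<integral>x. D i j x * D j i x \<partial>lborel) = (\<integral>x. D i i x * D j j x \<partial>lborel)" for i j
    using integral_swap_directional_derivatives[of "\<lambda>y. u y $ i" "\<lambda>y. u y $ j" K "axis j 1" "axis i 1"]
      comp_diff K continuous_on_component[OF test_fun_continuous_derivative[OF u]]
    by (simp add: frechet_derivative_component[OF d] D_def)
  have "(\<integral>x. grad u x \<bullet> transpose (grad u x) \<partial>lborel) = (\<integral>x. (\<Sum>i\<in>UNIV. \<Sum>j\<in>UNIV. D i j x * D j i x) \<partial>lborel)"
    by (simp add: inner_vec_def transpose_def grad_def pderiv_def D_def)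
  also have "\<dots> = (\<Sum>i\<in>UNIV. \<Sum>j\<in>UNIV. (\<integral>x. D i j x * D j i x \<partial>lborel))"
    using D_int by (simp add: Bochner_Integration.integral_sum)
  also have "\<dots> = (\<Sum>i\<in>UNIV. \<Sum>j\<in>UNIV. (\<integral>x. D i i x * D j j x \<partial>lborel))" by (simp only: swap)
  also have "\<dots> = (\<integral>x. (\<Sum>i\<in>UNIV. D i i x)\<^sup>2 \<partial>lborel)"
    using D_int by (simp add: Bochner_Integration.integral_sum power2_eq_square sum_product)
  also have "\<dots> \<ge> 0" by simp
  finally show ?thesis .
qed

section \<open>The state space as a closed subspace\<close>

definition state_fun :: "pt set \<Rightarrow> state \<Rightarrow> pt \<Rightarrow> point_state" where
  "state_fun \<Omega> s x = (case s of (u, G, P, C) \<Rightarrow> indicator \<Omega> x *\<^sub>R (u x, G x, P x, C x))"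

definition L2_state :: "pt set \<Rightarrow> state \<Rightarrow> bool" where
  "L2_state \<Omega> s \<longleftrightarrow> square_integrable (state_fun \<Omega> s)"

definition embed_state :: "pt set \<Rightarrow> state \<Rightarrow> (pt, point_state) lsq" where
  "embed_state \<Omega> s = abs_lsq (state_fun \<Omega> s)"

lemma sqL2_alt: "sqL2 \<Omega> F = (\<integral>\<^sup>+x. ennreal ((norm (indicator \<Omega> x *\<^sub>R F x))\<^sup>2) \<partial>lborel)"
  unfolding sqL2_def by (intro nn_integral_cong) (simp add: indicator_def)

lemma L2_iff_square_integrable:
  fixes F :: "pt \<Rightarrow> 'b::euclidean_space"
  shows "L2 \<Omega> F \<longleftrightarrow> square_integrable (\<lambda>x. indicator \<Omega> x *\<^sub>R F x)"
  unfolding L2_def square_integrable_iff_nn_integral sqL2_alt by simp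

lemma square_integrable_Pair_iff:
  "square_integrable (\<lambda>x. (f x, g x)) \<longleftrightarrow> square_integrable f \<and> square_integrable g"
proof
  assume fg: "square_integrable (\<lambda>x. (f x, g x))"
  then have meas: "(\<lambda>x. (f x, g x)) \<in> borel_measurable borel"
    and int: "integrable lborel (\<lambda>x. (norm (f x, g x))\<^sup>2)"
    unfolding square_integrable_def by auto
  have "(\<lambda>x. fst (f x, g x)) \<in> borel_measurable borel" "(\<lambda>x. snd (f x, g x)) \<in> borel_measurable borel"
    by (rule measurable_compose[OF meas borel_measurable_continuous_onI], intro continuous_intros)+
  then show "square_integrable f \<and> square_integrable g"
    by (auto intro!: square_integrable_bounded_by[OF _ int] simp: norm_Pair)
next
  assume "square_integrable f \<and> square_integrable g"
  then show "square_integrable (\<lambda>x. (f x, g x))"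
    unfolding square_integrable_def by (auto simp: norm_Pair borel_prod[symmetric])
qed

lemma L2_state_iff: "L2_state \<Omega> (u, G, P, C) \<longleftrightarrow> L2 \<Omega> u \<and> L2 \<Omega> G \<and> L2 \<Omega> P \<and> L2 \<Omega> C"
  unfolding L2_state_def state_fun_def
  by (simp add: square_integrable_Pair_iff L2_iff_square_integrable)

lemma nn_integral_state_fun:
  assumes "L2_state \<Omega> (u, G, P, C)"
  shows "ennreal ((norm (embed_state \<Omega> (u, G, P, C)))\<^sup>2) = sqL2 \<Omega> u + sqL2 \<Omega> G + (sqL2 \<Omega> P + sqL2 \<Omega> C)"
proof -
  define u' G' P' C' where "u' x = indicator \<Omega> x *\<^sub>R u x" and "G' x = indicator \<Omega> x *\<^sub>R G x"
    and "P' x = indicator \<Omega> x *\<^sub>R P x" and "C' x = indicator \<Omega> x *\<^sub>R C x" for x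
  note defs = this
  have [measurable]: "u' \<in> borel_measurable borel" "G' \<in> borel_measurable borel"
      "P' \<in> borel_measurable borel" "C' \<in> borel_measurable borel"
    using assms by (auto simp: L2_state_iff L2_def defs[abs_def])
  have "ennreal ((norm (embed_state \<Omega> (u, G, P, C)))\<^sup>2)
      = (\<integral>\<^sup>+x. ennreal ((norm (state_fun \<Omega> (u, G, P, C) x))\<^sup>2) \<partial>lborel)"
    using assms unfolding embed_state_def L2_state_def by (rule nn_integral_norm_abs_lsq[symmetric])
  also have "\<dots> = (\<integral>\<^sup>+x. ennreal ((norm (u' x))\<^sup>2) + ennreal ((norm (G' x))\<^sup>2)
      + (ennreal ((norm (P' x))\<^sup>2) + ennreal ((norm (C' x))\<^sup>2)) \<partial>lborel)"
    by (intro nn_integral_cong)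
      (simp add: defs state_fun_def norm_Pair ennreal_plus[symmetric] add.assoc del: norm_scaleR ennreal_plus)
  also have "\<dots> = sqL2 \<Omega> u + sqL2 \<Omega> G + (sqL2 \<Omega> P + sqL2 \<Omega> C)"
    unfolding sqL2_alt defs[symmetric] by (simp add: nn_integral_add)
  finally show ?thesis .
qed

text \<open>\<open>normX\<close> is assembled through \<open>enn2real\<close>, which sends infinity
  to 0; it is additive here because \<open>L2_state\<close> makes all four integrals finite.\<close>

lemma normX_eq_norm_embed:
  assumes "L2_state \<Omega> s"
  shows "normX \<Omega> s = norm (embed_state \<Omega> s)"
proof -
  obtain u G P C where s: "s = (u, G, P, C)" by (cases s) auto
  have fin: "sqL2 \<Omega> u < top" "sqL2 \<Omega> G < top" "sqL2 \<Omega> P < top" "sqL2 \<Omega> C < top"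
    using assms unfolding s L2_state_iff L2_def by auto
  have "(norm (embed_state \<Omega> s))\<^sup>2 = enn2real (sqL2 \<Omega> u + sqL2 \<Omega> G + (sqL2 \<Omega> P + sqL2 \<Omega> C))"
    using nn_integral_state_fun[OF assms[unfolded s]] unfolding s by (metis enn2real_ennreal zero_le_power2)
  also have "\<dots> = enn2real (sqL2 \<Omega> u + sqL2 \<Omega> G) + enn2real (sqL2 \<Omega> P + sqL2 \<Omega> C)"
    using fin by (intro enn2real_plus) auto
  finally show ?thesis
    unfolding s normX_def normH1_def normHCurl_def by (simp add: real_sqrt_unique)
qed

lemma normH1_le_normX: "normH1 \<Omega> (u, G) \<le> normX \<Omega> (u, G, P, C)"
  and normHCurl_le_normX: "normHCurl \<Omega> (P, C) \<le> normX \<Omega> (u, G, P, C)"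
  unfolding normX_def by (auto simp: normH1_def normHCurl_def intro!: real_le_rsqrt)

lemma normX_eq_0_iff: "normX \<Omega> (u, G, P, C) = 0 \<longleftrightarrow> normH1 \<Omega> (u, G) = 0 \<and> normHCurl \<Omega> (P, C) = 0"
  unfolding normX_def by (simp add: add_nonneg_eq_0_iff)

text \<open>Common generalisation of \<open>sdiff\<close> and \<open>sscale\<close>, so that
  linearity is checked once; it also has the shape of the linearity clauses in
  \<open>dual_H01\<close> and \<open>dual_H0Curl\<close>.\<close>

definition slincomb :: "real \<Rightarrow> state \<Rightarrow> real \<Rightarrow> state \<Rightarrow> state" where
  "slincomb a s b r = (case s of (u, G, P, C) \<Rightarrow> case r of (u', G', P', C') \<Rightarrow>
      (\<lambda>x. a *\<^sub>R u x + b *\<^sub>R u' x, \<lambda>x. a *\<^sub>R G x + b *\<^sub>R G' x,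
       \<lambda>x. a *\<^sub>R P x + b *\<^sub>R P' x, \<lambda>x. a *\<^sub>R C x + b *\<^sub>R C' x))"

lemma sdiff_eq_slincomb: "sdiff s r = slincomb 1 s (- 1) r"
  and sscale_eq_slincomb: "sscale a s = slincomb a s 0 s"
  unfolding sdiff_def sscale_def slincomb_def by (auto split: prod.splits)

lemma embed_slincomb:
  assumes "L2_state \<Omega> s" "L2_state \<Omega> r"
  shows "L2_state \<Omega> (slincomb a s b r)" (is ?L2)
    and "embed_state \<Omega> (slincomb a s b r) = a *\<^sub>R embed_state \<Omega> s + b *\<^sub>R embed_state \<Omega> r" (is ?embed_state)
proof -
  have *: "state_fun \<Omega> (slincomb a s b r) = (\<lambda>x. a *\<^sub>R state_fun \<Omega> s x + b *\<^sub>R state_fun \<Omega> r x)"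
    unfolding state_fun_def slincomb_def
    by (auto simp: fun_eq_iff algebra_simps split: prod.splits)
  show ?L2 ?embed_state
    using assms unfolding L2_state_def embed_state_def *
    by (simp_all add: square_integrable_add square_integrable_scaleR scaleR_abs_lsq plus_abs_lsq)
qed

lemma embed_sdiff:
  assumes "L2_state \<Omega> s" "L2_state \<Omega> r"
  shows "L2_state \<Omega> (sdiff s r)" "embed_state \<Omega> (sdiff s r) = embed_state \<Omega> s - embed_state \<Omega> r"
  using embed_slincomb[OF assms, of 1 "- 1"] unfolding sdiff_eq_slincomb by auto

lemma embed_sscale:
  assumes "L2_state \<Omega> s"
  shows "L2_state \<Omega> (sscale a s)" "embed_state \<Omega> (sscale a s) = a *\<^sub>R embed_state \<Omega> s"
  using embed_slincomb[OF assms assms, of a 0] unfolding sscale_eq_slincomb by auto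

text \<open>The density vanishes when one argument is zero, so integrating over
  \<open>\<Omega>\<close> and integrating the extension by zero over the whole space give the same
  value.\<close>

lemma form_embed:
  assumes "L2_state \<Omega> s" "L2_state \<Omega> r"
  shows W1_eq_form: "W1 \<Omega> \<rho> J \<mu> Lc Ce Cc Cmicro Laniso s r
      = lsq_form (energy_density \<rho> J \<mu> Lc Ce Cc Cmicro Laniso) (embed_state \<Omega> s) (embed_state \<Omega> r)"
    and W2_eq_form: "W2 \<Omega> \<mu> Lc Ce Cc Cmicro Laniso s r
      = lsq_form (energy_density 0 0 \<mu> Lc Ce Cc Cmicro Laniso) (embed_state \<Omega> s) (embed_state \<Omega> r)"
proof -
  have form: "lsq_form (energy_density \<rho> J \<mu> Lc Ce Cc Cmicro Laniso) (embed_state \<Omega> s) (embed_state \<Omega> r)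
    = (\<integral>x. energy_density \<rho> J \<mu> Lc Ce Cc Cmicro Laniso (state_fun \<Omega> s x) (state_fun \<Omega> r x) \<partial>lborel)" for \<rho> J
    using assms unfolding embed_state_def L2_state_def
    by (intro lsq_form_abs bounded_bilinear_energy_density)
  have zero: "energy_density \<rho> J \<mu> Lc Ce Cc Cmicro Laniso (0, 0, 0, 0) e = 0" for \<rho> J e
    using bounded_bilinear.zero_left[OF bounded_bilinear_energy_density] by (simp add: zero_prod_def)
  obtain u G P C where s: "s = (u, G, P, C)" by (cases s) auto
  obtain u' G' P' C' where r: "r = (u', G', P', C')" by (cases r) auto
  have ind: "energy_density \<rho> J \<mu> Lc Ce Cc Cmicro Laniso (state_fun \<Omega> s x) (state_fun \<Omega> r x)
    = indicator \<Omega> x *\<^sub>R energy_density \<rho> J \<mu> Lc Ce Cc Cmicro Laniso (u x, G x, P x, C x) (u' x, G' x, P' x, C' x)" for \<rho> J x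
    unfolding s r state_fun_def by (cases "x \<in> \<Omega>") (simp_all add: zero)
  show "W1 \<Omega> \<rho> J \<mu> Lc Ce Cc Cmicro Laniso s r
      = lsq_form (energy_density \<rho> J \<mu> Lc Ce Cc Cmicro Laniso) (embed_state \<Omega> s) (embed_state \<Omega> r)"
    unfolding form ind by (simp add: W1_def s r set_lebesgue_integral_def energy_density_def)
  show "W2 \<Omega> \<mu> Lc Ce Cc Cmicro Laniso s r
      = lsq_form (energy_density 0 0 \<mu> Lc Ce Cc Cmicro Laniso) (embed_state \<Omega> s) (embed_state \<Omega> r)"
    unfolding form ind by (simp add: W2_def s r set_lebesgue_integral_def energy_density_def)
qed

section \<open>The closure of the test states and its description through \<open>inX\<close>\<close>

definition test_state :: "vfield \<Rightarrow> mfield \<Rightarrow> state" where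
  "test_state \<phi> \<Phi> = (\<phi>, grad \<phi>, \<Phi>, Curl \<Phi>)"

definition test_space :: "pt set \<Rightarrow> (pt, point_state) lsq set" where
  "test_space \<Omega> = {embed_state \<Omega> (test_state \<phi> \<Phi>) |\<phi> \<Phi>. test_fun \<Omega> \<phi> \<and> test_fun \<Omega> \<Phi>}"

definition energy_space :: "pt set \<Rightarrow> (pt, point_state) lsq set" where
  "energy_space \<Omega> = closure (test_space \<Omega>)"

text \<open>Cutting off at \<open>\<Omega>\<close> changes nothing, because the fields and their
  derivatives vanish outside supports contained in \<open>\<Omega>\<close>. A test state is thus a
  continuous field on the whole space, and integration by parts meets no boundary.\<close>

lemma test_state_fun:
  assumes "test_fun \<Omega> \<phi>" "test_fun \<Omega> \<Phi>"
  shows state_fun_test_state: "state_fun \<Omega> (test_state \<phi> \<Phi>) = (\<lambda>x. (\<phi> x, grad \<phi> x, \<Phi> x, Curl \<Phi> x))"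
    and L2_test_state: "L2_state \<Omega> (test_state \<phi> \<Phi>)"
proof -
  define K where "K = closure {x. \<phi> x \<noteq> 0} \<union> closure {x. \<Phi> x \<noteq> 0}"
  have K: "compact K" "K \<subseteq> \<Omega>" using assms unfolding K_def test_fun_def by auto
  have zero: "(\<phi> x, grad \<phi> x, \<Phi> x, Curl \<Phi> x) = 0" if "x \<notin> K" for x
  proof -
    have x: "x \<notin> closure {x. \<phi> x \<noteq> 0}" "x \<notin> closure {x. \<Phi> x \<noteq> 0}" using that unfolding K_def by auto
    then have "\<phi> x = 0" "\<Phi> x = 0"
      using closure_subset[of "{x. \<phi> x \<noteq> 0}"] closure_subset[of "{x. \<Phi> x \<noteq> 0}"] by auto
    then show ?thesis
      using grad_zero_outside_support[OF x(1)] Curl_zero_outside_support[OF assms(2) x(2)]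
      by (simp add: zero_prod_def)
  qed
  show eq: "state_fun \<Omega> (test_state \<phi> \<Phi>) = (\<lambda>x. (\<phi> x, grad \<phi> x, \<Phi> x, Curl \<Phi> x))"
  proof
    fix x
    show "state_fun \<Omega> (test_state \<phi> \<Phi>) x = (\<phi> x, grad \<phi> x, \<Phi> x, Curl \<Phi> x)"
    proof (cases "x \<in> \<Omega>")
      case False
      then have "x \<notin> K" using K by auto
      then show ?thesis using False zero[of x] unfolding state_fun_def test_state_def by (simp add: zero_prod_def)
    qed (simp add: state_fun_def test_state_def)
  qed
  show "L2_state \<Omega> (test_state \<phi> \<Phi>)"
    unfolding L2_state_def eq using zero
    by (intro square_integrable_continuous_compact_support[OF _ K(1)] continuous_on_Pair
        continuous_grad[OF assms(1)] continuous_Curl[OF assms(2)]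
        test_fun_continuous[OF assms(1)] test_fun_continuous[OF assms(2)]) auto
qed

lemma subspace_closure:
  fixes S :: "'a::real_normed_vector set"
  assumes S: "subspace S"
  shows "subspace (closure S)"
proof -
  have "0 \<in> closure S" using subspace_0[OF S] closure_subset by blast
  moreover have "x + y \<in> closure S" if xy: "x \<in> closure S" "y \<in> closure S" for x y
  proof -
    obtain f g where "\<And>n. f n \<in> S" "f \<longlonglongrightarrow> x" "\<And>n. g n \<in> S" "g \<longlonglongrightarrow> y"
      using xy unfolding closure_sequential by metis
    then show ?thesis unfolding closure_sequential
      by (intro exI[of _ "\<lambda>n. f n + g n"]) (auto intro!: tendsto_add subspace_add[OF S])
  qed
  moreover have "r *\<^sub>R x \<in> closure S" if x: "x \<in> closure S" for x r
  proof -
    obtain f where "\<And>n. f n \<in> S" "f \<longlonglongrightarrow> x" using x unfolding closure_sequential by metis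
    then show ?thesis unfolding closure_sequential
      by (intro exI[of _ "\<lambda>n. r *\<^sub>R f n"]) (auto intro!: tendsto_scaleR subspace_scale[OF S])
  qed
  ultimately show ?thesis by (auto intro: subspaceI)
qed

lemma test_fun_zero: "test_fun \<Omega> (\<lambda>x. 0 :: 'b::real_normed_vector)"
proof -
  have "Cn n (\<lambda>x. 0 :: 'b)" for n by (induction n) (auto simp: frechet_derivative_const)
  then show ?thesis unfolding test_fun_def smooth_def by simp
qed

lemma subspace_energy_space: "subspace (energy_space \<Omega>)"
proof -
  have lin: "a *\<^sub>R X + b *\<^sub>R Y \<in> test_space \<Omega>" if "X \<in> test_space \<Omega>" "Y \<in> test_space \<Omega>" for a b X Y
  proof -
    obtain \<phi> \<Phi> where X: "X = embed_state \<Omega> (test_state \<phi> \<Phi>)" "test_fun \<Omega> \<phi>" "test_fun \<Omega> \<Phi>"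
      using \<open>X \<in> test_space \<Omega>\<close> unfolding test_space_def by blast
    obtain \<psi> \<Psi> where Y: "Y = embed_state \<Omega> (test_state \<psi> \<Psi>)" "test_fun \<Omega> \<psi>" "test_fun \<Omega> \<Psi>"
      using \<open>Y \<in> test_space \<Omega>\<close> unfolding test_space_def by blast
    have "slincomb a (test_state \<phi> \<Phi>) b (test_state \<psi> \<Psi>)
        = test_state (\<lambda>x. a *\<^sub>R \<phi> x + b *\<^sub>R \<psi> x) (\<lambda>x. a *\<^sub>R \<Phi> x + b *\<^sub>R \<Psi> x)"
      unfolding test_state_def slincomb_def
      by (simp add: grad_lincomb[OF X(2) Y(2)] Curl_lincomb[OF X(3) Y(3)])
    then have "a *\<^sub>R X + b *\<^sub>R Y
        = embed_state \<Omega> (test_state (\<lambda>x. a *\<^sub>R \<phi> x + b *\<^sub>R \<psi> x) (\<lambda>x. a *\<^sub>R \<Phi> x + b *\<^sub>R \<Psi> x))"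
      using embed_slincomb(2)[OF L2_test_state[OF X(2,3)] L2_test_state[OF Y(2,3)]] X(1) Y(1) by metis
    then show ?thesis
      unfolding test_space_def using test_fun_lincomb[OF X(2) Y(2)] test_fun_lincomb[OF X(3) Y(3)] by blast
  qed
  have "embed_state \<Omega> (test_state (\<lambda>x. 0) (\<lambda>x. 0)) \<in> test_space \<Omega>"
    unfolding test_space_def mem_Collect_eq 
    by (rule exI[of _ "\<lambda>x. 0"], rule exI[of _ "\<lambda>x. 0"]) (simp add: test_fun_zero)
  then have "0 \<in> test_space \<Omega>" using lin[of _ _ 0 0] by fastforce
  then have "subspace (test_space \<Omega>)"
    using lin[of _ _ 1 1] lin[of _ _ _ 0] by (intro subspaceI) fastforce+
  then show ?thesis unfolding energy_space_def by (rule subspace_closure)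
qed

lemma closed_energy_space: "closed (energy_space \<Omega>)"
  unfolding energy_space_def by simp

lemma inX_imp_L2_state: "inX \<Omega> s \<Longrightarrow> L2_state \<Omega> s"
  unfolding inX_def H01_def H0Curl_def by (cases s) (auto simp: L2_state_iff)

text \<open>The squared distance is the sum of the four errors, and a sum of nonnegative terms tends
  to 0 exactly when each of them does.\<close>

lemma embed_tendsto_iff:
  assumes s: "L2_state \<Omega> (u, G, P, C)" and r: "\<And>n. L2_state \<Omega> (u' n, G' n, P' n, C' n)"
  shows "(\<lambda>n::nat. embed_state \<Omega> (u' n, G' n, P' n, C' n)) \<longlonglongrightarrow> embed_state \<Omega> (u, G, P, C) \<longleftrightarrow>
    (\<lambda>n. sqL2 \<Omega> (\<lambda>x. u' n x - u x)) \<longlonglongrightarrow> 0 \<and> (\<lambda>n. sqL2 \<Omega> (\<lambda>x. G' n x - G x)) \<longlonglongrightarrow> 0 \<and>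
    (\<lambda>n. sqL2 \<Omega> (\<lambda>x. P' n x - P x)) \<longlonglongrightarrow> 0 \<and> (\<lambda>n. sqL2 \<Omega> (\<lambda>x. C' n x - C x)) \<longlonglongrightarrow> 0"
    (is "?lhs \<longleftrightarrow> ?A \<longlonglongrightarrow> 0 \<and> ?B \<longlonglongrightarrow> 0 \<and> ?C \<longlonglongrightarrow> 0 \<and> ?D \<longlonglongrightarrow> 0")
proof -
  have eq: "ennreal ((norm (embed_state \<Omega> (u' n, G' n, P' n, C' n) - embed_state \<Omega> (u, G, P, C)))\<^sup>2)
      = ?A n + ?B n + (?C n + ?D n)" for n
    using nn_integral_state_fun[of \<Omega> "\<lambda>x. u' n x - u x" "\<lambda>x. G' n x - G x" "\<lambda>x. P' n x - P x" "\<lambda>x. C' n x - C x"]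
      embed_sdiff[OF r[of n] s] by (simp add: sdiff_def)
  have "?lhs \<longleftrightarrow> (\<lambda>n. (norm (embed_state \<Omega> (u' n, G' n, P' n, C' n) - embed_state \<Omega> (u, G, P, C)))\<^sup>2) \<longlonglongrightarrow> 0"
    by (subst LIM_zero_iff[symmetric], subst tendsto_norm_zero_iff[symmetric]) (simp add: power_tendsto_0_iff)
  also have "\<dots> \<longleftrightarrow> (\<lambda>n. ?A n + ?B n + (?C n + ?D n)) \<longlonglongrightarrow> 0"
    unfolding eq[symmetric] by (rule ennreal_tendsto_0_iff[symmetric]) simp
  also have "\<dots> \<longleftrightarrow> ?A \<longlonglongrightarrow> 0 \<and> ?B \<longlonglongrightarrow> 0 \<and> ?C \<longlonglongrightarrow> 0 \<and> ?D \<longlonglongrightarrow> 0"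
  proof
    assume lim: "(\<lambda>n. ?A n + ?B n + (?C n + ?D n)) \<longlonglongrightarrow> 0"
    have "f \<longlonglongrightarrow> 0" if "\<And>n. f n \<le> ?A n + ?B n + (?C n + ?D n)" for f :: "nat \<Rightarrow> ennreal"
      by (rule tendsto_sandwich[OF _ _ tendsto_const lim]) (use that in auto)
    then show "?A \<longlonglongrightarrow> 0 \<and> ?B \<longlonglongrightarrow> 0 \<and> ?C \<longlonglongrightarrow> 0 \<and> ?D \<longlonglongrightarrow> 0"
      by (simp add: add_increasing add_increasing2)
  next
    assume "?A \<longlonglongrightarrow> 0 \<and> ?B \<longlonglongrightarrow> 0 \<and> ?C \<longlonglongrightarrow> 0 \<and> ?D \<longlonglongrightarrow> 0"
    then have "(\<lambda>n. ?A n + ?B n + (?C n + ?D n)) \<longlonglongrightarrow> 0 + 0 + (0 + 0)"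
      by (intro tendsto_add) auto
    then show "(\<lambda>n. ?A n + ?B n + (?C n + ?D n)) \<longlonglongrightarrow> 0" by simp
  qed
  finally show ?thesis .
qed

text \<open>\<open>inX\<close> approximates \<open>(u, G)\<close> and \<open>(P, C)\<close> by two
  unrelated sequences of test functions; pairing them index by index approximates the whole state.
  Conversely, convergence of test states splits into its four components.\<close>

lemma inX_iff: "inX \<Omega> s \<longleftrightarrow> L2_state \<Omega> s \<and> embed_state \<Omega> s \<in> energy_space \<Omega>"
proof -
  obtain u G P C where s: "s = (u, G, P, C)" by (cases s) auto
  show ?thesis
  proof
    assume X: "inX \<Omega> s"
    note L2 = inX_imp_L2_state[OF X]
    obtain \<phi> where \<phi>: "\<And>n. test_fun \<Omega> (\<phi> n)" "(\<lambda>n. sqL2 \<Omega> (\<lambda>x. \<phi> n x - u x)) \<longlonglongrightarrow> 0"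
        "(\<lambda>n. sqL2 \<Omega> (\<lambda>x. grad (\<phi> n) x - G x)) \<longlonglongrightarrow> 0"
      using X unfolding s inX_def H01_def by auto
    obtain \<Phi> where \<Phi>: "\<And>n. test_fun \<Omega> (\<Phi> n)" "(\<lambda>n. sqL2 \<Omega> (\<lambda>x. \<Phi> n x - P x)) \<longlonglongrightarrow> 0"
        "(\<lambda>n. sqL2 \<Omega> (\<lambda>x. Curl (\<Phi> n) x - C x)) \<longlonglongrightarrow> 0"
      using X unfolding s inX_def H0Curl_def by auto
    have "(\<lambda>n. embed_state \<Omega> (test_state (\<phi> n) (\<Phi> n))) \<longlonglongrightarrow> embed_state \<Omega> s"
      unfolding s test_state_def using \<phi> \<Phi> L2 L2_test_state[OF \<phi>(1) \<Phi>(1)]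
      by (subst embed_tendsto_iff) (auto simp: s test_state_def)
    moreover have "embed_state \<Omega> (test_state (\<phi> n) (\<Phi> n)) \<in> test_space \<Omega>" for n
      unfolding test_space_def using \<phi>(1) \<Phi>(1) by blast
    ultimately have "embed_state \<Omega> s \<in> energy_space \<Omega>"
      unfolding energy_space_def closure_sequential
      by (intro exI[of _ "\<lambda>n. embed_state \<Omega> (test_state (\<phi> n) (\<Phi> n))"]) auto
    then show "L2_state \<Omega> s \<and> embed_state \<Omega> s \<in> energy_space \<Omega>" using L2 by blast
  next
    assume X: "L2_state \<Omega> s \<and> embed_state \<Omega> s \<in> energy_space \<Omega>"
    then obtain Y where Y: "\<And>n. Y n \<in> test_space \<Omega>" "Y \<longlonglongrightarrow> embed_state \<Omega> s"
      unfolding energy_space_def closure_sequential by blast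
    have "\<exists>\<phi> \<Phi>. Y n = embed_state \<Omega> (test_state \<phi> \<Phi>) \<and> test_fun \<Omega> \<phi> \<and> test_fun \<Omega> \<Phi>" for n
      using Y(1)[of n] unfolding test_space_def by blast
    then obtain \<phi> \<Phi> where t: "\<And>n. Y n = embed_state \<Omega> (test_state (\<phi> n) (\<Phi> n))"
        "\<And>n. test_fun \<Omega> (\<phi> n)" "\<And>n. test_fun \<Omega> (\<Phi> n)"
      by metis
    have "Y = (\<lambda>n. embed_state \<Omega> (\<phi> n, grad (\<phi> n), \<Phi> n, Curl (\<Phi> n)))"
      using t(1) unfolding test_state_def by (rule ext)
    then have "(\<lambda>n. embed_state \<Omega> (\<phi> n, grad (\<phi> n), \<Phi> n, Curl (\<Phi> n))) \<longlonglongrightarrow> embed_state \<Omega> (u, G, P, C)"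
      using Y(2) unfolding s by simp
    then have "(\<lambda>n. sqL2 \<Omega> (\<lambda>x. \<phi> n x - u x)) \<longlonglongrightarrow> 0 \<and> (\<lambda>n. sqL2 \<Omega> (\<lambda>x. grad (\<phi> n) x - G x)) \<longlonglongrightarrow> 0 \<and>
      (\<lambda>n. sqL2 \<Omega> (\<lambda>x. \<Phi> n x - P x)) \<longlonglongrightarrow> 0 \<and> (\<lambda>n. sqL2 \<Omega> (\<lambda>x. Curl (\<Phi> n) x - C x)) \<longlonglongrightarrow> 0"
      using X L2_test_state[OF t(2,3)] by (subst (asm) embed_tendsto_iff) (auto simp: s test_state_def)
    moreover have "L2 \<Omega> u \<and> L2 \<Omega> G \<and> L2 \<Omega> P \<and> L2 \<Omega> C" using X unfolding s L2_state_iff by blast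
    ultimately show "inX \<Omega> s"
      unfolding s inX_def H01_def H0Curl_def using t(2,3) by auto
  qed
qed

text \<open>Test states vanish off \<open>\<Omega>\<close>, so the mass of \<open>X\<close> there is
  at most its squared distance to any approximant, hence 0. A representative of \<open>X\<close> may
  therefore be cut off at \<open>\<Omega>\<close> and read as a state.\<close>

lemma energy_space_representable:
  assumes \<Omega>: "\<Omega> \<in> sets borel" and X: "X \<in> energy_space \<Omega>"
  shows "\<exists>s. inX \<Omega> s \<and> embed_state \<Omega> s = X"
proof -
  define f where "f = rep_lsq X"
  have f: "square_integrable f" "abs_lsq f = X" unfolding f_def by auto
  have [measurable]: "f \<in> borel_measurable borel" using f(1) by (rule square_integrableD)
  have [measurable]: "\<Omega> \<in> sets borel" by (rule \<Omega>)
  obtain Y where Y: "\<And>n. Y n \<in> test_space \<Omega>" "Y \<longlonglongrightarrow> X"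
    using X unfolding energy_space_def closure_sequential by blast
  have "(\<integral>\<^sup>+x. indicator (- \<Omega>) x * ennreal ((norm (f x))\<^sup>2) \<partial>lborel) \<le> ennreal ((norm (X - Y n))\<^sup>2)" for n
  proof -
    obtain \<phi> \<Phi> where t: "Y n = embed_state \<Omega> (test_state \<phi> \<Phi>)" "test_fun \<Omega> \<phi>" "test_fun \<Omega> \<Phi>"
      using Y(1)[of n] unfolding test_space_def by blast
    define g where "g = state_fun \<Omega> (test_state \<phi> \<Phi>)"
    have g: "square_integrable g" "Y n = abs_lsq g"
      using L2_test_state[OF t(2,3)] t(1) unfolding g_def L2_state_def embed_state_def by auto
    have "(\<integral>\<^sup>+x. indicator (- \<Omega>) x * ennreal ((norm (f x))\<^sup>2) \<partial>lborel)
        \<le> (\<integral>\<^sup>+x. ennreal ((norm (f x - g x))\<^sup>2) \<partial>lborel)"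
      by (intro nn_integral_mono) (auto simp: indicator_def g_def state_fun_def test_state_def zero_prod_def[symmetric])
    also have "\<dots> = ennreal ((norm (X - Y n))\<^sup>2)"
      using nn_integral_norm_abs_lsq[OF square_integrable_diff[OF f(1) g(1)]] minus_abs_lsq[OF f(1) g(1)] f(2) g(2)
      by simp
    finally show ?thesis .
  qed
  moreover have "(\<lambda>n. ennreal ((norm (X - Y n))\<^sup>2)) \<longlonglongrightarrow> ennreal ((norm (X - X))\<^sup>2)"
    by (intro tendsto_intros Y)
  ultimately have "(\<integral>\<^sup>+x. indicator (- \<Omega>) x * ennreal ((norm (f x))\<^sup>2) \<partial>lborel) \<le> ennreal ((norm (X - X))\<^sup>2)"
    by (intro LIMSEQ_le_const) auto
  then have "(\<integral>\<^sup>+x. indicator (- \<Omega>) x * ennreal ((norm (f x))\<^sup>2) \<partial>lborel) = 0" by simp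
  then have "AE x in lborel. indicator (- \<Omega>) x * ennreal ((norm (f x))\<^sup>2) = 0"
    by (subst (asm) nn_integral_0_iff_AE) auto
  then have AE: "AE x in lborel. f x = indicator \<Omega> x *\<^sub>R f x"
    by eventually_elim (auto simp: indicator_def split: if_splits)
  define s where "s = (\<lambda>x. fst (f x), \<lambda>x. fst (snd (f x)), \<lambda>x. fst (snd (snd (f x))), \<lambda>x. snd (snd (snd (f x))))"
  have s: "state_fun \<Omega> s = (\<lambda>x. indicator \<Omega> x *\<^sub>R f x)"
    unfolding s_def state_fun_def by (simp add: fun_eq_iff prod_eq_iff)
  have L2: "square_integrable (\<lambda>x. indicator \<Omega> x *\<^sub>R f x)"
    using f(1) by (intro square_integrable_bounded_by[where g = "\<lambda>x. (norm (f x))\<^sup>2"])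
      (auto simp: square_integrable_def indicator_def)
  have "embed_state \<Omega> s = X"
    unfolding embed_state_def s f(2)[symmetric] using AE by (subst abs_lsq_eq_iff[OF L2 f(1)]) auto
  moreover have "L2_state \<Omega> s" unfolding L2_state_def s by (rule L2)
  ultimately show ?thesis using X inX_iff by blast
qed

lemma energy_density_form_coercive:
  assumes m: "0 < m" "\<And>X. is_sym X \<Longrightarrow> m * (norm X)\<^sup>2 \<le> tapp Ce X \<bullet> X"
      "\<And>X. m * (norm X)\<^sup>2 \<le> tapp Laniso X \<bullet> X"
    and nonneg: "\<And>X. is_sym X \<Longrightarrow> 0 \<le> tapp Cmicro X \<bullet> X" "\<And>X. is_skew X \<Longrightarrow> 0 \<le> tapp Cc X \<bullet> X"
    and pos: "0 < \<rho>" "0 < J" "0 < \<mu>" "0 < Lc"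
  shows "\<exists>c>0. \<forall>X\<in>energy_space \<Omega>.
    c * (norm X)\<^sup>2 \<le> lsq_form (energy_density \<rho> J \<mu> Lc Ce Cc Cmicro Laniso) X X"
proof -
  define q where "q = energy_density \<rho> J \<mu> Lc Ce Cc Cmicro Laniso"
  define k where "k = min m (J / 2)"
  define c where "c = min (min \<rho> (J / 2)) (min (k / 4) (\<mu> * Lc\<^sup>2 * m))"
  have k: "k > 0" unfolding k_def using m pos by simp
  then have c: "c > 0" unfolding c_def using m pos by simp
  have q: "bounded_bilinear q" unfolding q_def by (rule bounded_bilinear_energy_density)
  have "c * (norm X)\<^sup>2 \<le> lsq_form q X X" if X: "X \<in> test_space \<Omega>" for X
  proof -
    obtain \<phi> \<Phi> where t: "X = embed_state \<Omega> (test_state \<phi> \<Phi>)" "test_fun \<Omega> \<phi>" "test_fun \<Omega> \<Phi>"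
      using X unfolding test_space_def by blast
    define f where "f x = (\<phi> x, grad \<phi> x, \<Phi> x, Curl \<Phi> x)" for x
    have f: "square_integrable f" "X = abs_lsq f"
      using L2_test_state[OF t(2,3)] t(1) state_fun_test_state[OF t(2,3)]
      unfolding f_def L2_state_def embed_state_def by auto
    have int1: "integrable lborel (\<lambda>x. (norm (f x))\<^sup>2)" using f(1) unfolding square_integrable_def by blast
    have int2: "integrable lborel (\<lambda>x. grad \<phi> x \<bullet> transpose (grad \<phi> x))"
    proof (rule integrable_continuous_compact_support)
      show "continuous_on UNIV (\<lambda>x. grad \<phi> x \<bullet> transpose (grad \<phi> x))"
        by (intro continuous_intros continuous_grad[OF t(2)]
            linear_continuous_on_compose[OF _ linear_transpose])
      show "compact (closure {x. \<phi> x \<noteq> 0})" using t(2) unfolding test_fun_def by blast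
    qed (simp add: grad_zero_outside_support)
    \<comment> \<open>The Korn integral is nonnegative on test states and may be added for free; it
      supplies the term that the pointwise bound requires.\<close>
    have "c * (norm X)\<^sup>2 \<le> c * (norm X)\<^sup>2 + k / 4 * (\<integral>x. grad \<phi> x \<bullet> transpose (grad \<phi> x) \<partial>lborel)"
      using integral_grad_transpose_nonneg[OF t(2)] k by simp
    also have "\<dots> = (\<integral>x. c * (norm (f x))\<^sup>2 + k / 4 * (grad \<phi> x \<bullet> transpose (grad \<phi> x)) \<partial>lborel)"
      using int1 int2 power2_norm_abs_lsq[OF f(1)] f(2) by simp
    also have "\<dots> \<le> (\<integral>x. q (f x) (f x) \<partial>lborel)"
    proof (rule integral_mono)
      show "integrable lborel (\<lambda>x. c * (norm (f x))\<^sup>2 + k / 4 * (grad \<phi> x \<bullet> transpose (grad \<phi> x)))"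
        using int1 int2 by auto
      show "integrable lborel (\<lambda>x. q (f x) (f x))" by (rule integrable_bilinear[OF q f(1) f(1)])
      show "c * (norm (f x))\<^sup>2 + k / 4 * (grad \<phi> x \<bullet> transpose (grad \<phi> x)) \<le> q (f x) (f x)" for x
        unfolding f_def q_def using energy_density_lower_bound[OF m nonneg k_def c_def pos] by blast
    qed
    also have "\<dots> = lsq_form q X X" using lsq_form_abs[OF q f(1) f(1)] f(2) by simp
    finally show ?thesis .
  qed
  then have "test_space \<Omega> \<subseteq> {X. c * (norm X)\<^sup>2 \<le> lsq_form q X X}" by blast
  moreover have "closed {X :: (pt, point_state) lsq. c * (norm X)\<^sup>2 \<le> lsq_form q X X}"
    by (intro closed_Collect_le continuous_intros
        bounded_bilinear.continuous_on[OF bounded_bilinear_lsq_form[OF q]])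
  ultimately have "energy_space \<Omega> \<subseteq> {X. c * (norm X)\<^sup>2 \<le> lsq_form q X X}"
    unfolding energy_space_def by (rule closure_minimal)
  then show ?thesis using c unfolding q_def by blast
qed

section \<open>Loads, derivatives and initial data\<close>

lemma lfm_slincomb:
  assumes "dual_H01 \<Omega> f" "dual_H0Curl \<Omega> M" "inX \<Omega> s" "inX \<Omega> r"
  shows "lfm f M (slincomb a s b r) = a * lfm f M s + b * lfm f M r"
  using assms unfolding dual_H01_def dual_H0Curl_def inX_def lfm_def slincomb_def
  by (auto split: prod.splits simp: algebra_simps)

lemma lfm_bounded:
  assumes "dual_H01 \<Omega> f" "dual_H0Curl \<Omega> M"
  shows "\<exists>K. \<forall>s. inX \<Omega> s \<longrightarrow> \<bar>lfm f M s\<bar> \<le> K * norm (embed_state \<Omega> s)"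
proof -
  obtain K1 where K1: "\<And>uG. H01 \<Omega> uG \<Longrightarrow> \<bar>f uG\<bar> \<le> K1 * normH1 \<Omega> uG"
    using assms unfolding dual_H01_def by blast
  obtain K2 where K2: "\<And>PC. H0Curl \<Omega> PC \<Longrightarrow> \<bar>M PC\<bar> \<le> K2 * normHCurl \<Omega> PC"
    using assms unfolding dual_H0Curl_def by blast
  \<comment> \<open>The constants in the dual conditions carry no sign, hence the absolute
    values.\<close>
  have "\<bar>lfm f M s\<bar> \<le> (\<bar>K1\<bar> + \<bar>K2\<bar>) * norm (embed_state \<Omega> s)" if X: "inX \<Omega> s" for s
  proof -
    obtain u G P C where s: "s = (u, G, P, C)" by (cases s) auto
    have H: "H01 \<Omega> (u, G)" "H0Curl \<Omega> (P, C)" using X unfolding s inX_def by auto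
    have nn: "0 \<le> normH1 \<Omega> (u, G)" "0 \<le> normHCurl \<Omega> (P, C)"
      unfolding normH1_def normHCurl_def by auto
    have "\<bar>f (u, G)\<bar> \<le> \<bar>K1\<bar> * normH1 \<Omega> (u, G)" "\<bar>M (P, C)\<bar> \<le> \<bar>K2\<bar> * normHCurl \<Omega> (P, C)"
      using K1[OF H(1)] K2[OF H(2)] nn by (meson abs_ge_self mult_right_mono order_trans)+
    then have "\<bar>f (u, G)\<bar> \<le> \<bar>K1\<bar> * normX \<Omega> s" "\<bar>M (P, C)\<bar> \<le> \<bar>K2\<bar> * normX \<Omega> s"
      using normH1_le_normX normHCurl_le_normX unfolding s by (meson abs_ge_zero mult_left_mono order_trans)+
    then show ?thesis
      unfolding normX_eq_norm_embed[OF inX_imp_L2_state[OF X]]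
      by (simp add: lfm_def s distrib_right)
  qed
  then show ?thesis by blast
qed

lemma inX_slincomb: "inX \<Omega> s \<Longrightarrow> inX \<Omega> r \<Longrightarrow> inX \<Omega> (slincomb a s b r)"
  using subspace_energy_space[of \<Omega>] embed_slincomb[of \<Omega> s r a b]
  by (simp add: inX_iff subspace_add subspace_scale)

text \<open>Loads act on functions, but their norm bound makes them vanish on states of norm zero,
  so they depend on the class only.\<close>

lemma lfm_cong:
  assumes "dual_H01 \<Omega> f" "dual_H0Curl \<Omega> M" "inX \<Omega> s" "inX \<Omega> r" "embed_state \<Omega> s = embed_state \<Omega> r"
  shows "lfm f M s = lfm f M r"
proof -
  obtain K where K: "\<And>s. inX \<Omega> s \<Longrightarrow> \<bar>lfm f M s\<bar> \<le> K * norm (embed_state \<Omega> s)"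
    using lfm_bounded[OF assms(1,2)] by blast
  have "embed_state \<Omega> (slincomb 1 s (- 1) r) = 0"
    using embed_slincomb(2)[OF inX_imp_L2_state[OF assms(3)] inX_imp_L2_state[OF assms(4)]] assms(5) by simp
  then have "lfm f M (slincomb 1 s (- 1) r) = 0"
    using K[OF inX_slincomb[OF assms(3,4)], of 1 "- 1"] by simp
  then show ?thesis using lfm_slincomb[OF assms(1-4), of 1 "- 1"] by simp
qed

lemma lfm_continuous:
  assumes f: "cont_dual \<Omega> T f M" and t: "t \<in> {0..T}" and \<epsilon>: "0 < \<epsilon>"
  shows "\<exists>\<delta>>0. \<forall>s\<in>{0..T}. \<bar>s - t\<bar> < \<delta> \<longrightarrow>
    (\<forall>r. inX \<Omega> r \<longrightarrow> \<bar>lfm (f s) (M s) r - lfm (f t) (M t) r\<bar> \<le> \<epsilon> * norm (embed_state \<Omega> r))"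
proof -
  note f[unfolded cont_dual_def, THEN conjunct2, THEN bspec, OF t]
  from this[rule_format, of "\<epsilon> / 2"] \<epsilon> obtain \<delta> where \<delta>: "\<delta> > 0" "\<And>s uG. s \<in> {0..T} \<Longrightarrow> \<bar>s - t\<bar> < \<delta> \<Longrightarrow> H01 \<Omega> uG \<Longrightarrow>
        \<bar>f s uG - f t uG\<bar> \<le> \<epsilon> / 2 * normH1 \<Omega> uG"
      "\<And>s PC. s \<in> {0..T} \<Longrightarrow> \<bar>s - t\<bar> < \<delta> \<Longrightarrow> H0Curl \<Omega> PC \<Longrightarrow>
        \<bar>M s PC - M t PC\<bar> \<le> \<epsilon> / 2 * normHCurl \<Omega> PC"
    by auto
  have "\<bar>lfm (f s) (M s) r - lfm (f t) (M t) r\<bar> \<le> \<epsilon> * norm (embed_state \<Omega> r)"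
    if s: "s \<in> {0..T}" "\<bar>s - t\<bar> < \<delta>" and X: "inX \<Omega> r" for s r
  proof -
    obtain u G P C where r: "r = (u, G, P, C)" by (cases r) auto
    have H: "H01 \<Omega> (u, G)" "H0Curl \<Omega> (P, C)" using X unfolding r inX_def by auto
    have "\<bar>f s (u, G) - f t (u, G)\<bar> \<le> \<epsilon> / 2 * normX \<Omega> r" "\<bar>M s (P, C) - M t (P, C)\<bar> \<le> \<epsilon> / 2 * normX \<Omega> r"
      using order_trans[OF \<delta>(2)[OF s H(1)] mult_left_mono[OF normH1_le_normX]]
        order_trans[OF \<delta>(3)[OF s H(2)] mult_left_mono[OF normHCurl_le_normX]] \<epsilon> unfolding r by auto
    from add_mono[OF this]
    have "\<bar>f s (u, G) - f t (u, G)\<bar> + \<bar>M s (P, C) - M t (P, C)\<bar> \<le> \<epsilon> * normX \<Omega> r" by simp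
    moreover have "\<bar>lfm (f s) (M s) r - lfm (f t) (M t) r\<bar>
        \<le> \<bar>f s (u, G) - f t (u, G)\<bar> + \<bar>M s (P, C) - M t (P, C)\<bar>"
      using abs_triangle_ineq[of "f s (u, G) - f t (u, G)" "M s (P, C) - M t (P, C)"]
      by (simp add: lfm_def r algebra_simps)
    ultimately show ?thesis
      unfolding normX_eq_norm_embed[OF inX_imp_L2_state[OF X]] by (rule order_trans[rotated])
  qed
  then show ?thesis using \<delta>(1) by blast
qed

text \<open>Brings the library notion of derivative into the difference quotient form of
  \<open>has_X_deriv\<close>; the two expressions agree for \<open>s \<noteq> t\<close>, and the
  filter excludes \<open>t\<close>.\<close>

lemma has_vector_derivative_iff_quotient:
  fixes w :: "real \<Rightarrow> 'a::real_normed_vector"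
  shows "(w has_vector_derivative D) (at t within A) \<longleftrightarrow>
    ((\<lambda>s. norm ((1 / (s - t)) *\<^sub>R (w s - w t) - D)) \<longlongrightarrow> 0) (at t within A)"
proof -
  have "norm (w s - w t - (s - t) *\<^sub>R D) / norm (s - t) = norm ((1 / (s - t)) *\<^sub>R (w s - w t) - D)"
    if "s \<noteq> t" for s
  proof -
    have "(1 / (s - t)) *\<^sub>R (w s - w t) - D = (1 / (s - t)) *\<^sub>R (w s - w t - (s - t) *\<^sub>R D)"
      using that by (simp add: scaleR_diff_right)
    then show ?thesis by (simp add: divide_inverse mult.commute abs_inverse)
  qed
  then have "((\<lambda>s. norm (w s - w t - (s - t) *\<^sub>R D) / norm (s - t)) \<longlongrightarrow> 0) (at t within A) \<longleftrightarrow>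
    ((\<lambda>s. norm ((1 / (s - t)) *\<^sub>R (w s - w t) - D)) \<longlongrightarrow> 0) (at t within A)"
    by (intro tendsto_cong) (auto simp: eventually_at_filter)
  then show ?thesis
    unfolding has_vector_derivative_def has_derivative_iff_norm
    by (simp add: bounded_linear_scaleR_left)
qed

lemma has_X_deriv_iff:
  assumes "\<And>t. t \<in> {0..T} \<Longrightarrow> inX \<Omega> (w t) \<and> inX \<Omega> (w' t)"
  shows "has_X_deriv \<Omega> T w w' \<longleftrightarrow> (\<forall>t\<in>{0..T}.
    ((\<lambda>s. embed_state \<Omega> (w s)) has_vector_derivative embed_state \<Omega> (w' t)) (at t within {0..T}))"
  unfolding has_X_deriv_def has_vector_derivative_iff_quotient
proof (intro ball_cong refl tendsto_cong)
  fix t assume t: "t \<in> {0..T}"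
  have "normX \<Omega> (sdiff (sscale (1 / (s - t)) (sdiff (w s) (w t))) (w' t))
      = norm ((1 / (s - t)) *\<^sub>R (embed_state \<Omega> (w s) - embed_state \<Omega> (w t)) - embed_state \<Omega> (w' t))"
    if s: "s \<in> {0..T}" for s
  proof -
    have L2: "L2_state \<Omega> (w s)" "L2_state \<Omega> (w t)" "L2_state \<Omega> (w' t)"
      using assms s t inX_imp_L2_state by blast+
    note d = embed_sdiff[OF L2(1,2)]
    note sc = embed_sscale[OF d(1), of "1 / (s - t)"]
    note dd = embed_sdiff[OF sc(1) L2(3)]
    show ?thesis using normX_eq_norm_embed[OF dd(1)] unfolding dd(2) sc(2) d(2) .
  qed
  then show "\<forall>\<^sub>F s in at t within {0..T}. normX \<Omega> (sdiff (sscale (1 / (s - t)) (sdiff (w s) (w t))) (w' t))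
      = norm ((1 / (s - t)) *\<^sub>R (embed_state \<Omega> (w s) - embed_state \<Omega> (w t)) - embed_state \<Omega> (w' t))"
    by (auto simp: eventually_at_filter)
qed

lemma X_continuous_iff:
  assumes "\<And>t. t \<in> {0..T} \<Longrightarrow> inX \<Omega> (w t)"
  shows "X_continuous \<Omega> T w \<longleftrightarrow> continuous_on {0..T} (\<lambda>s. embed_state \<Omega> (w s))"
proof -
  have "((\<lambda>s. normX \<Omega> (sdiff (w s) (w t))) \<longlongrightarrow> 0) (at t within {0..T}) \<longleftrightarrow>
      ((\<lambda>s. embed_state \<Omega> (w s)) \<longlongrightarrow> embed_state \<Omega> (w t)) (at t within {0..T})" if t: "t \<in> {0..T}" for t
  proof -
    have "normX \<Omega> (sdiff (w s) (w t)) = norm (embed_state \<Omega> (w s) - embed_state \<Omega> (w t))" if "s \<in> {0..T}" for s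
      using that t assms embed_sdiff[of \<Omega> "w s" "w t"] normX_eq_norm_embed inX_imp_L2_state by metis
    then have "((\<lambda>s. normX \<Omega> (sdiff (w s) (w t))) \<longlongrightarrow> 0) (at t within {0..T}) \<longleftrightarrow>
        ((\<lambda>s. norm (embed_state \<Omega> (w s) - embed_state \<Omega> (w t))) \<longlongrightarrow> 0) (at t within {0..T})"
      by (intro tendsto_cong) (auto simp: eventually_at_filter)
    then show ?thesis by (simp add: tendsto_norm_zero_iff LIM_zero_iff)
  qed
  then show ?thesis unfolding X_continuous_def continuous_on_def by (intro ball_cong refl)
qed

lemma normX_sdiff_eq_0_iff:
  assumes "inX \<Omega> s" "inX \<Omega> r"
  shows "normX \<Omega> (sdiff s r) = 0 \<longleftrightarrow> embed_state \<Omega> s = embed_state \<Omega> r"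
  using embed_sdiff[OF assms[THEN inX_imp_L2_state]] normX_eq_norm_embed by simp

text \<open>The data come as two pairs; assembled into one state, the two vanishing norms amount to
  equality of classes.\<close>

lemma initial_condition_iff:
  assumes "inX \<Omega> s" "H01 \<Omega> v" "H0Curl \<Omega> Q"
  shows "(case s of (u, G, P, C) \<Rightarrow>
      normH1 \<Omega> (\<lambda>x. u x - fst v x, \<lambda>x. G x - snd v x) = 0 \<and>
      normHCurl \<Omega> (\<lambda>x. P x - fst Q x, \<lambda>x. C x - snd Q x) = 0) \<longleftrightarrow>
    embed_state \<Omega> s = embed_state \<Omega> (fst v, snd v, fst Q, snd Q)"
proof -
  have "inX \<Omega> (fst v, snd v, fst Q, snd Q)" using assms unfolding inX_def by simp
  from normX_sdiff_eq_0_iff[OF assms(1) this] show ?thesis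
    by (cases s; cases v; cases Q) (simp add: sdiff_def normX_eq_0_iff)
qed

theorem mainTheorem2:
  fixes \<Omega> :: "pt set" and T \<rho> J \<mu> Lc :: real
    and Ce Cmicro Cc Laniso Cet Cmicrot Cct Lanisot :: tensor4
    and f :: "real \<Rightarrow> vfield \<times> mfield \<Rightarrow> real"
    and M :: "real \<Rightarrow> mfield \<times> mfield \<Rightarrow> real"
    and u0 u0' :: "vfield \<times> mfield" and P0 P0' :: "mfield \<times> mfield"
  assumes dom: "open \<Omega>" "connected \<Omega>" "bounded \<Omega>" "\<Omega> \<noteq> {}"
    and T: "T > 0"
    and sym: "sym_tensor Ce" "sym_tensor Cmicro" "sym_tensor Cet" "sym_tensor Cmicrot"
      "skew_tensor Cc" "skew_tensor Cct" "major_sym Laniso" "major_sym Lanisot"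
    and bnd: "\<exists>K\<ge>0. (\<forall>X. is_sym X \<longrightarrow> tapp Ce X \<bullet> X \<le> K * (norm X)\<^sup>2)
                 \<and> (\<forall>X. is_sym X \<longrightarrow> tapp Cmicro X \<bullet> X \<le> K * (norm X)\<^sup>2)
                 \<and> (\<forall>X. is_skew X \<longrightarrow> tapp Cc X \<bullet> X \<le> K * (norm X)\<^sup>2)
                 \<and> (\<forall>X. tapp Laniso X \<bullet> X \<le> K * (norm X)\<^sup>2)"
    and pd: "\<exists>m Mb. 0 < m \<and> m \<le> Mb
               \<and> (\<forall>X. is_sym X \<longrightarrow> m * (norm X)\<^sup>2 \<le> tapp Cet X \<bullet> X \<and> tapp Cet X \<bullet> X \<le> Mb * (norm X)\<^sup>2)
               \<and> (\<forall>X. m * (norm X)\<^sup>2 \<le> tapp Lanisot X \<bullet> X \<and> tapp Lanisot X \<bullet> X \<le> Mb * (norm X)\<^sup>2)"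
    and psd: "\<exists>K. (\<forall>X. is_sym X \<longrightarrow> 0 \<le> tapp Cmicrot X \<bullet> X \<and> tapp Cmicrot X \<bullet> X \<le> K * (norm X)\<^sup>2)
              \<and> (\<forall>X. is_skew X \<longrightarrow> 0 \<le> tapp Cct X \<bullet> X \<and> tapp Cct X \<bullet> X \<le> K * (norm X)\<^sup>2)"
    and load: "cont_dual \<Omega> T f M"
    and init: "H01 \<Omega> u0" "H0Curl \<Omega> P0" "H01 \<Omega> u0'" "H0Curl \<Omega> P0'"
    and params: "\<rho> > 0" "J > 0" "Lc > 0" "\<mu> > 0"
  shows "(\<exists>w. is_solution \<Omega> T \<rho> J \<mu> Lc Ce Cc Cmicro Laniso Cet Cct Cmicrot Lanisot f M u0 P0 u0' P0' w)
       \<and> (\<forall>w w'. is_solution \<Omega> T \<rho> J \<mu> Lc Ce Cc Cmicro Laniso Cet Cct Cmicrot Lanisot f M u0 P0 u0' P0' w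
              \<longrightarrow> is_solution \<Omega> T \<rho> J \<mu> Lc Ce Cc Cmicro Laniso Cet Cct Cmicrot Lanisot f M u0 P0 u0' P0' w'
              \<longrightarrow> (\<forall>t\<in>{0..T}. normX \<Omega> (sdiff (w t) (w' t)) = 0))"
proof -
  define a where "a = (lsq_form (energy_density \<rho> J \<mu> Lc Cet Cct Cmicrot Lanisot) :: (pt, point_state) lsq \<Rightarrow> _)"
  define b where "b = (lsq_form (energy_density 0 0 \<mu> Lc Ce Cc Cmicro Laniso) :: (pt, point_state) lsq \<Rightarrow> _)"
  define S where "S = energy_space \<Omega>"
  obtain m where m: "0 < m" "\<And>X. is_sym X \<Longrightarrow> m * (norm X)\<^sup>2 \<le> tapp Cet X \<bullet> X"
      "\<And>X. m * (norm X)\<^sup>2 \<le> tapp Lanisot X \<bullet> X"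
    using pd by blast
  have nonneg: "\<And>X. is_sym X \<Longrightarrow> 0 \<le> tapp Cmicrot X \<bullet> X" "\<And>X. is_skew X \<Longrightarrow> 0 \<le> tapp Cct X \<bullet> X"
    using psd by blast+
  obtain c where c: "c > 0" "\<And>X. X \<in> S \<Longrightarrow> c * (norm X)\<^sup>2 \<le> a X X"
    using energy_density_form_coercive[OF m nonneg params(1,2,4,3)] unfolding a_def S_def by blast
  have "a X Y = a Y X" for X Y
    unfolding a_def lsq_form_def using sym
    by (simp add: energy_density_commute[of Cet Cct Cmicrot Lanisot _ _ _ _ "rep_lsq X _"] sym_tensor_def skew_tensor_def)
  moreover have "bounded_bilinear a" "bounded_bilinear b"
    unfolding a_def b_def by (intro bounded_bilinear_lsq_form bounded_bilinear_energy_density)+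
  ultimately interpret coercive_evolution S a b c
    using c subspace_energy_space closed_energy_space unfolding S_def
    by (intro coercive_evolution.intro)
  have form: "W1 \<Omega> \<rho> J \<mu> Lc Cet Cct Cmicrot Lanisot s r + W2 \<Omega> \<mu> Lc Ce Cc Cmicro Laniso s' r
      = a (embed_state \<Omega> s) (embed_state \<Omega> r) + b (embed_state \<Omega> s') (embed_state \<Omega> r)"
    if "inX \<Omega> s" "inX \<Omega> s'" "inX \<Omega> r" for s s' r
    using that unfolding a_def b_def by (simp add: W1_eq_form W2_eq_form inX_imp_L2_state)
  have dual: "dual_H01 \<Omega> (f t)" "dual_H0Curl \<Omega> (M t)" if "t \<in> {0..T}" for t
    using load that unfolding cont_dual_def by auto
  \<comment> \<open>A representative state is chosen separately for each class, hence later for each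
    time. This is harmless: continuity and differentiability in time are statements about
    classes.\<close>
  define rp where "rp X = (SOME s. inX \<Omega> s \<and> embed_state \<Omega> s = X)" for X
  have rp: "inX \<Omega> (rp X)" "embed_state \<Omega> (rp X) = X" if "X \<in> S" for X
    using someI_ex[OF energy_space_representable[of \<Omega> X]] that dom(1) unfolding rp_def S_def by auto
  define s0 where "s0 = (fst u0, snd u0, fst P0, snd P0)"
  define s1 where "s1 = (fst u0', snd u0', fst P0', snd P0')"
  have s01: "inX \<Omega> s0" "inX \<Omega> s1" using init unfolding s0_def s1_def inX_def by auto
  define sol where "sol = is_solution \<Omega> T \<rho> J \<mu> Lc Ce Cc Cmicro Laniso Cet Cct Cmicrot Lanisot f M u0 P0 u0' P0'"
  \<comment> \<open>After this translation the problem speaks only of classes in the Hilbert space,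
    apart from the test states \<open>r\<close> and the load.\<close>
  have sol_iff: "sol w \<longleftrightarrow> (\<exists>w1 w2. (\<forall>t\<in>{0..T}. inX \<Omega> (w t) \<and> inX \<Omega> (w1 t) \<and> inX \<Omega> (w2 t)
        \<and> ((\<lambda>s. embed_state \<Omega> (w s)) has_vector_derivative embed_state \<Omega> (w1 t)) (at t within {0..T})
        \<and> ((\<lambda>s. embed_state \<Omega> (w1 s)) has_vector_derivative embed_state \<Omega> (w2 t)) (at t within {0..T})
        \<and> (\<forall>r. inX \<Omega> r \<longrightarrow> a (embed_state \<Omega> (w2 t)) (embed_state \<Omega> r)
            + b (embed_state \<Omega> (w t)) (embed_state \<Omega> r) = lfm (f t) (M t) r))
      \<and> continuous_on {0..T} (\<lambda>s. embed_state \<Omega> (w2 s))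
      \<and> embed_state \<Omega> (w 0) = embed_state \<Omega> s0 \<and> embed_state \<Omega> (w1 0) = embed_state \<Omega> s1)" for w
    unfolding sol_def is_solution_def
  proof (intro ex_cong1)
    fix w1 w2
    show "(C2X \<Omega> T w w1 w2 \<and>
       (\<forall>t\<in>{0..T}. \<forall>r. inX \<Omega> r \<longrightarrow>
          W1 \<Omega> \<rho> J \<mu> Lc Cet Cct Cmicrot Lanisot (w2 t) r + W2 \<Omega> \<mu> Lc Ce Cc Cmicro Laniso (w t) r
            = lfm (f t) (M t) r) \<and>
       (case w 0 of (u, G, P, C) \<Rightarrow>
          normH1 \<Omega> (\<lambda>x. u x - fst u0 x, \<lambda>x. G x - snd u0 x) = 0 \<and>
          normHCurl \<Omega> (\<lambda>x. P x - fst P0 x, \<lambda>x. C x - snd P0 x) = 0) \<and>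
       (case w1 0 of (u, G, P, C) \<Rightarrow>
          normH1 \<Omega> (\<lambda>x. u x - fst u0' x, \<lambda>x. G x - snd u0' x) = 0 \<and>
          normHCurl \<Omega> (\<lambda>x. P x - fst P0' x, \<lambda>x. C x - snd P0' x) = 0)) \<longleftrightarrow>
      ((\<forall>t\<in>{0..T}. inX \<Omega> (w t) \<and> inX \<Omega> (w1 t) \<and> inX \<Omega> (w2 t)
        \<and> ((\<lambda>s. embed_state \<Omega> (w s)) has_vector_derivative embed_state \<Omega> (w1 t)) (at t within {0..T})
        \<and> ((\<lambda>s. embed_state \<Omega> (w1 s)) has_vector_derivative embed_state \<Omega> (w2 t)) (at t within {0..T})
        \<and> (\<forall>r. inX \<Omega> r \<longrightarrow> a (embed_state \<Omega> (w2 t)) (embed_state \<Omega> r)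
            + b (embed_state \<Omega> (w t)) (embed_state \<Omega> r) = lfm (f t) (M t) r))
      \<and> continuous_on {0..T} (\<lambda>s. embed_state \<Omega> (w2 s))
      \<and> embed_state \<Omega> (w 0) = embed_state \<Omega> s0 \<and> embed_state \<Omega> (w1 0) = embed_state \<Omega> s1)"
      (is "?L \<longleftrightarrow> ?R")
    \<comment> \<open>The translations of derivatives and initial data presuppose membership in the
      state space; when it fails, both sides are false.\<close>
    proof (cases "\<forall>t\<in>{0..T}. inX \<Omega> (w t) \<and> inX \<Omega> (w1 t) \<and> inX \<Omega> (w2 t)")
      case True
      then have w0: "inX \<Omega> (w 0)" "inX \<Omega> (w1 0)" using T by auto
      show ?thesis
        unfolding C2X_def initial_condition_iff[OF w0(1) init(1,2), folded s0_def]
          initial_condition_iff[OF w0(2) init(3,4), folded s1_def]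
        using True form has_X_deriv_iff[of T \<Omega> w w1] has_X_deriv_iff[of T \<Omega> w1 w2] X_continuous_iff[of T \<Omega> w2]
        by (auto simp del: atLeastAtMost_iff)
    next
      case False
      then show ?thesis unfolding C2X_def by blast
    qed
  qed
  \<comment> \<open>The load as a family of functionals on classes, independent of the chosen
    representative by \<open>lfm_cong\<close>.\<close>
  define l where "l t X = lfm (f t) (M t) (rp X)" for t X
  have l: "l t (embed_state \<Omega> r) = lfm (f t) (M t) r" if "t \<in> {0..T}" "inX \<Omega> r" for t r
    unfolding l_def using rp[of "embed_state \<Omega> r"] that
    by (intro lfm_cong[OF dual]) (auto simp: S_def inX_iff)
  have l_lin: "l t (p *\<^sub>R X + q *\<^sub>R Y) = p * l t X + q * l t Y"
    if "t \<in> {0..T}" "X \<in> S" "Y \<in> S" for t p q X Y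
  proof -
    have "embed_state \<Omega> (slincomb p (rp X) q (rp Y)) = p *\<^sub>R X + q *\<^sub>R Y"
      using rp that by (simp add: embed_slincomb inX_imp_L2_state)
    then have "l t (p *\<^sub>R X + q *\<^sub>R Y) = lfm (f t) (M t) (slincomb p (rp X) q (rp Y))"
      using l[of t "slincomb p (rp X) q (rp Y)"] rp that inX_slincomb by metis
    also have "\<dots> = p * l t X + q * l t Y"
      unfolding l_def using that by (intro lfm_slincomb[where \<Omega> = \<Omega>] dual rp(1))
    finally show ?thesis .
  qed
  have "\<exists>w. sol w"
  proof -
    have "\<exists>w w1 w2. (\<forall>t\<in>{0..T}. w t \<in> S \<and> w1 t \<in> S \<and> w2 t \<in> S
        \<and> (w has_vector_derivative w1 t) (at t within {0..T})
        \<and> (w1 has_vector_derivative w2 t) (at t within {0..T})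
        \<and> (\<forall>r\<in>S. a (w2 t) r + b (w t) r = l t r))
      \<and> continuous_on {0..T} w2 \<and> w 0 = embed_state \<Omega> s0 \<and> w1 0 = embed_state \<Omega> s1"
    proof (rule evolution_exists)
      show "embed_state \<Omega> s0 \<in> S" "embed_state \<Omega> s1 \<in> S" using s01 by (auto simp: S_def inX_iff)
      show "l t (x + y) = l t x + l t y" if "t \<in> {0..T}" "x \<in> S" "y \<in> S" for t x y
        using l_lin[OF that, of 1 1] by simp
      show "l t (r *\<^sub>R x) = r * l t x" if "t \<in> {0..T}" "x \<in> S" for t x r
        using l_lin[OF that that(2), of r 0] by simp
      show "\<exists>K. \<forall>x\<in>S. \<bar>l t x\<bar> \<le> K * norm x" if "t \<in> {0..T}" for t
        using lfm_bounded[OF dual[OF that]] rp unfolding l_def by metis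
      show "\<exists>\<delta>>0. \<forall>s\<in>{0..T}. \<bar>s - t\<bar> < \<delta> \<longrightarrow> (\<forall>x\<in>S. \<bar>l s x - l t x\<bar> \<le> \<epsilon> * norm x)"
        if "t \<in> {0..T}" "0 < \<epsilon>" for t \<epsilon>
        using lfm_continuous[OF load that] rp unfolding l_def by metis
    qed (use T in simp)
    then obtain w w1 w2 where S: "\<And>t. t \<in> {0..T} \<Longrightarrow> w t \<in> S \<and> w1 t \<in> S \<and> w2 t \<in> S"
      and w: "\<And>t. t \<in> {0..T} \<Longrightarrow> (w has_vector_derivative w1 t) (at t within {0..T})"
      and w1: "\<And>t. t \<in> {0..T} \<Longrightarrow> (w1 has_vector_derivative w2 t) (at t within {0..T})"
      and eq: "\<And>t r. t \<in> {0..T} \<Longrightarrow> r \<in> S \<Longrightarrow> a (w2 t) r + b (w t) r = l t r"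
      and w2: "continuous_on {0..T} w2" and w0: "w 0 = embed_state \<Omega> s0" "w1 0 = embed_state \<Omega> s1"
      by blast
    have em: "embed_state \<Omega> (rp (w t)) = w t" "embed_state \<Omega> (rp (w1 t)) = w1 t"
        "embed_state \<Omega> (rp (w2 t)) = w2 t" if "t \<in> {0..T}" for t
      using rp S that by auto
    have "sol (\<lambda>t. rp (w t))"
      unfolding sol_iff
    proof (rule exI[of _ "\<lambda>t. rp (w1 t)"], rule exI[of _ "\<lambda>t. rp (w2 t)"],
        intro conjI ballI allI impI)
      fix t assume t: "t \<in> {0..T}"
      show "inX \<Omega> (rp (w t))" "inX \<Omega> (rp (w1 t))" "inX \<Omega> (rp (w2 t))" using rp S t by auto
      show "((\<lambda>s. embed_state \<Omega> (rp (w s))) has_vector_derivative embed_state \<Omega> (rp (w1 t))) (at t within {0..T})"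
        using has_vector_derivative_transform[OF t em(1) w[OF t]] em(2)[OF t] by simp
      show "((\<lambda>s. embed_state \<Omega> (rp (w1 s))) has_vector_derivative embed_state \<Omega> (rp (w2 t))) (at t within {0..T})"
        using has_vector_derivative_transform[OF t em(2) w1[OF t]] em(3)[OF t] by simp
      show "a (embed_state \<Omega> (rp (w2 t))) (embed_state \<Omega> r) + b (embed_state \<Omega> (rp (w t))) (embed_state \<Omega> r)
          = lfm (f t) (M t) r" if "inX \<Omega> r" for r
        using eq[OF t, of "embed_state \<Omega> r"] l[OF t that] that em[OF t] by (simp add: S_def inX_iff)
    next
      show "continuous_on {0..T} (\<lambda>s. embed_state \<Omega> (rp (w2 s)))"
        using continuous_on_cong[OF refl em(3), of "{0..T}"] w2 by simp
    qed (use em[of 0] w0 T in auto)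
    then show ?thesis by blast
  qed
  moreover have "normX \<Omega> (sdiff (w t) (v t)) = 0" if w: "sol w" and v: "sol v" and t: "t \<in> {0..T}" for w v t
  proof -
    define e where "e = embed_state \<Omega>"
    obtain w1 w2 where w': "\<And>t. t \<in> {0..T} \<Longrightarrow> inX \<Omega> (w t) \<and> inX \<Omega> (w2 t)"
        "\<And>t. t \<in> {0..T} \<Longrightarrow> ((\<lambda>s. e (w s)) has_vector_derivative e (w1 t)) (at t within {0..T})"
        "\<And>t. t \<in> {0..T} \<Longrightarrow> ((\<lambda>s. e (w1 s)) has_vector_derivative e (w2 t)) (at t within {0..T})"
        "\<And>t r. t \<in> {0..T} \<Longrightarrow> inX \<Omega> r \<Longrightarrow> a (e (w2 t)) (e r) + b (e (w t)) (e r) = lfm (f t) (M t) r"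
        "e (w 0) = e s0" "e (w1 0) = e s1"
      using w unfolding sol_iff e_def by blast
    obtain v1 v2 where v': "\<And>t. t \<in> {0..T} \<Longrightarrow> inX \<Omega> (v t) \<and> inX \<Omega> (v2 t)"
        "\<And>t. t \<in> {0..T} \<Longrightarrow> ((\<lambda>s. e (v s)) has_vector_derivative e (v1 t)) (at t within {0..T})"
        "\<And>t. t \<in> {0..T} \<Longrightarrow> ((\<lambda>s. e (v1 s)) has_vector_derivative e (v2 t)) (at t within {0..T})"
        "\<And>t r. t \<in> {0..T} \<Longrightarrow> inX \<Omega> r \<Longrightarrow> a (e (v2 t)) (e r) + b (e (v t)) (e r) = lfm (f t) (M t) r"
        "e (v 0) = e s0" "e (v1 0) = e s1"
      using v unfolding sol_iff e_def by blast
    have "e (w t) - e (v t) = 0"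
    proof (rule evolution_unique[where w = "\<lambda>t. e (w t) - e (v t)" and T = T])
      show "((\<lambda>t. e (w t) - e (v t)) has_vector_derivative e (w1 s) - e (v1 s)) (at s within {0..T})"
        if "s \<in> {0..T}" for s
        by (intro has_vector_derivative_diff w'(2) v'(2) that)
      show "((\<lambda>s. e (w1 s) - e (v1 s)) has_vector_derivative e (w2 s) - e (v2 s)) (at s within {0..T})"
        if "s \<in> {0..T}" for s
        by (intro has_vector_derivative_diff w'(3) v'(3) that)
      show "e (w2 s) - e (v2 s) \<in> S" if "s \<in> {0..T}" for s
        using w'(1)[OF that] v'(1)[OF that] subspace_energy_space[of \<Omega>]
        by (simp add: S_def e_def inX_iff subspace_diff)
      \<comment> \<open>The weak equations are stated for states, so \<open>r\<close> is tested
        through its representative \<open>rp r\<close>; the load cancels in the difference.\<close>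
      show "a (e (w2 s) - e (v2 s)) r + b (e (w s) - e (v s)) r = 0" if s: "s \<in> {0..T}" and r: "r \<in> S" for s r
        using w'(4)[OF s rp(1)[OF r]] v'(4)[OF s rp(1)[OF r]] rp(2)[OF r]
        by (simp add: e_def bounded_bilinear.diff_left[OF a] bounded_bilinear.diff_left[OF b])
    qed (use w'(5,6) v'(5,6) t in auto)
    then show ?thesis
      using normX_sdiff_eq_0_iff[of \<Omega> "w t" "v t"] w'(1)[OF t] v'(1)[OF t] unfolding e_def by simp
  qed
  ultimately show ?thesis unfolding sol_def by blast
qed

end
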